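(* Let $F=F[A,B]$ be a bipartite graph with parts $A,B$, $|A|\leq|B|$, and let $F^{good}$ be a good odd-ballooning of $F$. Set $q=q(\mathcal{M}(F^{good}))$. Then for sufficiently large $n$, every graph $G\in{\rm EX}(n,F^{good})$ has a partition $V(G)=W\cup S_1\cup S_2$ such that: (i) $|W|=q-1$ and $|S_i|\in\{\lfloor\frac{n-q+1}{2}\rfloor,\lceil\frac{n-q+1}{2}\rceil\}$ for $i=1,2$; (ii) there is a constant $M=M(|F^{good}|)$ such that for $i=1,2$ there exists $S'_i\subseteq S_i$ with $|S_i\setminus S'_i|\leq M$ and $N_G(v)=V(G)\setminus S_i$ for every $v\in S'_i$.
   Context: All graphs are finite and simple. ${\rm EX}(n,H)$ is the set of $H$-free $n$-vertex graphs with maximum number of edges. An odd-ballooning of a graph $F$ is obtained from $F$ by replacing each edge by an odd cycle through that edge, all new vertices of distinct cycles being distinct. For bipartite $F=F[A,B]$ with $|A|\leq|B|$, an odd-ballooning is good if a replacing cycle may be a triangle only when the corresponding edge is incident with a leaf (degree-1 vertex) in $B$. For a finite family $\mathcal{H}$ with $\min\chi=r+1\geq3$ (here $r=2$), the decomposition family $\mathcal{M}(\mathcal{H})$ is the family of minimal graphs $M$ without isolated vertices such that some $H\in\mathcal{H}$ satisfies $H\subseteq(M\cup\overline{K_t})\bigotimes T((r-1)t,r-1)$, $t=|H|$, where $\cup$ is disjoint union, $\bigotimes$ is the join and $T(\cdot,\cdot)$ the Turán graph. For bipartite $B'$, $q(B')$ is the minimum size of an independent set meeting every edge of $B'$; for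 a family $\mathcal{M}$ containing bipartite graphs, $q(\mathcal{M})$ is the minimum of $q(B')$ over bipartite $B'\in\mathcal{M}$. *)

theory Defs
  imports Complex_Main
begin

type_synonym 'a graph = "'a set \<times> 'a set set"

abbreviation verts :: "'a graph \<Rightarrow> 'a set" where "verts \<equiv> fst"
abbreviation edges :: "'a graph \<Rightarrow> 'a set set" where "edges \<equiv> snd"

definition simple_graph :: "'a graph \<Rightarrow> bool" where
  "simple_graph G \<longleftrightarrow> finite (verts G) \<and> (\<forall>e \<in> edges G. e \<subseteq> verts G \<and> card e = 2)"

definition nbhd :: "'a graph \<Rightarrow> 'a \<Rightarrow> 'a set" where
  "nbhd G v = {u. {v, u} \<in> edges G}"

definition degree :: "'a graph \<Rightarrow> 'a \<Rightarrow> nat" where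
  "degree G v = card (nbhd G v)"

definition subgraph :: "'a graph \<Rightarrow> 'a graph \<Rightarrow> bool" where
  "subgraph H G \<longleftrightarrow> verts H \<subseteq> verts G \<and> edges H \<subseteq> edges G"

text \<open>\<open>embeds H G\<close>: \<open>G\<close> has a (not necessarily induced) subgraph isomorphic to \<open>H\<close>. The vertex
  types may differ.\<close>

definition embeds :: "'a graph \<Rightarrow> 'b graph \<Rightarrow> bool" where
  "embeds H G \<longleftrightarrow> (\<exists>f. inj_on f (verts H) \<and> f ` verts H \<subseteq> verts G \<and>
     (\<forall>e \<in> edges H. f ` e \<in> edges G))"

text \<open>Up to isomorphism every finite graph has natural numbers as vertices, so extremal graphs are
  taken over that type.\<close>

definition extremal :: "nat \<Rightarrow> 'a graph \<Rightarrow> nat graph set" where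
  "extremal n H = {G. simple_graph G \<and> card (verts G) = n \<and> \<not> embeds H G \<and>
     (\<forall>G' :: nat graph. simple_graph G' \<and> card (verts G') = n \<and> \<not> embeds H G' \<longrightarrow>
        card (edges G') \<le> card (edges G))}"

definition bipartition :: "'a graph \<Rightarrow> 'a set \<Rightarrow> 'a set \<Rightarrow> bool" where
  "bipartition G A B \<longleftrightarrow> A \<union> B = verts G \<and> A \<inter> B = {} \<and>
     (\<forall>e \<in> edges G. \<exists>a \<in> A. \<exists>b \<in> B. e = {a, b})"

definition bipartite :: "'a graph \<Rightarrow> bool" where
  "bipartite G \<longleftrightarrow> (\<exists>A B. bipartition G A B)"

definition chromatic_number :: "'a graph \<Rightarrow> nat" where
  "chromatic_number G = (LEAST k. \<exists>c. c ` verts G \<subseteq> {..<k} \<and>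
     (\<forall>u v. {u, v} \<in> edges G \<longrightarrow> c u \<noteq> (c v :: nat)))"

definition cycle_graph :: "'a graph \<Rightarrow> bool" where
  "cycle_graph C \<longleftrightarrow> (\<exists>xs. distinct xs \<and> 3 \<le> length xs \<and> verts C = set xs \<and>
     edges C = {{xs ! i, xs ! (Suc i mod length xs)} | i. i < length xs})"

text \<open>\<open>C e\<close> is the odd cycle replacing the edge \<open>e\<close>. It passes through \<open>e\<close>, and \<open>verts (C e) - e\<close>
  are its new vertices.\<close>

definition odd_ballooning_by :: "'a graph \<Rightarrow> ('a set \<Rightarrow> 'a graph) \<Rightarrow> 'a graph \<Rightarrow> bool" where
  "odd_ballooning_by F C H \<longleftrightarrow>
     (\<forall>e \<in> edges F. cycle_graph (C e) \<and> odd (card (verts (C e))) \<and>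
        e \<in> edges (C e) \<and> verts (C e) \<inter> verts F = e) \<and>
     (\<forall>e \<in> edges F. \<forall>e' \<in> edges F. e \<noteq> e' \<longrightarrow> (verts (C e) - e) \<inter> (verts (C e') - e') = {}) \<and>
     H = (verts F \<union> (\<Union>e \<in> edges F. verts (C e)), edges F \<union> (\<Union>e \<in> edges F. edges (C e)))"

text \<open>\<open>F\<close> is bipartite and \<open>B\<close> is a part of a fixed bipartition, at least as large as the other part.\<close>

definition good_odd_ballooning :: "'a graph \<Rightarrow> 'a set \<Rightarrow> 'a graph \<Rightarrow> bool" where
  "good_odd_ballooning F B H \<longleftrightarrow>
     (\<exists>C. odd_ballooning_by F C H \<and>
        (\<forall>e \<in> edges F. card (verts (C e)) = 3 \<longrightarrow> (\<exists>b \<in> B. b \<in> e \<and> degree F b = 1)))"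

definition disjoint_union :: "'a graph \<Rightarrow> 'b graph \<Rightarrow> ('a + 'b) graph" where
  "disjoint_union G H =
     (Inl ` verts G \<union> Inr ` verts H, (`) Inl ` edges G \<union> (`) Inr ` edges H)"

definition join :: "'a graph \<Rightarrow> 'b graph \<Rightarrow> ('a + 'b) graph" where
  "join G H = (verts (disjoint_union G H),
     edges (disjoint_union G H) \<union> {{Inl u, Inr v} | u v. u \<in> verts G \<and> v \<in> verts H})"

definition edgeless_graph :: "nat \<Rightarrow> nat graph" where
  "edgeless_graph t = ({..<t}, {})"

definition turan_graph :: "nat \<Rightarrow> nat \<Rightarrow> nat graph" where
  "turan_graph n r = ({..<n}, {{i, j} | i j. i < n \<and> j < n \<and> i mod r \<noteq> j mod r})"

definition no_isolated_vertices :: "'a graph \<Rightarrow> bool" where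
  "no_isolated_vertices G \<longleftrightarrow> (\<forall>v \<in> verts G. nbhd G v \<noteq> {})"

definition decomposes :: "'a graph set \<Rightarrow> nat graph \<Rightarrow> bool" where
  "decomposes \<H> M \<longleftrightarrow> simple_graph M \<and> no_isolated_vertices M \<and>
     (let r = Min (chromatic_number ` \<H>) - 1 in
      \<exists>H \<in> \<H>. let t = card (verts H) in
        embeds H (join (disjoint_union M (edgeless_graph t)) (turan_graph ((r - 1) * t) (r - 1))))"

text \<open>The family is closed under isomorphism. It is meant for finite nonempty families \<open>\<H>\<close> with
  minimum chromatic number at least 3.\<close>

definition decomposition_family :: "'a graph set \<Rightarrow> nat graph set" where
  "decomposition_family \<H> =
     {M. decomposes \<H> M \<and> (\<forall>M'. subgraph M' M \<and> decomposes \<H> M' \<longrightarrow> M' = M)}"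

definition independent_set :: "'a graph \<Rightarrow> 'a set \<Rightarrow> bool" where
  "independent_set G S \<longleftrightarrow> S \<subseteq> verts G \<and> (\<forall>u \<in> S. \<forall>v \<in> S. {u, v} \<notin> edges G)"

text \<open>The infimum of a nonempty set of natural numbers is attained, so \<open>Inf\<close> is a minimum in both
  definitions below. An independent set meeting every edge exists exactly in bipartite graphs.\<close>

definition q_graph :: "'a graph \<Rightarrow> nat" where
  "q_graph G = Inf {card S | S. independent_set G S \<and> (\<forall>e \<in> edges G. S \<inter> e \<noteq> {})}"

definition q_family :: "'a graph set \<Rightarrow> nat" where
  "q_family \<M> = Inf {q_graph G | G. G \<in> \<M> \<and> bipartite G}"

end

theory Submission
  imports Defs
begin

text \<open>Deleting an independent set of \<open>q - 1\<close> vertices never makes \<open>H\<close> bipartite, so the join of \<open>q - 1\<close>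
  independent vertices with a balanced complete bipartite graph is \<open>H\<close>-free and bounds the number of
  edges of an extremal graph \<open>G\<close> from below. Conversely \<open>H\<close> embeds into a complete tripartite graph
  with a part of size \<open>q\<close>, and into a complete bipartite graph with a matching added on one side.
  The first embedding makes few neighbourhoods dense, and the neighbourhood of a vertex of maximum
  degree among the remaining ones yields an almost complete bipartition. The second embedding,
  together with a minimum degree bound, leaves a set \<open>W\<close> of bounded size whose removal makes \<open>G\<close>
  bipartite. Classify the other vertices by their neighbours in \<open>W\<close>. If \<open>x\<close> and \<open>y\<close> are the largest
  sizes of frequent types on the two sides, the edge count forces \<open>x + y = card W + q - 1\<close> exactly,
  and then all but boundedly many vertices have the same type \<open>X\<close> on one side and the same type \<open>Y\<close>
  on the other, with \<open>card (X \<inter> Y) = q - 1\<close> and \<open>X \<union> Y = W\<close>. Adding \<open>W - X\<close> and \<open>W - Y\<close> to the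
  two sides gives the partition. It is balanced because in an extremal graph no vertex gains from
  being reattached to the common neighbourhood of many others.\<close>

text \<open>The decomposition family is linked to \<open>H\<close> by proper 3-colourings:
  \<open>q\<close> is the least possible size of class 2. Colourings of \<open>F\<close> extend over
  the odd cycles, so the colourings behind the embeddings are built on \<open>F\<close>. With 0 on
  \<open>A\<close> and 1 on \<open>B\<close>, colour 2 appears once inside each cycle, next to the
  end in \<open>A\<close>. It touches the end in \<open>B\<close> only in a triangle, and then
  goodness makes that end a leaf, so the edges between classes 1 and 2 form a matching.

  The obstacle in the edge count is the size of its error. A small multiple of \<open>n\<close> is
  good enough to recover an integer, but the theorem demands a bounded number of exceptions. Hence
  the count is done twice. At first a type is frequent from a small multiple of \<open>n\<close> on,
  which settles \<open>x + y\<close>. This value leaves at most \<open>h\<close> vertices in any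
  larger type, so the second count, with threshold \<open>h\<close>, has bounded error. The first
  threshold depends on the size of \<open>W\<close>, which must therefore be bounded before the
  closeness to a complete bipartite graph is chosen.\<close>

lemma simple_graphD:
  assumes "simple_graph G" "{u, v} \<in> edges G"
  shows "u \<noteq> v" "u \<in> verts G" "v \<in> verts G"
  using assms by (auto simp: simple_graph_def)

lemma finite_edges: "simple_graph G \<Longrightarrow> finite (edges G)"
  by (rule finite_subset[of _ "Pow (verts G)"]) (auto simp: simple_graph_def)

lemma nbhd_subset: "simple_graph G \<Longrightarrow> nbhd G v \<subseteq> verts G"
  by (auto simp: nbhd_def dest: simple_graphD)

lemma finite_nbhd: "simple_graph G \<Longrightarrow> finite (nbhd G v)"
  by (meson finite_subset nbhd_subset simple_graph_def)

lemma mem_nbhd: "u \<in> nbhd G v \<longleftrightarrow> {v, u} \<in> edges G"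
  by (simp add: nbhd_def)

lemma nbhd_sym: "u \<in> nbhd G v \<longleftrightarrow> v \<in> nbhd G u"
  by (simp add: nbhd_def insert_commute)

text \<open>Ordered pairs, so an edge inside \<open>S\<close> counts twice in
  \<open>pairs G S S\<close>. The count is then additive in both arguments and a sum of degrees,
  even if \<open>S\<close> and \<open>T\<close> overlap.\<close>

definition pairs :: "'a graph \<Rightarrow> 'a set \<Rightarrow> 'a set \<Rightarrow> ('a \<times> 'a) set" where
  "pairs G S T = (SIGMA u:S. nbhd G u \<inter> T)"

lemma finite_pairs: "finite S \<Longrightarrow> finite T \<Longrightarrow> finite (pairs G S T)"
  by (auto simp: pairs_def)

lemma card_pairs: "finite S \<Longrightarrow> finite T \<Longrightarrow> card (pairs G S T) = (\<Sum>u\<in>S. card (nbhd G u \<inter> T))"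
  by (simp add: pairs_def)

lemma card_pairs_mono:
  "finite S' \<Longrightarrow> finite T' \<Longrightarrow> S \<subseteq> S' \<Longrightarrow> T \<subseteq> T' \<Longrightarrow> card (pairs G S T) \<le> card (pairs G S' T')"
  by (rule card_mono[OF finite_pairs]) (auto simp: pairs_def)

lemma card_pairs_sym: "card (pairs G S T) = card (pairs G T S)"
proof -
  have "pairs G T S = prod.swap ` pairs G S T"
    by (auto simp: pairs_def nbhd_sym image_iff)
  then show ?thesis
    by (simp add: card_image)
qed

lemma card_pairs_Un_left:
  assumes "finite S" "finite S'" "finite T" "S \<inter> S' = {}"
  shows "card (pairs G (S \<union> S') T) = card (pairs G S T) + card (pairs G S' T)"
  using assms by (simp add: card_pairs sum.union_disjoint)

lemma card_pairs_Un_right: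
  assumes "finite S" "finite T" "finite T'" "T \<inter> T' = {}"
  shows "card (pairs G S (T \<union> T')) = card (pairs G S T) + card (pairs G S T')"
  using card_pairs_Un_left[of T T' S G] assms by (simp add: card_pairs_sym)

lemma card_pairs_le: "finite S \<Longrightarrow> finite T \<Longrightarrow> card (pairs G S T) \<le> card S * card T"
  unfolding pairs_def card_cartesian_product[symmetric] by (rule card_mono) auto

lemma handshake:
  assumes "simple_graph G"
  shows "card (pairs G (verts G) (verts G)) = 2 * card (edges G)"
proof -
  have fin: "finite (edges G)"
    using assms by (rule finite_edges)
  define P where "P e = {(u, v). e = {u, v}}" for e :: "'a set"
  have P: "finite (P e) \<and> card (P e) = 2" if "e \<in> edges G" for e
  proof -
    have "card e = 2" using assms that by (simp add: simple_graph_def)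
    then obtain u v where "e = {u, v}" "u \<noteq> v" by (auto simp: card_2_iff)
    then have "P e = {(u, v), (v, u)}"
      by (auto simp: P_def doubleton_eq_iff)
    with \<open>u \<noteq> v\<close> show ?thesis by simp
  qed
  have "pairs G (verts G) (verts G) = (\<Union>e\<in>edges G. P e)"
    using assms by (auto simp: pairs_def P_def mem_nbhd dest: simple_graphD)
  moreover have "card (\<Union>e\<in>edges G. P e) = (\<Sum>e\<in>edges G. card (P e))"
    using fin P by (intro card_UN_disjoint) (auto simp: P_def)
  ultimately show ?thesis using P by simp
qed

text \<open>Each point lying in at least \<open>q\<close> of the sets selects a \<open>q\<close>-subset of the index set, and there
  are at most \<open>2 ^ card I\<close> of these.\<close>

lemma popular_intersection:
  fixes \<epsilon> :: real
  assumes fin: "finite X" "finite I" and I: "I \<noteq> {}"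
    and S: "\<And>i. i \<in> I \<Longrightarrow> S i \<subseteq> X" "\<And>i. i \<in> I \<Longrightarrow> \<epsilon> * card X \<le> card (S i)"
    and eps: "0 < \<epsilon>" "\<epsilon> \<le> 1" and q: "real q \<le> \<epsilon> / 2 * card I"
  shows "\<exists>Q\<subseteq>I. card Q = q \<and> \<epsilon> / 2 / 2 ^ card I * card X \<le> card {x\<in>X. \<forall>i\<in>Q. x \<in> S i}"
proof -
  define N where "N = card I"
  have N: "N > 0" using fin I by (simp add: N_def card_gt_0_iff)
  define D where "D = {x\<in>X. q \<le> card {i\<in>I. x \<in> S i}}"
  have DX: "D \<subseteq> X" by (auto simp: D_def)
  have finD: "finite D" using fin DX finite_subset by blast
  have "(\<Sum>i\<in>I. card (S i)) = (\<Sum>i\<in>I. card {x\<in>X. x \<in> S i})"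
    using S(1) by (intro sum.cong refl arg_cong[of _ _ card]) auto
  also have "\<dots> = (\<Sum>x\<in>X. card {i\<in>I. x \<in> S i})"
    by (rule sum_multicount_gen) (use fin in auto)
  \<comment> \<open>Points outside \<open>D\<close> lie in fewer than \<open>q\<close> sets, points
    of \<open>D\<close> in at most \<open>N\<close>. By the bound on \<open>q\<close>, the
    \<open>q\<close> terms make up at most half of the total, so \<open>D\<close> must account for
    the other half.\<close>
  also have "\<dots> \<le> (\<Sum>x\<in>X. (if x \<in> D then N else 0) + q)"
  proof (rule sum_mono)
    fix x assume "x \<in> X"
    have "card {i\<in>I. x \<in> S i} \<le> N" unfolding N_def by (rule card_mono) (use fin in auto)
    then show "card {i\<in>I. x \<in> S i} \<le> (if x \<in> D then N else 0) + q"
      using \<open>x \<in> X\<close> by (auto simp: D_def)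
  qed
  also have "\<dots> = N * card D + q * card X"
    using fin DX by (simp add: sum.distrib sum.If_cases Int_absorb1)
  finally have "real (\<Sum>i\<in>I. card (S i)) \<le> real (N * card D + q * card X)"
    by (simp only: of_nat_le_iff)
  moreover have "N * (\<epsilon> * card X) \<le> real (\<Sum>i\<in>I. card (S i))"
    using sum_mono[of I "\<lambda>_. \<epsilon> * card X" "\<lambda>i. real (card (S i))"] S(2) by (simp add: N_def)
  moreover have "q * real (card X) \<le> \<epsilon> / 2 * N * card X"
    using mult_right_mono[OF q] by (simp add: N_def)
  ultimately have "N * (\<epsilon> / 2 * card X) \<le> N * real (card D)"
    by (simp add: algebra_simps)
  then have D: "\<epsilon> / 2 * card X \<le> card D" using N by simp
  define \<Q> where "\<Q> = {Q. Q \<subseteq> I \<and> card Q = q}"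
  define Y where "Y Q = {x\<in>X. \<forall>i\<in>Q. x \<in> S i}" for Q
  have fQ: "finite \<Q>" and cQ: "card \<Q> \<le> 2 ^ N"
    using fin card_mono[of "Pow I" \<Q>] by (auto simp: \<Q>_def N_def card_Pow)
  have "D \<subseteq> (\<Union>Q\<in>\<Q>. Y Q)"
  proof
    fix x assume "x \<in> D"
    then obtain Q where "Q \<subseteq> {i\<in>I. x \<in> S i}" "card Q = q"
      unfolding D_def by (metis (lifting) mem_Collect_eq obtain_subset_with_card_n)
    then show "x \<in> (\<Union>Q\<in>\<Q>. Y Q)"
      using \<open>x \<in> D\<close> DX by (auto simp: \<Q>_def Y_def)
  qed
  then have "card D \<le> (\<Sum>Q\<in>\<Q>. card (Y Q))"
    using card_mono[of "\<Union>Q\<in>\<Q>. Y Q" D] card_UN_le[OF fQ, of Y] fin fQ by (force simp: Y_def)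
  then have "real (card D) \<le> (\<Sum>Q\<in>\<Q>. real (card (Y Q)))"
    by (metis of_nat_le_iff of_nat_sum)
  show ?thesis
  proof (rule ccontr)
    assume none: "\<not> ?thesis"
    define r where "r = \<epsilon> / 2 / 2 ^ N * card X"
    have small: "real (card (Y Q)) < r" if "Q \<in> \<Q>" for Q
      using none that by (force simp: r_def \<Q>_def Y_def N_def)
    have "r \<ge> 0" unfolding r_def
      using eps by simp
    \<comment> \<open>The strict comparison of sums below needs at least one
      \<open>q\<close>-subset; it exists because \<open>q \<le> card I\<close>.\<close>
    have "\<Q> \<noteq> {}"
    proof
      assume "\<Q> = {}"
      have "\<epsilon> / 2 * N \<le> real N"
      proof -
        show ?thesis using mult_right_mono[of "\<epsilon> / 2" 1 "real N"] eps by simp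
      qed
      then have "q \<le> N" using q by (simp add: N_def)
      then show False using \<open>\<Q> = {}\<close> obtain_subset_with_card_n[of q I] by (auto simp: \<Q>_def N_def)
    qed
    then have "(\<Sum>Q\<in>\<Q>. real (card (Y Q))) < (\<Sum>Q\<in>\<Q>. r)"
      using small fQ by (intro sum_strict_mono) auto
    also have "\<dots> \<le> 2 ^ N * r"
      using cQ \<open>r \<ge> 0\<close> by (simp add: mult_right_mono numeral_power_le_of_nat_cancel_iff)
    finally show False
      using \<open>real (card D) \<le> _\<close> D by (simp add: r_def)
  qed
qed

section \<open>Stability and minimum degree\<close>

text \<open>The Kovari-Sos-Turan argument: many vertices have linearly many
  \<open>R\<close>-successors, and among \<open>k\<close> of them some \<open>t\<close> share at
  least \<open>t\<close>. A relation takes the place of a graph because the lemma is applied to the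
  adjacent pairs lying in several neighbourhoods at once.\<close>

lemma complete_bipartite_in_dense:
  fixes \<eta> :: real
  assumes \<eta>: "0 < \<eta>" "\<eta> \<le> 1"
  shows "\<exists>N. \<forall>(V :: 'a set) R. finite V \<and> N \<le> card V \<and> R \<subseteq> V \<times> V \<and> \<eta> * (card V)\<^sup>2 \<le> card R \<longrightarrow>
    (\<exists>X Y. X \<subseteq> V \<and> Y \<subseteq> V \<and> card X = t \<and> card Y = t \<and> X \<times> Y \<subseteq> R)"
proof -
  \<comment> \<open>\<open>popular_intersection\<close> is applied with density
    \<open>\<eta> / 2\<close> and thus asks for \<open>t \<le> \<eta> / 4 * k\<close>. The two terms
    of \<open>N\<close> provide \<open>k\<close> vertices with many successors and \<open>t\<close>
    common successors.\<close>
  define k where "k = nat \<lceil>4 * t / \<eta>\<rceil> + 1"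
  have "4 * t / \<eta> \<le> k" unfolding k_def by linarith
  then have k: "real t \<le> \<eta> / 2 / 2 * k" "k > 0"
    using \<eta> by (auto simp: field_simps k_def)
  define N where "N = nat \<lceil>2 * k / \<eta>\<rceil> + nat \<lceil>4 * 2 ^ k * t / \<eta>\<rceil>"
  have N: "2 * k / \<eta> \<le> N" "4 * 2 ^ k * t / \<eta> \<le> N"
    unfolding N_def by linarith+
  have "\<exists>X Y. X \<subseteq> V \<and> Y \<subseteq> V \<and> card X = t \<and> card Y = t \<and> X \<times> Y \<subseteq> R"
    if V: "finite V" "N \<le> card V" and R: "R \<subseteq> V \<times> V" "\<eta> * (card V)\<^sup>2 \<le> card R" for V :: "'a set" and R
  proof -
    define n where "n = card V"
    have "2 * k / \<eta> \<le> n" "4 * 2 ^ k * t / \<eta> \<le> n"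
      using N V by (simp_all add: n_def)
    then have n: "k \<le> \<eta> / 2 * n" "t \<le> \<eta> / 2 / 2 / 2 ^ k * n"
      using \<eta> by (simp_all add: field_simps)
    have "n > 0" using n k by (cases "n = 0") auto
    have sub: "R `` {u} \<subseteq> V" for u using R by auto
    define D where "D = {u\<in>V. \<eta> / 2 * n \<le> card (R `` {u})}"
    have D: "D \<subseteq> V" "finite D" using V by (auto simp: D_def)
    have "R = (SIGMA u:V. R `` {u})" using R by auto
    then have "card R = (\<Sum>u\<in>V. card (R `` {u}))"
      using V sub by (metis card_SigmaI finite_subset)
    then have "real (card R) = (\<Sum>u\<in>V. real (card (R `` {u})))" by simp
    also have "\<dots> \<le> (\<Sum>u\<in>V. (if u \<in> D then real n else 0) + \<eta> / 2 * n)"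
    proof (rule sum_mono)
      fix u assume "u \<in> V"
      have "card (R `` {u}) \<le> n" unfolding n_def using V sub by (intro card_mono) auto
      then show "real (card (R `` {u})) \<le> (if u \<in> D then real n else 0) + \<eta> / 2 * n"
        using \<open>u \<in> V\<close> \<eta> by (auto simp: D_def add_increasing2)
    qed
    also have "\<dots> = n * card D + n * (\<eta> / 2 * n)"
      using V D by (simp add: sum.distrib sum.If_cases Int_absorb1 n_def)
    finally have "n * (\<eta> / 2 * n) \<le> n * real (card D)"
      using R by (simp add: n_def power2_eq_square algebra_simps)
    then have "\<eta> / 2 * n \<le> card D" using \<open>n > 0\<close> by simp
    then have "k \<le> card D" using n by linarith
    then obtain I where I: "I \<subseteq> D" "card I = k" "finite I"
      by (meson obtain_subset_with_card_n)
    obtain X where X: "X \<subseteq> I" "card X = t"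
      "\<eta> / 2 / 2 / 2 ^ card I * card V \<le> card {y\<in>V. \<forall>i\<in>X. y \<in> R `` {i}}"
      using popular_intersection[of V I "\<lambda>u. R `` {u}" "\<eta> / 2" t] V I \<eta> k sub
      by (force simp: D_def n_def)
    then have "t \<le> card {y\<in>V. \<forall>i\<in>X. y \<in> R `` {i}}"
      using n I by (simp add: n_def)
    then obtain Y where "Y \<subseteq> {y\<in>V. \<forall>i\<in>X. y \<in> R `` {i}}" "card Y = t"
      by (meson obtain_subset_with_card_n)
    then show ?thesis using X I D by (intro exI[of _ X] exI[of _ Y]) auto
  qed
  then show ?thesis by (intro exI[of _ N]) blast
qed

section \<open>Working assumptions on extremal graphs\<close>

definition joined :: "'a graph \<Rightarrow> 'a set \<Rightarrow> 'a set \<Rightarrow> bool" where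
  "joined G S T \<longleftrightarrow> (\<forall>s\<in>S. \<forall>t\<in>T. {s, t} \<in> edges G)"

lemma joined_sym: "joined G S T \<longleftrightarrow> joined G T S"
  unfolding joined_def by (metis insert_commute)

lemma joined_mono:
  "joined G S T \<Longrightarrow> S' \<subseteq> S \<Longrightarrow> T' \<subseteq> T \<Longrightarrow> joined G S' T'"
  by (auto simp: joined_def)

text \<open>These are the only properties of extremal graphs that enter the structural analysis. In
  \<open>split_free\<close>, the \<open>q\<close> vertices \<open>insert w Q\<close> are joined to all of \<open>X\<close>, but \<open>Y\<close> need only see \<open>Q\<close> and \<open>Z\<close>
  need only see \<open>w\<close>. Without it, \<open>q\<close> exceptional vertices joined to one side and to varying
  \<open>(q - 1)\<close>-sets on the other side would give as many edges up to \<open>O(1)\<close>.\<close>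

locale extremal_like =
  fixes G :: "'a graph" and n q h :: nat
  assumes simple: "simple_graph G" and card_verts: "card (verts G) = n"
    and q: "1 \<le> q" "q \<le> h"
    and tripartite_free: "\<And>Q X Y. card Q = q \<Longrightarrow> h \<le> card X \<Longrightarrow> h \<le> card Y \<Longrightarrow>
      joined G Q X \<Longrightarrow> joined G Q Y \<Longrightarrow> joined G X Y \<Longrightarrow> False"
    and split_free: "\<And>Q w X Y Z. finite Q \<Longrightarrow> card Q + 1 = q \<Longrightarrow> w \<notin> Q \<Longrightarrow>
      h \<le> card X \<Longrightarrow> h \<le> card Y \<Longrightarrow> h \<le> card Z \<Longrightarrow> Y \<inter> Z = {} \<Longrightarrow> insert w Q \<inter> (Y \<union> Z) = {} \<Longrightarrow>
      joined G X (insert w Q \<union> Y \<union> Z) \<Longrightarrow> joined G Q Y \<Longrightarrow>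
      joined G {w} Z \<Longrightarrow> False"
    and matching_free: "\<And>u w X. inj_on u {..<h} \<Longrightarrow> inj_on w {..<h} \<Longrightarrow>
      u ` {..<h} \<inter> w ` {..<h} = {} \<Longrightarrow> (\<And>i. i < h \<Longrightarrow> {u i, w i} \<in> edges G) \<Longrightarrow>
      h \<le> card X \<Longrightarrow> joined G X (u ` {..<h} \<union> w ` {..<h}) \<Longrightarrow> False"
    and many_edges: "real n ^ 2 / 2 + (real q - 1) * n - 2 * real q ^ 2 \<le> 2 * card (edges G)"
    and degree_common: "\<And>v X. v \<in> verts G \<Longrightarrow> X \<subseteq> verts G - {v} \<Longrightarrow> h \<le> card X \<Longrightarrow>
      card {y \<in> verts G - {v}. \<forall>x\<in>X. {x, y} \<in> edges G} \<le> degree G v"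
begin

abbreviation "V \<equiv> verts G"
abbreviation "p S T \<equiv> card (pairs G S T)"

lemma finV: "finite V"
  using simple by (simp add: simple_graph_def)

lemma finite_sub: "S \<subseteq> V \<Longrightarrow> finite S"
  using finV finite_subset by blast

lemma card_sub: "S \<subseteq> V \<Longrightarrow> card S \<le> n"
  using card_mono[OF finV] card_verts by simp

lemma degree_le: "degree G v \<le> n"
  unfolding degree_def by (rule card_sub[OF nbhd_subset[OF simple]])

lemma split_pairs:
  assumes "A \<union> B = V" "A \<inter> B = {}"
  shows "p A A + 2 * p A B + p B B = 2 * card (edges G)"
proof -
  have fin: "finite A" "finite B" using assms finV by (metis finite_Un)+
  have "p V V = p A A + p A B + (p B A + p B B)"
    using assms fin unfolding assms(1)[symmetric]
    by (simp add: card_pairs_Un_left card_pairs_Un_right)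
  then show ?thesis
    using handshake[OF simple] card_pairs_sym[of G A B] by simp
qed

definition dense_nbhd :: "real \<Rightarrow> 'a set" where
  "dense_nbhd \<eta> = {u\<in>V. \<eta> * real n ^ 2 \<le> p (nbhd G u) (nbhd G u)}"

end

text \<open>Among \<open>k\<close> vertices with dense neighbourhoods,
  \<open>popular_intersection\<close> on the ground set \<open>V \<times> V\<close> finds
  \<open>q\<close> whose neighbourhoods share a positive fraction of all pairs. A complete bipartite
  graph among the shared pairs contradicts \<open>tripartite_free\<close>. Being outside the locale
  lets \<open>L\<close> and \<open>N\<close> precede \<open>G\<close> and \<open>n\<close>.\<close>

lemma few_dense_nbhds:
  fixes \<eta> :: real
  assumes "0 < \<eta>" "\<eta> \<le> 1"
  shows "\<exists>L N. \<forall>(G :: 'a graph) n. extremal_like G n q h \<and> N \<le> n \<longrightarrow>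
    card (extremal_like.dense_nbhd G n \<eta>) \<le> L"
proof -
  define k where "k = nat \<lceil>2 * q / \<eta>\<rceil> + 1"
  have "2 * q / \<eta> \<le> k" unfolding k_def by linarith
  then have k: "real q \<le> \<eta> / 2 * k" "k > 0"
    using assms by (auto simp: field_simps k_def)
  define \<eta>' where "\<eta>' = \<eta> / 2 / 2 ^ k"
  have "0 < \<eta>'" "\<eta>' \<le> 1"
    using assms one_le_power[of "2 :: real" k] by (simp_all add: \<eta>'_def field_simps del: one_le_power)
  then obtain N where N: "\<And>(V :: 'a set) R. finite V \<Longrightarrow> N \<le> card V \<Longrightarrow> R \<subseteq> V \<times> V \<Longrightarrow>
      \<eta>' * (card V)\<^sup>2 \<le> card R \<Longrightarrow> \<exists>X Y. X \<subseteq> V \<and> Y \<subseteq> V \<and> card X = h \<and> card Y = h \<and> X \<times> Y \<subseteq> R"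
    using complete_bipartite_in_dense by metis
  have "card (extremal_like.dense_nbhd G n \<eta>) \<le> k" if "extremal_like G n q h" "N \<le> n" for G :: "'a graph" and n
  proof (rule ccontr)
    interpret extremal_like G n q h by fact
    assume "\<not> ?thesis"
    then have "k \<le> card (dense_nbhd \<eta>)" by simp
    then obtain I where I: "I \<subseteq> dense_nbhd \<eta>" "card I = k" "finite I"
      by (meson obtain_subset_with_card_n)
    define S where "S u = pairs G (nbhd G u) (nbhd G u)" for u
    have "S u \<subseteq> V \<times> V" for u
      using nbhd_subset[OF simple] by (auto simp: S_def pairs_def)
    moreover have "\<eta> * card (V \<times> V) \<le> card (S u)" if "u \<in> I" for u
      using I that by (auto simp: S_def dense_nbhd_def card_cartesian_product card_verts power2_eq_square)
    ultimately obtain Q where Q: "Q \<subseteq> I" "card Q = q"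
      "\<eta> / 2 / 2 ^ card I * card (V \<times> V) \<le> card {x\<in>V \<times> V. \<forall>i\<in>Q. x \<in> S i}"
      using popular_intersection[of "V \<times> V" I S \<eta> q] I k finV assms by force
    then have "\<exists>X Y. X \<subseteq> V \<and> Y \<subseteq> V \<and> card X = h \<and> card Y = h \<and>
        X \<times> Y \<subseteq> {x\<in>V \<times> V. \<forall>i\<in>Q. x \<in> S i}"
      using finV that card_verts I
      by (intro N) (auto simp: \<eta>'_def card_cartesian_product power2_eq_square)
    then obtain X Y where XY: "card X = h" "card Y = h" "X \<times> Y \<subseteq> {x\<in>V \<times> V. \<forall>i\<in>Q. x \<in> S i}"
      by blast
    have "X \<noteq> {}" "Y \<noteq> {}" "Q \<noteq> {}" using XY Q q by auto
    have *: "{x, y} \<in> edges G \<and> {i, x} \<in> edges G \<and> {i, y} \<in> edges G" if "x \<in> X" "y \<in> Y" "i \<in> Q" for x y i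
      using XY(3) that by (auto simp: S_def pairs_def mem_nbhd)
    then have "joined G X Y" "joined G Q X" "joined G Q Y"
      using \<open>X \<noteq> {}\<close> \<open>Y \<noteq> {}\<close> \<open>Q \<noteq> {}\<close> unfolding joined_def by blast+
    then show False using tripartite_free[of Q X Y] XY Q by simp
  qed
  then show ?thesis by blast
qed


definition sparse_parts :: "'a graph \<Rightarrow> real \<Rightarrow> 'a set \<Rightarrow> 'a set \<Rightarrow> bool" where
  "sparse_parts G m A B \<longleftrightarrow> A \<union> B = verts G \<and> A \<inter> B = {} \<and> real (card (pairs G A A)) \<le> m \<and>
     real (card (pairs G B B)) \<le> m \<and> real (card A * card B) - card (pairs G A B) \<le> m"

text \<open>Degree majorization as in Erdos's proof of Turan's theorem. With
  \<open>A = nbhd G u\<close> for the chosen vertex \<open>u\<close>, the degrees in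
  \<open>B\<close> sum to at most \<open>card A * card B + L * n\<close>, and \<open>A\<close> spans
  few edges because \<open>u\<close> has no dense neighbourhood. Compared with
  \<open>many_edges\<close>, this leaves little room for edges inside \<open>B\<close> or for
  missing pairs.\<close>

lemma stability:
  fixes \<delta> :: real
  assumes \<delta>: "0 < \<delta>" "\<delta> \<le> 1"
  shows "\<exists>N. \<forall>(G :: 'a graph) n. extremal_like G n q h \<and> N \<le> n \<longrightarrow>
    (\<exists>A B. sparse_parts G (\<delta> * real n ^ 2) A B)"
proof -
  have "0 < \<delta> / 8" "\<delta> / 8 \<le> 1" using \<delta> by auto
  from few_dense_nbhds[OF this, of q h] obtain L N where
    LN: "\<forall>(G :: 'a graph) n. extremal_like G n q h \<and> N \<le> n \<longrightarrow>
      card (extremal_like.dense_nbhd G n (\<delta> / 8)) \<le> L"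
    by blast
  define M where "M = nat \<lceil>(2 * L + 2 * q\<^sup>2) * 4 / \<delta>\<rceil> + L + N + 1"
  have "\<exists>A B. sparse_parts G (\<delta> * real n ^ 2) A B"
    if ex: "extremal_like G n q h" and n: "M \<le> n" for G :: "'a graph" and n
  proof -
    interpret extremal_like G n q h by fact
    define D where "D = dense_nbhd (\<delta> / 8)"
    have D: "card D \<le> L" "D \<subseteq> V"
      using LN[rule_format, OF conjI[OF ex]] n by (simp_all add: D_def M_def) (auto simp: dense_nbhd_def)
    have "(2 * L + 2 * q\<^sup>2) * 4 / \<delta> \<le> M"
      unfolding M_def by (simp add: le_nat_iff) linarith
    then have "(2 * L + 2 * q\<^sup>2) * 4 / \<delta> \<le> n" using n by linarith
    then have "2 * real L + 2 * real q ^ 2 \<le> \<delta> / 4 * n"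
      using \<delta> by (simp add: field_simps)
    then have "(2 * real L + 2 * real q ^ 2) * n \<le> \<delta> / 4 * n * n"
      by (rule mult_right_mono) simp
    moreover have "2 * real q ^ 2 * 1 \<le> 2 * real q ^ 2 * n"
      by (rule mult_left_mono) (use n in \<open>auto simp: M_def\<close>)
    ultimately have err: "2 * real L * n + 2 * real q ^ 2 \<le> \<delta> / 4 * real n ^ 2"
      by (simp add: power2_eq_square algebra_simps)
    have "V - D \<noteq> {}"
    proof
      assume "V - D = {}"
      then have "n \<le> L" using D card_mono[of D V] card_verts finite_sub by fastforce
      then show False using n by (simp add: M_def)
    qed
    then have "Max (degree G ` (V - D)) \<in> degree G ` (V - D)"
      using finV by (intro Max_in) auto
    then obtain u where u: "u \<in> V - D" "Max (degree G ` (V - D)) = degree G u" by auto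
    have umax: "degree G v \<le> degree G u" if "v \<in> V - D" for v
      unfolding u(2)[symmetric] using finV that by (intro Max_ge) auto
    define A where "A = nbhd G u"
    define B where "B = V - A"
    have AB: "A \<union> B = V" "A \<inter> B = {}" "A \<subseteq> V" "B \<subseteq> V"
      using nbhd_subset[OF simple] by (auto simp: A_def B_def)
    have fin: "finite A" "finite B" using AB finite_sub by auto
    have n_eq: "real n = card A + card B"
      using card_Un_disjoint[OF fin AB(2)] AB(1) card_verts by simp
    have pAA: "p A A \<le> \<delta> / 8 * real n ^ 2"
      using u by (auto simp: A_def D_def dense_nbhd_def)
    have "p B A + p B B = (\<Sum>v\<in>B. degree G v)"
    proof -
      have "p B A + p B B = p B V" using fin AB card_pairs_Un_right by metis
      then show ?thesis using fin finV nbhd_subset[OF simple]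
        by (simp add: card_pairs degree_def Int_absorb2)
    qed
    also have "\<dots> \<le> (\<Sum>v\<in>B. card A + (if v \<in> D then n else 0))"
    proof (rule sum_mono)
      fix v assume "v \<in> B"
      then show "degree G v \<le> card A + (if v \<in> D then n else 0)"
        using umax[of v] degree_le[of v] AB by (auto simp: A_def degree_def)
    qed
    also have "\<dots> = card A * card B + card (B \<inter> D) * n"
      using fin by (simp add: sum.distrib sum.If_cases)
    also have "\<dots> \<le> card A * card B + L * n"
      using D card_mono[of D "B \<inter> D"] finite_sub by (intro add_left_mono mult_right_mono) fastforce+
    finally have "real (p B A + p B B) \<le> real (card A * card B + L * n)"
      by (simp only: of_nat_le_iff)
    then have pBB: "real (p A B) + p B B \<le> real (card A) * card B + L * real n"
      by (simp add: card_pairs_sym[of G A B])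
    have e: "real (p A A) + 2 * p A B + p B B = 2 * card (edges G)"
      using split_pairs[OF AB(1,2)] by (metis of_nat_add of_nat_mult of_nat_numeral)
    have "0 \<le> (real q - 1) * n" using q by simp
    then have e2: "real n ^ 2 / 2 - 2 * real q ^ 2 \<le> 2 * card (edges G)"
      using many_edges by linarith
    have amgm: "4 * (real (card A) * card B) \<le> real n ^ 2"
      unfolding n_eq using zero_le_power2[of "real (card A) - card B"]
      by (simp add: power2_eq_square algebra_simps)
    have "0 \<le> \<delta> * real n ^ 2" using \<delta> by simp
    then have "real (p B B) \<le> \<delta> / 2 * real n ^ 2"
      using e e2 amgm pBB err pAA by linarith
    moreover have "0 \<le> real L * real n" by simp
    ultimately have "real (p B B) \<le> \<delta> * real n ^ 2" "real (p A A) \<le> \<delta> * real n ^ 2"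
      "real (card A * card B) - p A B \<le> \<delta> * real n ^ 2"
      using e e2 amgm err pAA \<open>0 \<le> \<delta> * real n ^ 2\<close>
      by (simp_all only: of_nat_mult)
    then show ?thesis
      using AB unfolding sparse_parts_def by blast
  qed
  then show ?thesis by blast
qed

lemma card_common_nbhd:
  fixes m :: real
  assumes "finite B" "finite X" "\<And>x. x \<in> X \<Longrightarrow> card (B - nbhd G x) \<le> m"
  shows "card B - card X * m \<le> card {y\<in>B. \<forall>x\<in>X. {x, y} \<in> edges G}"
proof -
  have "card (\<Union>x\<in>X. B - nbhd G x) \<le> (\<Sum>x\<in>X. card (B - nbhd G x))"
    by (rule card_UN_le) fact
  then have "real (card (\<Union>x\<in>X. B - nbhd G x)) \<le> (\<Sum>x\<in>X. real (card (B - nbhd G x)))"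
    by (metis of_nat_le_iff of_nat_sum)
  also have "\<dots> \<le> card X * m"
    using sum_mono[of X "\<lambda>x. real (card (B - nbhd G x))" "\<lambda>_. m"] assms by simp
  finally have "real (card (\<Union>x\<in>X. B - nbhd G x)) \<le> card X * m" .
  moreover have "card B \<le> card ({y\<in>B. \<forall>x\<in>X. {x, y} \<in> edges G} \<union> (\<Union>x\<in>X. B - nbhd G x))"
    by (rule card_mono) (use assms in \<open>auto simp: mem_nbhd\<close>)
  ultimately show ?thesis
    using card_Un_le[of "{y\<in>B. \<forall>x\<in>X. {x, y} \<in> edges G}" "\<Union>x\<in>X. B - nbhd G x"] by linarith
qed

text \<open>Sizes and degrees are off by a multiple of \<open>\<delta>\<close>, the missing pairs by
  its square: a deficit of order \<open>\<delta>\<^sup>2 * n\<^sup>2\<close> in the number of edges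
  permits an imbalance of order \<open>\<delta> * n\<close>.\<close>

definition almost_bipartition :: "'a graph \<Rightarrow> nat \<Rightarrow> real \<Rightarrow> 'a set \<Rightarrow> 'a set \<Rightarrow> bool" where
  "almost_bipartition G n \<delta> A B \<longleftrightarrow> A \<union> B = verts G \<and> A \<inter> B = {} \<and>
     (1 / 2 - \<delta>) * n \<le> card A \<and> (1 / 2 - \<delta>) * n \<le> card B \<and>
     real (card A * card B) - card (pairs G A B) \<le> \<delta>\<^sup>2 * real n ^ 2 \<and>
     (\<forall>v\<in>verts G. (1 / 2 - \<delta>) * n \<le> degree G v)"

text \<open>By \<open>degree_common\<close>, the degree of \<open>v\<close> is at least the number
  of common neighbours, other than \<open>v\<close>, of any \<open>h\<close> other vertices. Almost
  all vertices of \<open>A\<close> miss little of \<open>B\<close>, so \<open>h\<close> of them have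
  nearly all of \<open>B\<close> in common.\<close>

lemma min_degree:
  fixes \<delta> :: real
  assumes \<delta>: "0 < \<delta>" "\<delta> \<le> 1 / 2"
  shows "\<exists>N. \<forall>(G :: 'a graph) n. extremal_like G n q h \<and> N \<le> n \<longrightarrow>
    (\<exists>A B. almost_bipartition G n \<delta> A B)"
proof -
  \<comment> \<open>The losses are \<open>2 * \<theta> * n\<close> from the size of
    \<open>B\<close>, \<open>h * \<theta> * n\<close> from the non-neighbours of the
    \<open>h\<close> vertices, and 1 for \<open>v\<close> itself, which fits into the remaining
    \<open>2 * \<theta> * n\<close>.\<close>
  define \<theta> where "\<theta> = \<delta> / (h + 4)"
  have \<theta>: "0 < \<theta>" "\<theta> \<le> 1 / 8" "\<theta> \<le> \<delta>" "\<delta> = (h + 4) * \<theta>"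
    using \<delta> by (auto simp: \<theta>_def field_simps)
  have "0 < \<theta>\<^sup>2" "\<theta>\<^sup>2 \<le> 1" using \<theta> by (simp_all add: power_le_one)
  from stability[OF this, of q h] obtain N where N: "\<forall>(G :: 'a graph) n. extremal_like G n q h \<and> N \<le> n \<longrightarrow>
    (\<exists>A B. sparse_parts G (\<theta>\<^sup>2 * real n ^ 2) A B)"
    by (elim exE) (rule that)
  define M where "M = nat \<lceil>(2 * q + 1) / \<theta>\<rceil> + 8 * (h + 1) + N"
  have "\<exists>A B. almost_bipartition G n \<delta> A B"
    if ex: "extremal_like G n q h" and n: "M \<le> n" for G :: "'a graph" and n
  proof -
    interpret extremal_like G n q h by fact
    obtain A B where AB: "A \<union> B = V" "A \<inter> B = {}" and pp: "p A A \<le> \<theta>\<^sup>2 * real n ^ 2"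
      "p B B \<le> \<theta>\<^sup>2 * real n ^ 2" "real (card A * card B) - p A B \<le> \<theta>\<^sup>2 * real n ^ 2"
    proof -
      have "N \<le> n" using n by (simp add: M_def)
      with N ex that show thesis unfolding sparse_parts_def by blast
    qed
    have "(2 * q + 1) / \<theta> \<le> M" unfolding M_def by simp linarith
    then have "(2 * q + 1) / \<theta> \<le> n" using n by linarith
    then have \<theta>n: "2 * q + 1 \<le> \<theta> * n" using \<theta> by (simp add: field_simps)
    have nh: "8 * (real h + 1) \<le> n" using n by (simp add: M_def)
    have fin: "finite A" "finite B" using AB finV by (metis finite_Un)+
    have n_eq: "real n = card A + card B"
      using card_Un_disjoint[OF fin AB(2)] AB(1) card_verts by simp
    have e: "real (p A A) + 2 * p A B + p B B = 2 * card (edges G)"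
      using split_pairs[OF AB(1,2)] by (metis of_nat_add of_nat_mult of_nat_numeral)
    have "0 \<le> (real q - 1) * n" using q by simp
    then have e2: "real n ^ 2 / 2 - 2 * real q ^ 2 \<le> 2 * card (edges G)"
      using many_edges by linarith
    have "real (p A B) \<le> real (card A) * card B"
      using card_pairs_le[OF fin, of G] by (metis of_nat_le_iff of_nat_mult)
    then have "(real (card A) - card B)\<^sup>2 \<le> 4 * \<theta>\<^sup>2 * real n ^ 2 + 4 * real q ^ 2"
      using e e2 pp n_eq by (simp add: power2_eq_square algebra_simps)
    also have "\<dots> \<le> 5 * \<theta>\<^sup>2 * real n ^ 2"
    proof -
      have "(2 * real q)\<^sup>2 \<le> (\<theta> * n)\<^sup>2" using \<theta>n by (intro power_mono) auto
      then show ?thesis by (simp add: power_mult_distrib)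
    qed
    also have "\<dots> \<le> (3 * \<theta> * n)\<^sup>2" by (simp add: power_mult_distrib)
    finally have "\<bar>real (card A) - card B\<bar> \<le> \<bar>3 * \<theta> * n\<bar>"
      by (simp only: abs_le_square_iff)
    then have "\<bar>real (card A) - card B\<bar> \<le> 3 * \<theta> * n"
      using \<theta> by (simp add: abs_mult)
    then have size: "(1 / 2 - 2 * \<theta>) * n \<le> card A" "(1 / 2 - 2 * \<theta>) * n \<le> card B"
      using n_eq \<theta> by (auto simp: algebra_simps abs_le_iff)
    have mono: "(1 / 2 - \<delta>) * n \<le> (1 / 2 - 2 * \<theta>) * n"
      using \<theta> by (intro mult_right_mono) (auto simp: algebra_simps)
    define Z where "Z = {a\<in>A. \<theta> * n \<le> card (B - nbhd G a)}"
    have Z: "Z \<subseteq> A" by (auto simp: Z_def)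
    have miss: "card B = card (B - nbhd G a) + card (nbhd G a \<inter> B)" for a
      using card_Int_Diff[OF fin(2), of "nbhd G a"] by (simp add: Int_commute)
    have missing: "real (card A * card B) - p A B = (\<Sum>a\<in>A. real (card (B - nbhd G a)))"
    proof -
      have "(\<Sum>a\<in>A. real (card (B - nbhd G a))) = (\<Sum>a\<in>A. real (card B) - card (nbhd G a \<inter> B))"
        proof (intro sum.cong refl)
        fix a show "real (card (B - nbhd G a)) = real (card B) - card (nbhd G a \<inter> B)"
          using miss[of a] by linarith
      qed
      then show ?thesis using fin by (simp add: card_pairs sum_subtractf)
    qed
    have "(\<Sum>a\<in>Z. real (card (B - nbhd G a))) \<le> (\<Sum>a\<in>A. real (card (B - nbhd G a)))"
      by (rule sum_mono2) (use fin Z in auto)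
    moreover have "(\<Sum>a\<in>Z. real (card (B - nbhd G a))) \<ge> card Z * (\<theta> * n)"
      using sum_mono[of Z "\<lambda>_. \<theta> * n" "\<lambda>a. real (card (B - nbhd G a))"] by (simp add: Z_def)
    ultimately have "card Z * (\<theta> * n) \<le> \<theta> * n * (\<theta> * n)"
      using pp missing by (simp add: power2_eq_square algebra_simps)
    then have cZ: "card Z \<le> \<theta> * n"
      using \<theta>n by (simp add: mult_le_cancel_right mult.commute)
    have deg: "(1 / 2 - \<delta>) * n \<le> degree G v" if v: "v \<in> V" for v
    proof -
      have "card A \<le> card (A - Z - {v}) + card Z + 1"
        using card_mono[of "(A - Z - {v}) \<union> Z \<union> {v}" A] fin Z finite_subset[OF Z fin(1)]
          card_Un_le[of "(A - Z - {v}) \<union> Z" "{v}"] card_Un_le[of "A - Z - {v}" Z] by force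
      then have "(1 / 2 - 3 * \<theta>) * n - 1 \<le> card (A - Z - {v})"
        using size cZ by (simp add: algebra_simps)
      moreover have "n / 8 \<le> (1 / 2 - 3 * \<theta>) * n"
        using mult_right_mono[of "1 / 8" "1 / 2 - 3 * \<theta>" "real n"] \<theta> by simp
      ultimately have "n / 8 - 1 \<le> card (A - Z - {v})" by (meson diff_right_mono order_trans)
      then have "real h \<le> card (A - Z - {v})" using nh by simp
      then have "h \<le> card (A - Z - {v})" by simp
      then obtain X where X: "X \<subseteq> A - Z - {v}" "card X = h" "finite X"
        by (meson obtain_subset_with_card_n)
      have "card (B - {v}) - card X * (\<theta> * n) \<le> card {y\<in>B - {v}. \<forall>x\<in>X. {x, y} \<in> edges G}"
      proof (rule card_common_nbhd)
        fix x assume "x \<in> X"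
        then have "card (B - nbhd G x) \<le> \<theta> * n" using X by (force simp: Z_def)
        moreover have "card (B - {v} - nbhd G x) \<le> card (B - nbhd G x)"
          using fin by (intro card_mono) auto
        ultimately show "card (B - {v} - nbhd G x) \<le> \<theta> * n" by linarith
      qed (use fin X in auto)
      also have "\<dots> \<le> real (card {y\<in>V - {v}. \<forall>x\<in>X. {x, y} \<in> edges G})"
        using AB finV by (intro of_nat_mono card_mono) auto
      also have "\<dots> \<le> degree G v"
        using degree_common[OF v, of X] X AB by force
      finally have "card (B - {v}) - h * (\<theta> * n) \<le> degree G v" using X by simp
      moreover have "real (card B) \<le> card (B - {v}) + 1"
        using card_Un_le[of "B - {v}" "{v}"] card_mono[of "(B - {v}) \<union> {v}" B] fin by fastforce
      ultimately show ?thesis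
        using size \<theta>n \<theta>(4) by (simp add: algebra_simps)
    qed
    have "\<theta>\<^sup>2 * real n ^ 2 \<le> \<delta>\<^sup>2 * real n ^ 2"
      using \<theta> by (intro mult_right_mono power_mono) auto
    then show ?thesis
      unfolding almost_bipartition_def using AB size mono pp deg by (rule_tac exI[of _ A], rule_tac exI[of _ B]) auto
  qed
  then show ?thesis by blast
qed

section \<open>A bounded exceptional set\<close>

definition has_matching :: "'a graph \<Rightarrow> 'a set \<Rightarrow> nat \<Rightarrow> bool" where
  "has_matching G S k \<longleftrightarrow> (\<exists>u w. inj_on u {..<k} \<and> inj_on w {..<k} \<and> u ` {..<k} \<inter> w ` {..<k} = {} \<and>
     u ` {..<k} \<union> w ` {..<k} \<subseteq> S \<and> (\<forall>i<k. {u i, w i} \<in> edges G))"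

definition has_cover :: "'a graph \<Rightarrow> 'a set \<Rightarrow> nat \<Rightarrow> bool" where
  "has_cover G S k \<longleftrightarrow> (\<exists>C\<subseteq>S. finite C \<and> card C \<le> k \<and> (\<forall>x\<in>S - C. \<forall>y\<in>S - C. {x, y} \<notin> edges G))"

lemma has_cover_mono:
  assumes "has_cover G S k" "k \<le> l"
  shows "has_cover G S l"
proof -
  obtain C where "C \<subseteq> S" "finite C" "card C \<le> k" "\<forall>x\<in>S - C. \<forall>y\<in>S - C. {x, y} \<notin> edges G"
    using assms unfolding has_cover_def by (elim exE conjE) (rule that)
  then show ?thesis using assms unfolding has_cover_def by (intro exI[of _ C]) simp
qed

text \<open>The ends of a matching that cannot be extended meet every edge inside
  \<open>S\<close>.\<close>

lemma matching_or_cover: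
  assumes "simple_graph G"
  shows "has_matching G S k \<or> has_cover G S (2 * k)"
proof (induction k)
  case 0
  then show ?case by (simp add: has_matching_def)
next
  case (Suc k)
  show ?case
  proof (cases "has_matching G S k")
    case False
    then show ?thesis using Suc has_cover_mono[of G S "2 * k" "2 * Suc k"] by simp
  next
    case True
    then obtain u w where 1: "inj_on u {..<k}" "inj_on w {..<k}" "u ` {..<k} \<inter> w ` {..<k} = {}"
      "u ` {..<k} \<union> w ` {..<k} \<subseteq> S" "\<forall>i<k. {u i, w i} \<in> edges G"
      unfolding has_matching_def by (elim exE conjE) (rule that)
    define C where "C = u ` {..<k} \<union> w ` {..<k}"
    show ?thesis
    proof (cases "\<exists>x\<in>S - C. \<exists>y\<in>S - C. {x, y} \<in> edges G")
      case True
      then obtain x y where xy: "x \<in> S - C" "y \<in> S - C" "{x, y} \<in> edges G" by blast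
      define u' where "u' = u(k := x)"
      define w' where "w' = w(k := y)"
      have im: "u' ` {..<Suc k} = insert x (u ` {..<k})" "w' ` {..<Suc k} = insert y (w ` {..<k})"
        by (auto simp: lessThan_Suc u'_def w'_def)
      have "inj_on u' {..<Suc k}" "inj_on w' {..<Suc k}"
        using 1 xy by (auto simp: lessThan_Suc u'_def w'_def C_def inj_on_def)
      moreover have "x \<noteq> y" using xy simple_graphD[OF assms] by blast
      then have "u' ` {..<Suc k} \<inter> w' ` {..<Suc k} = {}"
        using 1 xy unfolding im by (auto simp: C_def)
      moreover have "u' ` {..<Suc k} \<union> w' ` {..<Suc k} \<subseteq> S"
        using 1 xy unfolding im by auto
      moreover have "\<forall>i<Suc k. {u' i, w' i} \<in> edges G"
        using 1 xy by (auto simp: u'_def w'_def less_Suc_eq)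
      ultimately show ?thesis unfolding has_matching_def by (intro disjI1 exI[of _ u'] exI[of _ w'] conjI)
    next
      case False
      have "card C \<le> 2 * Suc k"
        using card_Un_le[of "u ` {..<k}" "w ` {..<k}"] card_image_le[of "{..<k}" u]
          card_image_le[of "{..<k}" w] by (simp add: C_def)
      with False 1 show ?thesis unfolding has_cover_def by (intro disjI2 exI[of _ C]) (auto simp: C_def)
    qed
  qed
qed

text \<open>Non-adjacent pairs of \<open>S \<times> T\<close> are among those of
  \<open>A \<times> B\<close>; sums on both sides avoid subtraction of naturals.\<close>

lemma missing_pairs_mono:
  assumes "finite A" "finite B" "S \<subseteq> A" "T \<subseteq> B"
  shows "card (pairs G A B) + card S * card T \<le> card (pairs G S T) + card A * card B"
proof -
  have fin: "finite S" "finite T" using assms finite_subset by auto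
  have "card (pairs G A B) \<le> card (pairs G S T \<union> (A \<times> B - S \<times> T))"
    by (rule card_mono) (use assms fin in \<open>auto simp: pairs_def\<close>)
  also have "\<dots> \<le> card (pairs G S T) + card (A \<times> B - S \<times> T)"
    by (rule card_Un_le)
  also have "card (A \<times> B - S \<times> T) = card A * card B - card S * card T"
    using assms fin by (subst card_Diff_subset) (auto simp: card_cartesian_product)
  finally show ?thesis
    using assms mult_le_mono[OF card_mono card_mono, of A S B T] by linarith
qed

context extremal_like
begin

text \<open>With few neighbours in \<open>A\<close>, a vertex of \<open>S\<close> must see all but
  \<open>2 * \<eta> * n\<close> vertices of \<open>B\<close> to reach its degree. The ends of
  \<open>h\<close> matching edges would then have at least \<open>n / 8\<close> common neighbours in
  \<open>B\<close>, against \<open>matching_free\<close>. The value of \<open>\<eta>\<close> keeps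
  their total loss \<open>4 * h * \<eta> * n\<close> below \<open>n / 4\<close>.\<close>

lemma small_cover:
  fixes \<eta> \<delta> :: real
  assumes AB: "A \<union> B = V" "A \<inter> B = {}" and size: "(1 / 2 - \<delta>) * n \<le> card A" "(1 / 2 - \<delta>) * n \<le> card B"
    and deg: "\<And>v. v \<in> V \<Longrightarrow> (1 / 2 - \<delta>) * n \<le> degree G v"
    and \<eta>: "\<eta> = 1 / (16 * (h + 1))" and \<delta>: "0 < \<delta>" "\<delta> \<le> \<eta> / 3" and n: "8 * h \<le> n"
    and S: "S \<subseteq> V" "\<And>v. v \<in> S \<Longrightarrow> card (nbhd G v \<inter> A) < \<eta> * n"
  shows "has_cover G S (2 * h)"
proof (rule ccontr)
  assume "\<not> ?thesis"
  then have "has_matching G S h"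
    using matching_or_cover[OF simple, of S h] by blast
  then obtain u w where uw: "inj_on u {..<h}" "inj_on w {..<h}" "u ` {..<h} \<inter> w ` {..<h} = {}"
      "u ` {..<h} \<union> w ` {..<h} \<subseteq> S" "\<forall>i<h. {u i, w i} \<in> edges G"
    unfolding has_matching_def by (elim exE conjE) (rule that)
  define U where "U = u ` {..<h} \<union> w ` {..<h}"
  have fin: "finite A" "finite B" using AB finV by (metis finite_Un)+
  have n_eq: "real n = card A + card B"
    using card_Un_disjoint[OF fin AB(2)] AB(1) card_verts by simp
  have "card U \<le> 2 * h"
    using card_Un_le[of "u ` {..<h}" "w ` {..<h}"] card_image_le[of "{..<h}" u]
      card_image_le[of "{..<h}" w] by (simp add: U_def)
  define X where "X = {y\<in>B. \<forall>x\<in>U. {x, y} \<in> edges G}"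
  have \<delta>n: "\<delta> * n \<le> \<eta> / 3 * n" using \<delta> by (intro mult_right_mono) auto
  have "card B - card U * (2 * \<eta> * n) \<le> card X"
    unfolding X_def
  proof (rule card_common_nbhd)
    fix v assume "v \<in> U"
    then have v: "v \<in> S" "v \<in> V" using uw S by (auto simp: U_def)
    have fN: "finite (nbhd G v)" by (rule finite_nbhd[OF simple])
    have "nbhd G v = (nbhd G v \<inter> A) \<union> (nbhd G v \<inter> B)"
      using nbhd_subset[OF simple, of v] AB by auto
    then have "degree G v = card (nbhd G v \<inter> A) + card (nbhd G v \<inter> B)"
      using card_Un_disjoint[of "nbhd G v \<inter> A" "nbhd G v \<inter> B"] fN AB by (auto simp: degree_def)
    moreover have "card B = card (B - nbhd G v) + card (nbhd G v \<inter> B)"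
      using card_Int_Diff[OF fin(2), of "nbhd G v"] by (simp add: Int_commute)
    ultimately show "card (B - nbhd G v) \<le> 2 * \<eta> * n"
      using S(2)[OF v(1)] deg[OF v(2)] size n_eq \<delta>n by (simp add: algebra_simps)
  qed (use fin in \<open>auto simp: U_def\<close>)
  moreover have "card U * (2 * \<eta> * n) \<le> 2 * h * (2 * \<eta> * n)"
    using \<open>card U \<le> 2 * h\<close> \<eta> by (intro mult_right_mono) auto
  moreover have "2 * h * (2 * \<eta> * n) \<le> n / 4"
  proof -
    have "4 * h * \<eta> \<le> 1 / 4" by (simp add: \<eta> field_simps)
    from mult_right_mono[OF this, of "real n"] show ?thesis by simp
  qed
  moreover have "\<delta> * n \<le> n / 8"
  proof -
    have "\<eta> \<le> 1 / 16" by (simp add: \<eta> field_simps)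
    then have "\<delta> \<le> 1 / 8" using \<delta> by linarith
    from mult_right_mono[OF this, of "real n"] show ?thesis by simp
  qed
  ultimately have "n / 8 \<le> card X" using size by (simp add: algebra_simps)
  then have "h \<le> card X" using n by linarith
  moreover have "joined G X (u ` {..<h} \<union> w ` {..<h})"
    by (auto simp: joined_def X_def U_def insert_commute)
  ultimately show False using matching_free[OF uw(1-3)] uw(5) by blast
qed

lemma other_part_large:
  assumes "W \<union> A \<union> B = V" "W \<inter> B = {}" "A \<inter> B = {}" "card W \<le> w0" and indep: "\<forall>x\<in>A. \<forall>y\<in>A. {x, y} \<notin> edges G"
    and "a \<in> A"
  shows "degree G a \<le> w0 + card (nbhd G a \<inter> B)"
proof -
  have "nbhd G a \<subseteq> W \<union> (nbhd G a \<inter> B)"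
    using nbhd_subset[OF simple, of a] assms by (auto simp: mem_nbhd)
  then have "card (nbhd G a) \<le> card (W \<union> (nbhd G a \<inter> B))"
    using assms finV by (intro card_mono) (auto intro: finite_subset[of _ V])
  also have "\<dots> \<le> card W + card (nbhd G a \<inter> B)" by (rule card_Un_le)
  finally show ?thesis using assms by (simp add: degree_def)
qed

end

locale near_bipartite = extremal_like +
  fixes W A B :: "'a set" and w0 :: nat and \<epsilon> :: real
  assumes parts: "W \<union> A \<union> B = V" "W \<inter> A = {}" "W \<inter> B = {}" "A \<inter> B = {}" and W_le: "card W \<le> w0"
    and indep: "\<forall>x\<in>A. \<forall>y\<in>A. {x, y} \<notin> edges G" "\<forall>x\<in>B. \<forall>y\<in>B. {x, y} \<notin> edges G"
    and large: "n / 3 \<le> card A" "n / 3 \<le> card B"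
    and miss: "\<forall>a\<in>A. card (B - nbhd G a) \<le> \<epsilon> * n" "\<forall>b\<in>B. card (A - nbhd G b) \<le> \<epsilon> * n"

text \<open>\<open>w0\<close> precedes \<open>\<epsilon>\<close> because \<open>\<epsilon>\<close>
  will be exponentially small in \<open>w0\<close>. This is possible since \<open>\<eta>\<close>
  depends on \<open>h\<close> alone: vertices with at least \<open>\<eta> * n\<close> neighbours in
  both parts have dense neighbourhoods, so there are at most \<open>L\<close> of them, and two
  covers add \<open>2 * h\<close> each.\<close>

lemma bounded_exceptional_set:
  "\<exists>w0. \<forall>\<epsilon> :: real. 0 < \<epsilon> \<longrightarrow> (\<exists>N. \<forall>(G :: 'a graph) n. extremal_like G n q h \<and> N \<le> n \<longrightarrow>
    (\<exists>W A B. near_bipartite G n q h W A B w0 \<epsilon>))"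
proof -
  define \<eta> :: real where "\<eta> = 1 / (16 * (h + 1))"
  have \<eta>: "0 < \<eta>" "\<eta> \<le> 1" by (auto simp: \<eta>_def field_simps)
  have "\<eta>\<^sup>2 \<le> 1" using \<eta> by (simp add: power_le_one)
  then have "0 < \<eta>\<^sup>2 / 2" "\<eta>\<^sup>2 / 2 \<le> 1" using \<eta> by auto
  from few_dense_nbhds[OF this, of q h] obtain L N1 where
    L: "\<forall>(G :: 'a graph) n. extremal_like G n q h \<and> N1 \<le> n \<longrightarrow>
      card (extremal_like.dense_nbhd G n (\<eta>\<^sup>2 / 2)) \<le> L"
    by (elim exE) (rule that)
  define w0 where "w0 = L + 4 * h"
  show ?thesis
  proof (rule exI[of _ w0], intro allI impI)
    fix \<epsilon> :: real assume \<epsilon>: "0 < \<epsilon>"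
    define \<delta> where "\<delta> = min (\<eta> / 3) (min (\<epsilon> / 4) (1 / 12))"
    have \<delta>: "0 < \<delta>" "\<delta> \<le> \<eta> / 3" "\<delta> \<le> \<epsilon> / 4" "\<delta> \<le> 1 / 12" "\<delta> \<le> 1 / 2"
      using \<eta> \<epsilon> by (auto simp: \<delta>_def)
    from min_degree[OF \<delta>(1,5), of q h] obtain N2 where N2:
      "\<forall>(G :: 'a graph) n. extremal_like G n q h \<and> N2 \<le> n \<longrightarrow>
        (\<exists>A B. almost_bipartition G n \<delta> A B)"
      by (elim exE) (rule that)
    define N where "N = N1 + N2 + nat \<lceil>4 * w0 / \<epsilon>\<rceil> + 12 * w0 + 8 * h + 1"
    have main: "\<exists>W A B. near_bipartite G n q h W A B w0 \<epsilon>"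
      if ex: "extremal_like G n q h" and n: "N \<le> n" for G :: "'a graph" and n
    proof -
      interpret extremal_like G n q h by fact
      have nn: "N1 \<le> n" "N2 \<le> n" "12 * w0 < n" "8 * h \<le> n" using n by (auto simp: N_def)
      have "4 * w0 / \<epsilon> \<le> N" unfolding N_def by simp linarith
      then have "4 * w0 / \<epsilon> \<le> n" using n by linarith
      then have \<epsilon>n: "4 * w0 \<le> \<epsilon> * n" using \<epsilon> by (simp add: field_simps)
      from N2[rule_format, OF conjI[OF ex nn(2)]] obtain A B where
        "almost_bipartition G n \<delta> A B"
        by (elim exE) (rule that)
      then have AB: "A \<union> B = V" "A \<inter> B = {}" and size: "(1 / 2 - \<delta>) * n \<le> card A" "(1 / 2 - \<delta>) * n \<le> card B"
        and miss: "real (card A * card B) - p A B \<le> \<delta>\<^sup>2 * real n ^ 2"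
        and deg: "\<And>v. v \<in> V \<Longrightarrow> (1 / 2 - \<delta>) * n \<le> degree G v"
        by (auto simp: almost_bipartition_def)
      have fin: "finite A" "finite B" using AB finV by (metis finite_Un)+
      define M where "M = {v\<in>V. \<eta> * n \<le> card (nbhd G v \<inter> A) \<and> \<eta> * n \<le> card (nbhd G v \<inter> B)}"
      have "M \<subseteq> dense_nbhd (\<eta>\<^sup>2 / 2)"
      proof
        fix v assume v: "v \<in> M"
        define S where "S = nbhd G v \<inter> A"
        define T where "T = nbhd G v \<inter> B"
        have "p A B + card S * card T \<le> p S T + card A * card B"
          using fin by (intro missing_pairs_mono) (auto simp: S_def T_def)
        then have "real (p A B) + real (card S) * card T \<le> p S T + real (card A * card B)"
          by (metis of_nat_add of_nat_le_iff of_nat_mult)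
        moreover have "(\<eta> * n) * (\<eta> * n) \<le> real (card S) * card T"
          using v \<eta> by (intro mult_mono) (auto simp: M_def S_def T_def)
        moreover have "\<delta>\<^sup>2 * real n ^ 2 \<le> \<eta>\<^sup>2 / 2 * real n ^ 2"
        proof (rule mult_right_mono)
          have "\<delta>\<^sup>2 \<le> (\<eta> / 3)\<^sup>2" using \<delta> by (intro power_mono) auto
          then have "\<delta>\<^sup>2 \<le> \<eta>\<^sup>2 / 9" by (simp add: power_divide)
          then show "\<delta>\<^sup>2 \<le> \<eta>\<^sup>2 / 2" using zero_le_power2[of \<eta>] by linarith
        qed simp
        moreover have "p S T \<le> p (nbhd G v) (nbhd G v)"
          by (rule card_pairs_mono) (auto simp: S_def T_def finite_nbhd[OF simple])
        ultimately have "\<eta>\<^sup>2 / 2 * real n ^ 2 \<le> p (nbhd G v) (nbhd G v)"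
          using miss by (simp add: power2_eq_square algebra_simps)
        then show "v \<in> dense_nbhd (\<eta>\<^sup>2 / 2)"
          using v by (simp add: dense_nbhd_def M_def)
      qed
      moreover have "dense_nbhd (\<eta>\<^sup>2 / 2) \<subseteq> V" by (auto simp: dense_nbhd_def)
      ultimately have "card M \<le> L"
        using L[rule_format, OF conjI[OF ex nn(1)]] card_mono[of "dense_nbhd (\<eta>\<^sup>2 / 2)" M] finite_sub by force
      \<comment> \<open>The vertices are regrouped by adjacency: \<open>A0\<close> collects those
        with few neighbours in \<open>A\<close>, wherever they lay before.\<close>
      define A0 where "A0 = {v\<in>V - M. card (nbhd G v \<inter> A) < \<eta> * n}"
      define B0 where "B0 = V - M - A0"
      have "has_cover G A0 (2 * h)"
        by (rule small_cover[OF AB size deg \<eta>_def \<delta>(1,2) nn(4)]) (auto simp: A0_def)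
      then obtain C1 where C1: "C1 \<subseteq> A0" "finite C1" "card C1 \<le> 2 * h"
        "\<forall>x\<in>A0 - C1. \<forall>y\<in>A0 - C1. {x, y} \<notin> edges G"
        unfolding has_cover_def by (elim exE conjE) (rule that)
      have BA: "B \<union> A = V" "B \<inter> A = {}" using AB by auto
      have "has_cover G B0 (2 * h)"
        by (rule small_cover[OF BA size(2,1) deg \<eta>_def \<delta>(1,2) nn(4)]) (auto simp: B0_def A0_def M_def)
      then obtain C2 where C2: "C2 \<subseteq> B0" "finite C2" "card C2 \<le> 2 * h"
        "\<forall>x\<in>B0 - C2. \<forall>y\<in>B0 - C2. {x, y} \<notin> edges G"
        unfolding has_cover_def by (elim exE conjE) (rule that)
      define W where "W = M \<union> C1 \<union> C2"
      define A1 where "A1 = A0 - C1"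
      define B1 where "B1 = B0 - C2"
      have parts: "W \<union> A1 \<union> B1 = V" "W \<inter> A1 = {}" "W \<inter> B1 = {}" "A1 \<inter> B1 = {}"
        using C1 C2 by (auto simp: W_def A1_def B1_def A0_def B0_def M_def)
      have "card W \<le> card M + card C1 + card C2"
        using card_Un_le[of M C1] card_Un_le[of "M \<union> C1" C2] by (simp add: W_def)
      then have W: "card W \<le> w0"
        using \<open>card M \<le> L\<close> C1 C2 by (simp add: w0_def)
      have fin1: "finite W" "finite A1" "finite B1" using parts(1) finV by (metis finite_Un)+
      have "card (W \<union> A1 \<union> B1) = card W + card A1 + card B1"
        using parts fin1 by (subst card_Un_disjoint; simp add: Int_Un_distrib2 card_Un_disjoint)
      then have n_eq: "n = card W + card A1 + card B1" using parts card_verts by simp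
      have side: "(1 / 2 - \<delta>) * n - w0 + card (T - nbhd G a) \<le> card T"
        if "W \<union> S \<union> T = V" "W \<inter> T = {}" "S \<inter> T = {}" "\<forall>x\<in>S. \<forall>y\<in>S. {x, y} \<notin> edges G" "a \<in> S" for S T a
      proof -
        have "degree G a \<le> w0 + card (nbhd G a \<inter> T)"
          by (rule other_part_large[OF that(1-3) W that(4,5)])
        moreover have "finite T" "a \<in> V" using that(1,5) finite_sub[of T] by blast+
        then have "card T = card (nbhd G a \<inter> T) + card (T - nbhd G a)"
          using card_Int_Diff[of T "nbhd G a"] by (simp add: Int_commute)
        ultimately show ?thesis using deg[OF \<open>a \<in> V\<close>] by linarith
      qed
      have sA: "(1 / 2 - \<delta>) * n - w0 + card (B1 - nbhd G a) \<le> card B1" if "a \<in> A1" for a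
        by (rule side[OF parts(1,3,4)]) (use C1 that in \<open>auto simp: A1_def\<close>)
      have sB: "(1 / 2 - \<delta>) * n - w0 + card (A1 - nbhd G b) \<le> card A1" if "b \<in> B1" for b
        by (rule side[of B1]) (use parts C2 that in \<open>auto simp: B1_def\<close>)
      have "\<delta> * n \<le> n / 12" using mult_right_mono[OF \<delta>(4), of "real n"] by simp
      then have lo: "n / 3 \<le> (1 / 2 - \<delta>) * n - w0"
        using nn(3) unfolding left_diff_distrib by linarith
      have pos: "0 < n / 3" using nn by simp
      \<comment> \<open>The bound on one part comes from the degree of a vertex in the other. As
        \<open>w0 < n\<close>, some part is nonempty; this makes the other one large, hence nonempty
        too.\<close>
      have lA: "(1 / 2 - \<delta>) * n - w0 \<le> card A1" if "B1 \<noteq> {}"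
        using sB that by force
      have lB: "(1 / 2 - \<delta>) * n - w0 \<le> card B1" if "A1 \<noteq> {}"
        using sA that by force
      have "A1 \<noteq> {} \<or> B1 \<noteq> {}" using n_eq W nn(3) by auto
      then have "A1 \<noteq> {}" "B1 \<noteq> {}" using lA lB lo pos by force+
      note large = lA[OF this(2)] lB[OF this(1)]
      have sum: "real (card A1) + card B1 \<le> n" using n_eq by simp
      have de: "\<delta> * n \<le> \<epsilon> / 4 * n" using \<delta> by (intro mult_right_mono) auto
      have mA: "card (B1 - nbhd G a) \<le> \<epsilon> * n" if "a \<in> A1" for a
        using sA[OF that] large sum de \<epsilon>n by (simp add: algebra_simps)
      have mB: "card (A1 - nbhd G b) \<le> \<epsilon> * n" if "b \<in> B1" for b
        using sB[OF that] large sum de \<epsilon>n by (simp add: algebra_simps)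
      show ?thesis
      proof (rule exI[of _ W], rule exI[of _ A1], rule exI[of _ B1], unfold_locales)
        show "n / 3 \<le> card A1" "n / 3 \<le> card B1" using large lo by auto
      qed (use parts W C1(4) C2(4) mA mB in \<open>auto simp: A1_def B1_def\<close>)
    qed
    show "\<exists>N. \<forall>(G :: 'a graph) n. extremal_like G n q h \<and> N \<le> n \<longrightarrow>
      (\<exists>W A B. near_bipartite G n q h W A B w0 \<epsilon>)"
      by (rule exI[of _ N], intro allI impI, elim conjE) (rule main)
  qed
qed

section \<open>Neighbourhood types in the exceptional set\<close>

lemma ex_max_nat:
  fixes f :: "'b \<Rightarrow> nat"
  assumes "finite S" "S \<noteq> {}"
  shows "\<exists>m\<in>S. \<forall>s\<in>S. f s \<le> f m"
proof -
  have "Max (f ` S) \<in> f ` S" using assms by (intro Max_in) auto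
  then obtain m where "m \<in> S" "f m = Max (f ` S)" by auto
  then show ?thesis using assms by (auto intro!: bexI[of _ m])
qed

definition of_type :: "'a graph \<Rightarrow> 'a set \<Rightarrow> 'a set \<Rightarrow> 'a set \<Rightarrow> 'a set" where
  "of_type G W S X = {v\<in>S. nbhd G v \<inter> W = X}"

lemma card_types_le:
  fixes m :: real
  assumes "finite S" "finite W" "\<And>X. X \<subseteq> W \<Longrightarrow> X \<in> \<X> \<Longrightarrow> card (of_type G W S X) \<le> m" "0 \<le> m"
  shows "card {v\<in>S. nbhd G v \<inter> W \<in> \<X>} \<le> 2 ^ card W * m"
proof -
  have "{v\<in>S. nbhd G v \<inter> W \<in> \<X>} \<subseteq> (\<Union>X\<in>Pow W \<inter> \<X>. of_type G W S X)"
    by (auto simp: of_type_def)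
  then have "card {v\<in>S. nbhd G v \<inter> W \<in> \<X>} \<le> card (\<Union>X\<in>Pow W \<inter> \<X>. of_type G W S X)"
    using assms by (intro card_mono) (auto simp: of_type_def)
  also have "\<dots> \<le> (\<Sum>X\<in>Pow W \<inter> \<X>. card (of_type G W S X))"
    using assms by (intro card_UN_le) auto
  finally have "real (card {v\<in>S. nbhd G v \<inter> W \<in> \<X>}) \<le> (\<Sum>X\<in>Pow W \<inter> \<X>. real (card (of_type G W S X)))"
    by (simp only: of_nat_sum[symmetric] of_nat_le_iff)
  also have "\<dots> \<le> (\<Sum>X\<in>Pow W \<inter> \<X>. m)"
    using assms by (intro sum_mono) auto
  also have "\<dots> \<le> 2 ^ card W * m"
  proof -
    have "card (Pow W \<inter> \<X>) \<le> card (Pow W)" using assms by (intro card_mono) auto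
    then have "real (card (Pow W \<inter> \<X>)) \<le> 2 ^ card W"
      using assms by (simp add: card_Pow)
    then show ?thesis using assms by (simp add: mult_right_mono)
  qed
  finally show ?thesis .
qed

text \<open>A vertex with fewer than \<open>x\<close> neighbours in \<open>W\<close> falls short by
  at least 1, which the second summand records. Those with more than \<open>x\<close> gain at most
  \<open>card W\<close> each and are few.\<close>

lemma sum_types_le:
  fixes m :: real
  assumes "finite S" "finite W" "\<And>X. X \<subseteq> W \<Longrightarrow> x < card X \<Longrightarrow> card (of_type G W S X) \<le> m" "0 \<le> m"
  shows "(\<Sum>v\<in>S. real (card (nbhd G v \<inter> W))) + card {v\<in>S. card (nbhd G v \<inter> W) < x}
    \<le> real x * card S + card W * (2 ^ card W * m)"
proof -
  define L where "L = {v\<in>S. card (nbhd G v \<inter> W) < x}"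
  define U where "U = {v\<in>S. x < card (nbhd G v \<inter> W)}"
  have fin: "L \<subseteq> S" "U \<subseteq> S" by (auto simp: L_def U_def)
  have U: "card U \<le> 2 ^ card W * m"
    using card_types_le[of S W "{X. x < card X}" G m] assms by (simp add: U_def)
  have "(\<Sum>v\<in>S. real (card (nbhd G v \<inter> W)) + (if v \<in> L then 1 else 0)) \<le>
    (\<Sum>v\<in>S. real x + (if v \<in> U then real (card W) else 0))"
  proof (rule sum_mono)
    fix v assume "v \<in> S"
    have "card (nbhd G v \<inter> W) \<le> card W" using assms by (intro card_mono) auto
    then show "real (card (nbhd G v \<inter> W)) + (if v \<in> L then 1 else 0) \<le>
      real x + (if v \<in> U then real (card W) else 0)"
      using \<open>v \<in> S\<close> by (auto simp: L_def U_def)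
  qed
  then have "(\<Sum>v\<in>S. real (card (nbhd G v \<inter> W))) + card L \<le> real x * card S + card U * card W"
    using assms fin by (simp add: sum.distrib sum.If_cases Int_absorb1 mult.commute)
  also have "\<dots> \<le> real x * card S + (2 ^ card W * m) * card W"
    using mult_right_mono[OF U, of "real (card W)"] by simp
  finally show ?thesis by (simp add: L_def mult.commute)
qed

lemma near_bipartite_swap:
  assumes "near_bipartite G n q h W A B w0 \<epsilon>"
  shows "near_bipartite G n q h W B A w0 \<epsilon>"
proof -
  interpret near_bipartite G n q h W A B w0 \<epsilon> by fact
  show ?thesis
    by unfold_locales (use parts W_le indep large miss in auto)
qed

context near_bipartite
begin

abbreviation "cls \<equiv> of_type G W"

lemma fins: "finite W" "finite A" "finite B"
  using parts(1) finV by (metis finite_Un)+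

lemma n_eq: "n = card W + card A + card B"
proof -
  have "card (W \<union> A \<union> B) = card W + card A + card B"
    using parts fins by (subst card_Un_disjoint; simp add: Int_Un_distrib2 card_Un_disjoint)
  then show ?thesis using parts card_verts by simp
qed

lemma complete_cls: "S \<subseteq> cls T X \<Longrightarrow> Q \<subseteq> X \<Longrightarrow> joined G Q S"
  by (fastforce simp: joined_def of_type_def nbhd_def insert_commute)

text \<open>Some \<open>h\<close> vertices of type \<open>X\<close> miss at most
  \<open>\<epsilon> * n * h\<close> vertices of type \<open>X'\<close> together, so \<open>h\<close>
  of the latter see all of them; with \<open>q\<close> vertices of \<open>X \<inter> X'\<close> this
  is a forbidden tripartite graph. The low threshold on the side of \<open>A\<close> matters later:
  it limits rare types against a frequent type of the other side.\<close>

lemma types_meet: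
  assumes "h \<le> card (cls A X)" "\<epsilon> * n * h + h \<le> card (cls B X')"
  shows "card (X \<inter> X') < q"
proof (rule ccontr)
  assume "\<not> ?thesis"
  then obtain Q where Q: "Q \<subseteq> X \<inter> X'" "card Q = q"
    by (meson not_less obtain_subset_with_card_n)
  obtain S where S: "S \<subseteq> cls A X" "card S = h" "finite S"
    using assms(1) by (meson obtain_subset_with_card_n)
  define T where "T = {y\<in>cls B X'. \<forall>x\<in>S. {x, y} \<in> edges G}"
  have sub: "cls A X \<subseteq> A" "cls B X' \<subseteq> B" by (auto simp: of_type_def)
  have "card (cls B X') - card S * (\<epsilon> * n) \<le> card T"
    unfolding T_def
  proof (rule card_common_nbhd)
    fix x assume "x \<in> S"
    then have "card (B - nbhd G x) \<le> \<epsilon> * n" using S sub miss by auto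
    moreover have "card (cls B X' - nbhd G x) \<le> card (B - nbhd G x)"
      using fins sub by (intro card_mono) auto
    ultimately show "card (cls B X' - nbhd G x) \<le> \<epsilon> * n" by linarith
  qed (use S fins sub finite_subset in auto)
  then have "h \<le> card T" using assms(2) S by (simp add: algebra_simps)
  moreover have "joined G S T"
    by (auto simp: joined_def T_def)
  moreover have "joined G Q S" "joined G Q T"
    using complete_cls[of S A X Q] complete_cls[of T B X' Q] S Q by (auto simp: T_def)
  ultimately show False using tripartite_free[of Q S T] Q S by simp
qed

lemma types_join:
  assumes "X \<subseteq> W" "X' \<subseteq> W"
  shows "card X + card X' \<le> card W + card (X \<inter> X')"
proof -
  have "card X + card X' = card (X \<union> X') + card (X \<inter> X')"
    using assms fins finite_subset by (intro card_Un_Int) blast+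
  moreover have "card (X \<union> X') \<le> card W"
    using assms fins by (intro card_mono) auto
  ultimately show ?thesis by simp
qed

definition missing :: real where
  "missing = real (card A * card B) - p A B"

lemma missing_eq: "missing = (\<Sum>a\<in>A. real (card (B - nbhd G a)))"
proof -
  have "(\<Sum>a\<in>A. real (card (B - nbhd G a))) = (\<Sum>a\<in>A. real (card B) - card (nbhd G a \<inter> B))"
  proof (intro sum.cong refl)
    fix a show "real (card (B - nbhd G a)) = real (card B) - card (nbhd G a \<inter> B)"
      using card_Int_Diff[OF fins(3), of "nbhd G a"] by (simp add: Int_commute)
  qed
  then show ?thesis using fins by (simp add: missing_def card_pairs sum_subtractf)
qed

lemma card_incomplete_le: "card {a\<in>A. \<not> B \<subseteq> nbhd G a} \<le> missing"
proof -
  have "real (card {a\<in>A. \<not> B \<subseteq> nbhd G a}) = (\<Sum>a\<in>{a\<in>A. \<not> B \<subseteq> nbhd G a}. 1)" by simp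
  also have "\<dots> \<le> (\<Sum>a\<in>{a\<in>A. \<not> B \<subseteq> nbhd G a}. real (card (B - nbhd G a)))"
  proof (rule sum_mono)
    fix a assume "a \<in> {a\<in>A. \<not> B \<subseteq> nbhd G a}"
    then have "card (B - nbhd G a) \<noteq> 0" using fins by auto
    then show "1 \<le> real (card (B - nbhd G a))" by linarith
  qed
  also have "\<dots> \<le> missing"
    unfolding missing_eq by (rule sum_mono2) (use fins in auto)
  finally show ?thesis .
qed

abbreviation "sum_types S \<equiv> \<Sum>v\<in>S. real (card (nbhd G v \<inter> W))"

text \<open>In \<open>many_edges\<close>, \<open>n\<^sup>2 / 2\<close> contains
  \<open>2 * card A * card B\<close>, the most that pairs between the parts can contribute. After
  cancelling, the vertices outside \<open>W\<close> must have about
  \<open>(card W + q - 1) / 2\<close> neighbours in \<open>W\<close> on average, and more if there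
  are missing pairs or an imbalance.\<close>

lemma edge_count:
  "missing + (real (card A) - card B)\<^sup>2 / 4 + (real (card W) + q - 1) * (real (card A) + card B) / 2
    \<le> sum_types A + sum_types B + real q ^ 2 + real (card W) ^ 2 / 4"
proof -
  have AB: "finite (A \<union> B)" "W \<inter> (A \<union> B) = {}" "W \<union> (A \<union> B) = V"
    using fins parts by auto
  have zero: "p A A = 0" "p B B = 0"
    using indep fins by (auto simp: pairs_def nbhd_def)
  have "p (A \<union> B) (A \<union> B) = 2 * p A B"
    using fins parts zero by (simp add: card_pairs_Un_left card_pairs_Un_right card_pairs_sym[of G B A])
  moreover have "p W (A \<union> B) = p A W + p B W"
    using fins parts by (simp add: card_pairs_sym[of G W] card_pairs_Un_left)
  ultimately have "p W W + 2 * (p A W + p B W) + 2 * p A B = 2 * card (edges G)"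
    using split_pairs[OF AB(3,2)] by simp
  then have "real (p W W) + 2 * (real (p A W) + p B W) + 2 * real (p A B) = 2 * real (card (edges G))"
    by (drule_tac arg_cong[of _ _ real]) simp
  moreover define sA sB where "sA = sum_types A" and "sB = sum_types B"
  have "real (p A W) = sA" "real (p B W) = sB"
    using fins by (simp_all add: card_pairs sA_def sB_def)
  moreover have "real (p A B) = real (card A) * card B - missing"
    by (simp add: missing_def)
  ultimately have "real (p W W) + 2 * (sA + sB) + 2 * (real (card A) * card B - missing) = 2 * real (card (edges G))"
    by simp
  moreover have "real (p W W) \<le> real (card W) ^ 2"
    using card_pairs_le[OF fins(1,1), of G] by (metis of_nat_le_iff of_nat_mult power2_eq_square)
  moreover have "real n ^ 2 / 2 + (real q - 1) * n - 2 * real q ^ 2 \<le> 2 * real (card (edges G))"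
    using many_edges by simp
  ultimately have "real n ^ 2 / 2 + (real q - 1) * n - 2 * real q ^ 2 \<le>
    real (card W) ^ 2 + 2 * (sA + sB) + 2 * (real (card A) * card B - missing)"
    by linarith
  moreover have "(real q - 1) * (real (card A) + card B) \<le> (real q - 1) * n"
    using q n_eq by (intro mult_left_mono) auto
  moreover have "real n ^ 2 / 2 = real (card W) ^ 2 / 2 + card W * (real (card A) + card B)
    + (real (card A) - card B)\<^sup>2 / 2 + 2 * (real (card A) * card B)"
    by (simp add: n_eq power2_eq_square field_simps)
  moreover have "(real (card W) + q - 1) * (real (card A) + card B) / 2 =
      card W * (real (card A) + card B) / 2 + (real q - 1) * (real (card A) + card B) / 2"
    by (simp add: field_simps)
  ultimately show ?thesis unfolding sA_def[symmetric] sB_def[symmetric] by argo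
qed

end

context near_bipartite
begin

lemma popular_type:
  fixes m :: real
  assumes "0 \<le> m" "2 ^ w0 * m < card S" "finite S"
  shows "\<exists>X\<subseteq>W. m < card (cls S X)"
proof (rule ccontr)
  assume "\<not> ?thesis"
  then have "card {v\<in>S. nbhd G v \<inter> W \<in> UNIV} \<le> 2 ^ card W * m"
    using assms fins by (intro card_types_le) (auto simp: not_less)
  also have "\<dots> \<le> 2 ^ w0 * m"
    using assms W_le by (intro mult_right_mono power_increasing) auto
  finally show False using assms by simp
qed

text \<open>The type is the largest among the frequent ones, not the most frequent, so that every
  larger type is rare, as \<open>sum_types_le\<close> requires.\<close>

lemma max_popular_type:
  fixes m :: real
  assumes "0 \<le> m" "2 ^ w0 * m < card S" "finite S"
  shows "\<exists>X\<subseteq>W. m < card (cls S X) \<and> (\<forall>X'\<subseteq>W. card X < card X' \<longrightarrow> card (cls S X') \<le> m)"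
proof -
  define \<X> where "\<X> = {X. X \<subseteq> W \<and> m < card (cls S X)}"
  have "finite \<X>" "\<X> \<noteq> {}"
    using popular_type[OF assms] fins by (auto simp: \<X>_def)
  from ex_max_nat[OF this, of card] obtain X where "X \<in> \<X>" "\<forall>X'\<in>\<X>. card X' \<le> card X" by blast
  moreover have "card (cls S X') \<le> m" if "X' \<subseteq> W" "card X < card X'" for X'
  proof (rule ccontr)
    assume "\<not> ?thesis"
    then have "X' \<in> \<X>" using that by (simp add: \<X>_def)
    then show False using \<open>\<forall>X'\<in>\<X>. _\<close> that by (meson not_less)
  qed
  ultimately show ?thesis unfolding \<X>_def by blast
qed

text \<open>Rounding: \<open>edge_count\<close> forces the integer \<open>x + y\<close> up to \<open>card W + q - 1\<close>.\<close>

lemma popular_sizes: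
  fixes m :: real
  assumes A: "\<And>X. X \<subseteq> W \<Longrightarrow> x < card X \<Longrightarrow> card (cls A X) \<le> m" "x \<le> card W"
    and B: "\<And>X. X \<subseteq> W \<Longrightarrow> y < card X \<Longrightarrow> card (cls B X) \<le> m" "y \<le> card W"
    and m: "0 \<le> m"
  shows "missing + card {v\<in>A. card (nbhd G v \<inter> W) < x} + card {v\<in>B. card (nbhd G v \<inter> W) < y}
    + (real (card W) + q - 1 - x - y) * (real (card A) + card B) / 2
    \<le> 2 * (w0 * (2 ^ w0 * m)) + real h ^ 2 + real w0 ^ 2"
proof -
  \<comment> \<open>For \<open>x \<noteq> y\<close>, unequal parts could gain a term linear in the
    imbalance. The square of the imbalance in \<open>edge_count\<close> absorbs it up to a
    constant.\<close>
  have "(real x - y) * (real (card A) - card B) / 2 \<le> (real (card A) - card B)\<^sup>2 / 4 + (real x - y)\<^sup>2 / 4"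
    using zero_le_power2[of "(real x - y) - (real (card A) - card B)"]
    by (simp add: power2_eq_square field_simps)
  moreover have "(real x - y)\<^sup>2 \<le> real (card W) ^ 2"
    using A(2) B(2) by (intro power2_le_iff_abs_le[THEN iffD2]) (auto simp: abs_le_iff)
  moreover have "real x * card A + real y * card B =
      (real x + y) * (real (card A) + card B) / 2 + (real x - y) * (real (card A) - card B) / 2"
    by (simp add: field_simps)
  moreover have "real (card W) * (2 ^ card W * m) \<le> w0 * (2 ^ w0 * m)"
    using W_le m by (intro mult_mono mult_right_mono power_increasing) auto
  moreover have "real (card W) ^ 2 \<le> real w0 ^ 2" "real q ^ 2 \<le> real h ^ 2"
    using W_le q by (auto intro!: power_mono)
  moreover have "(real (card W) + q - 1 - x - y) * (real (card A) + card B) / 2 =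
    (real (card W) + q - 1) * (real (card A) + card B) / 2 - (real x + y) * (real (card A) + card B) / 2"
    by (simp add: field_simps)
  moreover have "sum_types A + card {v\<in>A. card (nbhd G v \<inter> W) < x} \<le> real x * card A + card W * (2 ^ card W * m)"
    by (rule sum_types_le) (use A m fins in auto)
  moreover have "sum_types B + card {v\<in>B. card (nbhd G v \<inter> W) < y} \<le> real y * card B + card W * (2 ^ card W * m)"
    by (rule sum_types_le) (use B m fins in auto)
  moreover note edge_count zero_le_power2[of "real (card W)"]
  ultimately show ?thesis by argo
qed

text \<open>The type of a removed vertex is too small or too large, or the vertex misses part of
  \<open>B\<close>. The three kinds are bounded by the recorded deficit, by
  \<open>card_types_le\<close> and by \<open>missing\<close>.\<close>

lemma card_irregular:
  assumes "\<And>X. X \<subseteq> W \<Longrightarrow> x < card X \<Longrightarrow> card (cls A X) \<le> h"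
  shows "card (A - {a\<in>A. card (nbhd G a \<inter> W) = x \<and> B \<subseteq> nbhd G a})
    \<le> missing + card {v\<in>A. card (nbhd G v \<inter> W) < x} + 2 ^ w0 * real h" (is "real (card ?D) \<le> _ + real (card ?L) + _")
proof -
  let ?U = "{v\<in>A. nbhd G v \<inter> W \<in> {X. x < card X}}"
  let ?I = "{a\<in>A. \<not> B \<subseteq> nbhd G a}"
  have "card ?U \<le> 2 ^ card W * real h"
    by (rule card_types_le) (use fins assms in auto)
  also have "\<dots> \<le> 2 ^ w0 * real h"
    using W_le by (intro mult_right_mono power_increasing) auto
  finally have "card ?U \<le> 2 ^ w0 * real h" .
  moreover have "card ?D \<le> card (?L \<union> ?U \<union> ?I)"
    using fins by (intro card_mono) auto
  then have "card ?D \<le> card ?L + card ?U + card ?I"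
    using card_Un_le[of "?L \<union> ?U" ?I] card_Un_le[of ?L ?U] by linarith
  ultimately show ?thesis using card_incomplete_le by linarith
qed

lemma card_other_types:
  assumes "A' \<subseteq> A" "\<And>Z. Z \<subseteq> W \<Longrightarrow> Z \<noteq> X \<Longrightarrow> card (cls A' Z) \<le> h"
  shows "card (A' - cls A' X) \<le> 2 ^ w0 * real h"
proof -
  have fin: "finite A'" using assms(1) fins finite_subset by auto
  have "card (A' - cls A' X) \<le> card {v\<in>A'. nbhd G v \<inter> W \<in> - {X}}"
    using fin by (intro card_mono) (auto simp: of_type_def)
  also have "\<dots> \<le> 2 ^ card W * real h"
    by (rule card_types_le) (use fins fin assms in auto)
  also have "\<dots> \<le> 2 ^ w0 * real h"
    using W_le by (intro mult_right_mono power_increasing) auto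
  finally show ?thesis by simp
qed

text \<open>To vertices of type \<open>X\<close>, the set \<open>W - X\<close> looks like a part of
  \<open>A\<close>; hence it joins \<open>A\<close> in the final partition.\<close>

lemma nbhd_eq:
  assumes "v \<in> A" "B \<subseteq> nbhd G v" "nbhd G v \<inter> W = X"
  shows "nbhd G v = V - (A \<union> (W - X))"
proof -
  have "nbhd G v \<inter> A = {}" using indep assms(1) by (auto simp: mem_nbhd)
  then show ?thesis using assms nbhd_subset[OF simple, of v] parts by auto
qed

lemma card_exceptional:
  assumes "A' \<subseteq> A"
  shows "card (A \<union> (W - X) - S) \<le> card (A - A') + card (A' - S) + w0"
proof -
  have fin: "finite A'" using assms fins finite_subset by auto
  have "card (A \<union> (W - X) - S) \<le> card ((A - A') \<union> (A' - S) \<union> W)"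
    using fins fin by (intro card_mono) auto
  also have "\<dots> \<le> card (A - A') + card (A' - S) + card W"
    using card_Un_le[of "(A - A') \<union> (A' - S)" W] card_Un_le[of "A - A'" "A' - S"] by linarith
  finally show ?thesis using W_le by simp
qed

text \<open>The sizes leave no slack:
  \<open>card X + card Y = card (X \<union> Y) + card (X \<inter> Y)\<close> and
  \<open>card (X \<inter> Y) < q\<close> force the first two claims. Then
  \<open>X \<inter> Y\<close> determines \<open>Y\<close>, so another type \<open>Z\<close> has a
  different \<open>X \<inter> Z\<close> of the same size. A vertex \<open>w\<close> of it outside
  \<open>Y\<close>, with \<open>X \<inter> Y\<close> as \<open>Q\<close>, contradicts
  \<open>split_free\<close>.\<close>

lemma unique_type:
  assumes good: "joined G A' B'" "A' \<subseteq> A" "B' \<subseteq> B"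
    and X: "X \<subseteq> W" "h \<le> card (cls A' X)"
    and Y: "Y \<subseteq> W" "h \<le> card (cls B' Y)" "Z \<subseteq> W" "h \<le> card (cls B' Z)"
    and sizes: "card X + card Y + 1 = card W + q" "card X + card Z + 1 = card W + q"
  shows "card (X \<inter> Y) + 1 = q" "X \<union> Y = W" "Y = Z"
proof -
  have *: "card (X \<inter> Y) + 1 = q \<and> X \<union> Y = W"
    if Y: "Y \<subseteq> W" "h \<le> card (cls B' Y)" and size: "card X + card Y + 1 = card W + q" for Y
  proof -
    have "card (X \<inter> Y) < q"
    proof (rule ccontr)
      assume "\<not> ?thesis"
      then obtain Q where Q: "Q \<subseteq> X \<inter> Y" "card Q = q"
        by (meson not_less obtain_subset_with_card_n)
      have "joined G Q (cls A' X)" "joined G Q (cls B' Y)"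
        using Q complete_cls by blast+
      moreover have "joined G (cls A' X) (cls B' Y)"
        by (rule joined_mono[OF good(1)]) (auto simp: of_type_def)
      ultimately show False using tripartite_free Q X Y by blast
    qed
    moreover have fin: "finite X" "finite Y" using X(1) Y(1) fins finite_subset by blast+
    have "card X + card Y = card (X \<union> Y) + card (X \<inter> Y)"
      by (rule card_Un_Int[OF fin])
    moreover have "card (X \<union> Y) \<le> card W"
      using X(1) Y(1) fins by (intro card_mono) auto
    ultimately have "card (X \<inter> Y) + 1 = q" "card (X \<union> Y) = card W" using size by auto
    then show ?thesis using X(1) Y(1) fins card_subset_eq[of W "X \<union> Y"] by auto
  qed
  show Y1: "card (X \<inter> Y) + 1 = q" "X \<union> Y = W" using *[OF Y(1,2) sizes(1)] by auto
  have Z1: "card (X \<inter> Z) + 1 = q" "X \<union> Z = W" using *[OF Y(3,4) sizes(2)] by auto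
  show "Y = Z"
  proof (rule ccontr)
    assume "Y \<noteq> Z"
    have fin: "finite X" "finite Y" "finite Z" using X(1) Y fins finite_subset by blast+
    have "X \<inter> Y \<noteq> X \<inter> Z" using \<open>Y \<noteq> Z\<close> Y1 Z1 Y by blast
    then have "\<not> X \<inter> Z \<subseteq> X \<inter> Y"
      using card_subset_eq[of "X \<inter> Y" "X \<inter> Z"] fin Y1 Z1 by auto
    then obtain w where w: "w \<in> X" "w \<in> Z" "w \<notin> Y" by blast
    have subs: "cls A' X \<subseteq> A'" "cls B' Y \<subseteq> B'" "cls B' Z \<subseteq> B'" by (auto simp: of_type_def)
    show False
    proof (rule split_free)
      show "card (X \<inter> Y) + 1 = q" by fact
      show "h \<le> card (cls A' X)" "h \<le> card (cls B' Y)" "h \<le> card (cls B' Z)" by fact+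
      show "cls B' Y \<inter> cls B' Z = {}" using \<open>Y \<noteq> Z\<close> by (auto simp: of_type_def)
      show "insert w (X \<inter> Y) \<inter> (cls B' Y \<union> cls B' Z) = {}"
        using w X(1) parts good subs by blast
      have "joined G (cls A' X) (insert w (X \<inter> Y))"
        using complete_cls[of "cls A' X" A' X "insert w (X \<inter> Y)"] w
        by (simp add: joined_sym)
      moreover have "joined G (cls A' X) (cls B' Y \<union> cls B' Z)"
        by (rule joined_mono[OF good(1)]) (use subs in auto)
      ultimately show "joined G (cls A' X) (insert w (X \<inter> Y) \<union> cls B' Y \<union> cls B' Z)"
        by (auto simp: joined_def)
      show "joined G (X \<inter> Y) (cls B' Y)" by (rule complete_cls[of _ B' Y]) auto
      show "joined G {w} (cls B' Z)" by (rule complete_cls[of _ B' Z]) (use w in auto)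
    qed (use fin w in auto)
  qed
qed

end

section \<open>Balance and the structure theorem\<close>

context extremal_like
begin

text \<open>Reattaching \<open>v\<close> to the common neighbourhood of \<open>T\<close> amounts to
  moving it into \<open>S2\<close>, with \<open>n - card S2 - 1\<close> neighbours in place of
  \<open>n - card S1\<close>. By \<open>degree_common\<close> this is no gain.\<close>

lemma balanced:
  assumes parts: "W \<union> S1 \<union> S2 = V" "W \<inter> S1 = {}" "W \<inter> S2 = {}" "S1 \<inter> S2 = {}"
    and S1: "v \<in> S1" "nbhd G v = V - S1"
    and S2: "T \<subseteq> S2" "h \<le> card T" "\<And>x. x \<in> T \<Longrightarrow> nbhd G x = V - S2"
  shows "card S1 \<le> card S2 + 1"
proof -
  have fin: "finite S1" "finite S2" using parts(1) finV by (metis finite_Un)+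
  have sub: "S1 \<subseteq> V" "S2 \<subseteq> V" using parts by auto
  have "T \<noteq> {}" using S2 q by auto
  have eq: "{y\<in>V - {v}. \<forall>x\<in>T. {x, y} \<in> edges G} = V - insert v S2"
    using S2(3) \<open>T \<noteq> {}\<close> by (auto simp: mem_nbhd[symmetric])
  have "card (V - insert v S2) \<le> degree G v"
    unfolding eq[symmetric] using S1 S2 parts by (intro degree_common) auto
  moreover have "degree G v = n - card S1"
    using S1 sub fin card_verts by (simp add: degree_def card_Diff_subset)
  moreover have "card (V - insert v S2) = n - (card S2 + 1)"
  proof -
    have "v \<notin> S2" "insert v S2 \<subseteq> V" using S1 sub parts by auto
    then show ?thesis using fin card_verts card_Diff_subset[of "insert v S2" V] by simp
  qed
  moreover have "card S1 + card S2 \<le> n"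
    using card_Un_disjoint[OF fin parts(4)] card_sub[of "S1 \<union> S2"] sub by simp
  moreover have "0 < card S1" using S1 fin by (auto simp: card_gt_0_iff)
  ultimately show ?thesis by linarith
qed

end


definition structured :: "'a graph \<Rightarrow> nat \<Rightarrow> nat \<Rightarrow> 'a set \<Rightarrow> 'a set \<Rightarrow> 'a set \<Rightarrow> bool" where
  "structured G q M W S1 S2 \<longleftrightarrow> W \<union> S1 \<union> S2 = verts G \<and> W \<inter> S1 = {} \<and> W \<inter> S2 = {} \<and> S1 \<inter> S2 = {} \<and>
     card W + 1 = q \<and> card S1 \<le> card S2 + 1 \<and> card S2 \<le> card S1 + 1 \<and>
     (\<forall>S\<in>{S1, S2}. \<exists>S'\<subseteq>S. card (S - S') \<le> M \<and> (\<forall>v\<in>S'. nbhd G v = verts G - S))"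

text \<open>\<open>c\<close> is so small that each side has a type with more than
  \<open>c * n\<close> vertices and that the first count errs little; \<open>\<epsilon>\<close>
  makes \<open>types_meet\<close> applicable to such types. The first three terms of
  \<open>K\<close> are the error of the second count. Of the two terms \<open>2 ^ w0 * h\<close>,
  one pays for the too large types outside \<open>A'\<close>, the other for the rare types inside
  it.\<close>

lemma near_bipartite_structure:
  fixes c \<epsilon> :: real
  assumes nb: "near_bipartite G n q h W A B w0 \<epsilon>"
    and c: "c = 1 / (24 * (real w0 + 1) * 2 ^ w0)" and \<epsilon>: "\<epsilon> = c / (2 * (real h + 1))"
    and K: "K = 2 * (w0 * (2 ^ w0 * h)) + h\<^sup>2 + w0\<^sup>2 + 2 * (2 ^ w0 * h)"
    and n: "4 * K < n" "3 * (K + h) < n" "2 * real h \<le> c * n"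
  shows "\<exists>W S1 S2. structured G q (K + w0) W S1 S2"
proof -
  interpret near_bipartite G n q h W A B w0 \<epsilon> by (fact nb)
  interpret swap: near_bipartite G n q h W B A w0 \<epsilon> by (rule near_bipartite_swap[OF nb])
  have c0: "0 < c" by (simp add: c)
  have n0: "0 < real n" using n by simp
  have cw: "2 ^ w0 * c = 1 / (24 * (real w0 + 1))" by (simp add: c)
  have "2 ^ w0 * c \<le> 1 / 24" "2 * (w0 * (2 ^ w0 * c)) \<le> 1 / 12"
    unfolding cw by (simp_all add: divide_simps)
  from mult_right_mono[OF this(1), of "real n"] mult_right_mono[OF this(2), of "real n"]
  have cn: "2 ^ w0 * (c * n) \<le> n / 24" "2 * (w0 * (2 ^ w0 * (c * n))) \<le> n / 12"
    by simp_all
  have "\<epsilon> * h \<le> c / 2" using c0 by (simp add: \<epsilon> field_simps)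
  from mult_right_mono[OF this, of "real n"] have \<epsilon>h: "\<epsilon> * n * h + h \<le> c * n"
    using n(3) by (simp add: mult_ac)
  have cn0: "0 \<le> c * n" using c0 by simp
  have big: "2 ^ w0 * (c * n) < card A" "2 ^ w0 * (c * n) < card B"
    using cn(1) large n0 by linarith+
  obtain XA where XA: "XA \<subseteq> W" "c * n < card (cls A XA)"
    "\<And>X'. X' \<subseteq> W \<Longrightarrow> card XA < card X' \<Longrightarrow> card (cls A X') \<le> c * n"
    using max_popular_type[OF cn0 big(1) fins(2)] by blast
  obtain XB where XB: "XB \<subseteq> W" "c * n < card (cls B XB)"
    "\<And>X'. X' \<subseteq> W \<Longrightarrow> card XB < card X' \<Longrightarrow> card (cls B X') \<le> c * n"
    using max_popular_type[OF cn0 big(2) fins(3)] by blast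
  define x y where "x = card XA" and "y = card XB"
  have xW: "x \<le> card W" "y \<le> card W"
    using XA XB fins by (auto simp: x_def y_def intro: card_mono)
  have hle: "h \<le> c * n" using n(3) by simp
  have hA: "h \<le> card (cls A XA)" "\<epsilon> * n * h + h \<le> card (cls A XA)"
    and hB: "h \<le> card (cls B XB)" "\<epsilon> * n * h + h \<le> card (cls B XB)"
    using hle \<epsilon>h XA(2) XB(2) by linarith+
  have le: "x + y + 1 \<le> card W + q"
    using types_meet[OF hA(1) hB(2)] types_join[OF XA(1) XB(1)] by (simp add: x_def y_def)
  have sums: "2 * real n / 3 \<le> real (card A) + card B" using large by simp
  have miss0: "0 \<le> missing" unfolding missing_eq by (intro sum_nonneg) auto
  \<comment> \<open>A deficit of 1 would cost half of \<open>card A + card B\<close>, at least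
    \<open>n / 3\<close>, while the error is at most \<open>n / 12 + K\<close> with
    \<open>4 * K < n\<close>.\<close>
  have xy: "x + y + 1 = card W + q"
  proof (rule ccontr)
    assume "x + y + 1 \<noteq> card W + q"
    with le have "1 \<le> real (card W) + q - 1 - x - y" by linarith
    from mult_right_mono[OF this, of "real (card A) + card B"]
    have "real (card A) + card B \<le> (real (card W) + q - 1 - x - y) * (real (card A) + card B)"
      by simp
    moreover have "missing + card {v\<in>A. card (nbhd G v \<inter> W) < x} + card {v\<in>B. card (nbhd G v \<inter> W) < y}
        + (real (card W) + q - 1 - x - y) * (real (card A) + card B) / 2
        \<le> 2 * (w0 * (2 ^ w0 * (c * n))) + real h ^ 2 + real w0 ^ 2"
      by (rule popular_sizes) (use XA XB xW cn0 in \<open>auto simp: x_def y_def\<close>)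
    moreover have "real h ^ 2 + real w0 ^ 2 \<le> K"
      by (simp add: K)
    ultimately have "n / 3 \<le> n / 12 + real K" using sums cn(2) miss0
      of_nat_0_le_iff[of "card {v\<in>A. card (nbhd G v \<inter> W) < x}", where 'a = real]
      of_nat_0_le_iff[of "card {v\<in>B. card (nbhd G v \<inter> W) < y}", where 'a = real] by argo
    then show False using n(1) by simp
  qed
  \<comment> \<open>As \<open>x + y\<close> is now the maximum that \<open>types_meet\<close>
    allows, a larger type with more than \<open>h\<close> vertices is impossible next to
    \<open>XB\<close>. This is what lowers the threshold from \<open>c * n\<close> to
    \<open>h\<close>.\<close>
  have smallA: "card (cls A X) \<le> h" if X: "X \<subseteq> W" "x < card X" for X
    using types_meet[of X XB] types_join[OF X(1) XB(1)] hB(2) xy X(2) by (fastforce simp: y_def)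
  have smallB: "card (cls B X) \<le> h" if X: "X \<subseteq> W" "y < card X" for X
    using swap.types_meet[of X XA] types_join[OF X(1) XA(1)] hA(2) xy X(2) by (fastforce simp: x_def)
  define lA lB where "lA = card {v\<in>A. card (nbhd G v \<inter> W) < x}" and "lB = card {v\<in>B. card (nbhd G v \<inter> W) < y}"
  have "real (card W) + q - 1 - x - y = 0" using xy by linarith
  moreover have "missing + lA + lB + (real (card W) + q - 1 - x - y) * (real (card A) + card B) / 2
      \<le> 2 * (w0 * (2 ^ w0 * real h)) + real h ^ 2 + real w0 ^ 2"
    unfolding lA_def lB_def by (rule popular_sizes) (use smallA smallB xW in auto)
  ultimately have low: "missing + lA + lB \<le> 2 * (w0 * (2 ^ w0 * real h)) + real h ^ 2 + real w0 ^ 2"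
    by simp
  define A' where "A' = {a\<in>A. card (nbhd G a \<inter> W) = x \<and> B \<subseteq> nbhd G a}"
  define B' where "B' = {b\<in>B. card (nbhd G b \<inter> W) = y \<and> A \<subseteq> nbhd G b}"
  have sub: "A' \<subseteq> A" "B' \<subseteq> B" by (auto simp: A'_def B'_def)
  have fin': "finite A'" "finite B'" using sub fins finite_subset by auto
  have good: "joined G A' B'" "joined G B' A'"
    by (auto simp: joined_def A'_def B'_def mem_nbhd)
  have remA: "card (A - A') \<le> missing + lA + 2 ^ w0 * real h"
    unfolding A'_def lA_def by (rule card_irregular[OF smallA])
  have "card (B - B') \<le> swap.missing + lB + 2 ^ w0 * real h"
    unfolding B'_def lB_def by (rule swap.card_irregular[OF smallB])
  moreover have "swap.missing = missing"
    by (simp add: missing_def swap.missing_def card_pairs_sym[of G B A] mult.commute)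
  ultimately have remB: "card (B - B') \<le> missing + lB + 2 ^ w0 * real h" by simp
  define K' where "K' = 2 * (w0 * (2 ^ w0 * real h)) + real h ^ 2 + real w0 ^ 2 + 2 ^ w0 * real h"
  have KK': "real K = K' + 2 ^ w0 * real h" by (simp add: K K'_def)
  have rem: "card (A - A') \<le> K'" "card (B - B') \<le> K'"
    using remA remB low by (auto simp: K'_def)
  have "card A = card A' + card (A - A')" "card B = card B' + card (B - B')"
    using card_Int_Diff[OF fins(2), of A'] card_Int_Diff[OF fins(3), of B'] sub by (simp_all add: Int_absorb1)
  then have "n / 3 - K' \<le> card A'" "n / 3 - K' \<le> card B'" using rem large by linarith+
  moreover have "real (3 * K) < real n" unfolding of_nat_less_iff using n(2) by simp
  then have "3 * real K < n" by simp
  ultimately have big': "2 ^ w0 * real h < card A'" "2 ^ w0 * real h < card B'"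
    using \<open>3 * real K < n\<close> KK' by argo+
  \<comment> \<open>\<open>X\<close> may differ from \<open>XA\<close>: all vertices of
    \<open>A'\<close> have types of size \<open>x\<close>, so any type frequent within
    \<open>A'\<close> serves.\<close>
  obtain X where X: "X \<subseteq> W" "h < card (cls A' X)"
    using popular_type[OF _ big'(1) fin'(1)] by auto
  obtain Y where Y: "Y \<subseteq> W" "h < card (cls B' Y)"
    using popular_type[OF _ big'(2) fin'(2)] by auto
  have sizeA: "card Z = x" if "h \<le> card (cls A' Z)" for Z
  proof -
    have "cls A' Z \<noteq> {}" using that q by auto
    then show ?thesis by (auto simp: of_type_def A'_def)
  qed
  have sizeB: "card Z = y" if "h \<le> card (cls B' Z)" for Z
  proof -
    have "cls B' Z \<noteq> {}" using that q by auto
    then show ?thesis by (auto simp: of_type_def B'_def)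
  qed
  have X': "h \<le> card (cls A' X)" and Y': "h \<le> card (cls B' Y)" using X Y by auto
  have sXY: "card X + card Y + 1 = card W + q" "card Y + card X + 1 = card W + q"
    using sizeA[OF X'] sizeB[OF Y'] xy by auto
  have XY: "card (X \<inter> Y) + 1 = q" "X \<union> Y = W"
    using unique_type[OF good(1) sub X(1) X' Y(1) Y' Y(1) Y' sXY(1,1)] by auto
  have otherB: "card (cls B' Z) \<le> h" if "Z \<subseteq> W" "Z \<noteq> Y" for Z
  proof (rule ccontr)
    assume "\<not> ?thesis"
    then have Z: "h \<le> card (cls B' Z)" by simp
    have "card X + card Z + 1 = card W + q" using sizeA[OF X'] sizeB[OF Z] xy by auto
    from unique_type(3)[OF good(1) sub X(1) X' Y(1) Y' that(1) Z sXY(1) this] show False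
      using that by simp
  qed
  have otherA: "card (cls A' Z) \<le> h" if "Z \<subseteq> W" "Z \<noteq> X" for Z
  proof (rule ccontr)
    assume "\<not> ?thesis"
    then have Z: "h \<le> card (cls A' Z)" by simp
    have "card Y + card Z + 1 = card W + q" using sizeA[OF Z] sizeB[OF Y'] xy by auto
    from swap.unique_type(3)[OF good(2) sub(2,1) Y(1) Y' X(1) X' that(1) Z sXY(2) this] show False
      using that by simp
  qed
  have tA: "card (A' - cls A' X) \<le> 2 ^ w0 * real h"
    by (rule card_other_types[OF sub(1) otherA])
  have tB: "card (B' - cls B' Y) \<le> 2 ^ w0 * real h"
    by (rule swap.card_other_types[OF sub(2) otherB])
  define S1 where "S1 = A \<union> (W - X)"
  define S2 where "S2 = B \<union> (W - Y)"
  have clsA: "cls A' X \<subseteq> S1" "cls B' Y \<subseteq> S2"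
    using sub by (auto simp: of_type_def S1_def S2_def)
  have NA: "nbhd G v = V - S1" if "v \<in> cls A' X" for v
    unfolding S1_def by (rule nbhd_eq) (use that in \<open>auto simp: of_type_def A'_def\<close>)
  have NB: "nbhd G v = V - S2" if "v \<in> cls B' Y" for v
    unfolding S2_def by (rule swap.nbhd_eq) (use that in \<open>auto simp: of_type_def B'_def\<close>)
  have "card (S1 - cls A' X) \<le> card (A - A') + card (A' - cls A' X) + w0"
    unfolding S1_def by (rule card_exceptional[OF sub(1)])
  then have c1: "card (S1 - cls A' X) \<le> K + w0" using tA rem KK' by linarith
  have "card (S2 - cls B' Y) \<le> card (B - B') + card (B' - cls B' Y) + w0"
    unfolding S2_def by (rule swap.card_exceptional[OF sub(2)])
  then have c2: "card (S2 - cls B' Y) \<le> K + w0" using tB rem KK' by linarith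
  have P: "(X \<inter> Y) \<union> S1 \<union> S2 = V" "(X \<inter> Y) \<inter> S1 = {}" "(X \<inter> Y) \<inter> S2 = {}" "S1 \<inter> S2 = {}"
    using parts XY(2) X(1) Y(1) by (auto simp: S1_def S2_def)
  have P': "(X \<inter> Y) \<union> S2 \<union> S1 = V" "S2 \<inter> S1 = {}" using P by auto
  obtain a b where ab: "a \<in> cls A' X" "b \<in> cls B' Y"
    using X(2) Y(2) by (metis card.empty ex_in_conv not_less0)
  have b1: "card S1 \<le> card S2 + 1"
    using balanced[OF P, of a "cls B' Y"] ab clsA NA NB Y' by blast
  have b2: "card S2 \<le> card S1 + 1"
    using balanced[OF P'(1) P(3,2) P'(2), of b "cls A' X"] ab clsA NA NB X' by blast
  have "\<exists>S'\<subseteq>S1. card (S1 - S') \<le> K + w0 \<and> (\<forall>v\<in>S'. nbhd G v = V - S1)"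
    using clsA c1 NA by (intro exI[of _ "cls A' X"]) auto
  moreover have "\<exists>S'\<subseteq>S2. card (S2 - S') \<le> K + w0 \<and> (\<forall>v\<in>S'. nbhd G v = V - S2)"
    using clsA c2 NB by (intro exI[of _ "cls B' Y"]) auto
  ultimately have "\<forall>S\<in>{S1, S2}. \<exists>S'\<subseteq>S. card (S - S') \<le> K + w0 \<and> (\<forall>v\<in>S'. nbhd G v = V - S)"
    by simp
  then show ?thesis
    unfolding structured_def
    by (rule_tac exI[of _ "X \<inter> Y"], rule_tac exI[of _ S1], rule_tac exI[of _ S2])
      (intro conjI P XY(1) b1 b2)
qed

lemma extremal_like_structure:
  "\<exists>M N. \<forall>(G :: 'a graph) n. extremal_like G n q h \<and> N \<le> n \<longrightarrow>
    (\<exists>W S1 S2. structured G q M W S1 S2)"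
proof -
  from bounded_exceptional_set[of q h, where 'a = 'a] obtain w0 where w0:
    "\<forall>\<epsilon> :: real. 0 < \<epsilon> \<longrightarrow> (\<exists>N. \<forall>(G :: 'a graph) n. extremal_like G n q h \<and> N \<le> n \<longrightarrow>
    (\<exists>W A B. near_bipartite G n q h W A B w0 \<epsilon>))"
    by (elim exE) (rule that)
  define c :: real where "c = 1 / (24 * (real w0 + 1) * 2 ^ w0)"
  define \<epsilon> where "\<epsilon> = c / (2 * (real h + 1))"
  define K where "K = 2 * (w0 * (2 ^ w0 * h)) + h\<^sup>2 + w0\<^sup>2 + 2 * (2 ^ w0 * h)"
  have "0 < c" by (simp add: c_def)
  then have "0 < \<epsilon>" by (simp add: \<epsilon>_def)
  from w0[rule_format, OF this] obtain N0 where N0: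
    "\<forall>(G :: 'a graph) n. extremal_like G n q h \<and> N0 \<le> n \<longrightarrow>
    (\<exists>W A B. near_bipartite G n q h W A B w0 \<epsilon>)"
    by (elim exE) (rule that)
  define N where "N = N0 + 4 * K + 3 * (K + h) + nat \<lceil>2 * h / c\<rceil> + 1"
  have main: "\<exists>W S1 S2. structured G q (K + w0) W S1 S2"
    if ex: "extremal_like G n q h" and n: "N \<le> n" for G :: "'a graph" and n
  proof -
    have n': "N0 \<le> n" "4 * K < n" "3 * (K + h) < n" using n by (auto simp: N_def)
    have "2 * h / c \<le> N" unfolding N_def by simp linarith
    then have "2 * h / c \<le> n" using n by linarith
    then have "2 * real h \<le> c * n" using \<open>0 < c\<close> by (simp add: field_simps)
    from N0[rule_format, OF conjI[OF ex n'(1)]] obtain W A B where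
      "near_bipartite G n q h W A B w0 \<epsilon>"
      by (elim exE) (rule that)
    from near_bipartite_structure[OF this c_def \<epsilon>_def K_def n'(2,3) \<open>2 * real h \<le> c * n\<close>]
    show ?thesis .
  qed
  show ?thesis
    by (rule exI[of _ "K + w0"], rule exI[of _ N], intro allI impI, elim conjE) (rule main)
qed

section \<open>Graphs with the required colourings\<close>

text \<open>The colours have fixed roles: class 2 is the independent set whose deletion leaves a
  bipartite graph with parts 0 and 1.\<close>

definition proper_3_colouring :: "'a graph \<Rightarrow> ('a \<Rightarrow> nat) \<Rightarrow> bool" where
  "proper_3_colouring H c \<longleftrightarrow> c ` verts H \<subseteq> {..<3} \<and> (\<forall>u v. {u, v} \<in> edges H \<longrightarrow> c u \<noteq> c v)"

definition colour_class :: "'a graph \<Rightarrow> ('a \<Rightarrow> nat) \<Rightarrow> nat \<Rightarrow> 'a set" where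
  "colour_class H c i = {v\<in>verts H. c v = i}"

lemma proper_3_colouringD:
  assumes "proper_3_colouring H c"
  shows "v \<in> verts H \<Longrightarrow> c v = 0 \<or> c v = 1 \<or> c v = 2" "{u, v} \<in> edges H \<Longrightarrow> c u \<noteq> c v"
  using assms by (force simp: proper_3_colouring_def)+

lemma inj_into:
  assumes "finite S" "finite T" "card S \<le> card T"
  shows "\<exists>f. inj_on f S \<and> f ` S \<subseteq> T"
  using assms inj_on_iff_card_le by blast

lemma inj_on_disjoint_UnI:
  assumes "inj_on g A" "inj_on g B" "g ` A \<subseteq> S" "g ` B \<subseteq> T" "S \<inter> T = {}"
  shows "inj_on g (A \<union> B)"
proof -
  have "g ` (A - B) \<inter> g ` (B - A) = {}" using assms(3-5) by blast
  then show ?thesis using assms(1,2) by (simp add: inj_on_Un)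
qed

text \<open>Class 0 can be placed anywhere in \<open>X\<close>, which is joined to the image of the
  other classes and, as \<open>G\<close> has no loops, avoids it. Only edges between classes 1 and 2
  constrain \<open>g\<close>.\<close>

lemma embeds_via_class0:
  fixes H :: "'a graph" and G :: "'b graph"
  assumes H: "simple_graph H" "proper_3_colouring H c" and G: "simple_graph G"
    and g: "inj_on g (colour_class H c 1 \<union> colour_class H c 2)" "g ` (colour_class H c 1 \<union> colour_class H c 2) \<subseteq> verts G"
    and edge: "\<And>u v. {u, v} \<in> edges H \<Longrightarrow> c u = 1 \<Longrightarrow> c v = 2 \<Longrightarrow> {g u, g v} \<in> edges G"
    and X: "X \<subseteq> verts G" "card (verts H) \<le> card X"
    and complete: "joined G X (g ` (colour_class H c 1 \<union> colour_class H c 2))"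
  shows "embeds H G"
proof -
  let ?R = "colour_class H c 1 \<union> colour_class H c 2"
  have fin: "finite (verts H)" "finite X"
    using H(1) G X(1) finite_subset by (auto simp: simple_graph_def)
  have "card (colour_class H c 0) \<le> card (verts H)"
    using fin by (intro card_mono) (auto simp: colour_class_def)
  then obtain k where k: "inj_on k (colour_class H c 0)" "k ` colour_class H c 0 \<subseteq> X"
    using inj_into[of "colour_class H c 0" X] fin X(2) by (auto simp: colour_class_def)
  have disj: "X \<inter> g ` ?R = {}"
    using complete simple_graphD(1)[OF G] by (fastforce simp: joined_def)
  define f where "f v = (if c v = 0 then k v else g v)" for v
  have V: "verts H = colour_class H c 0 \<union> ?R"
    using proper_3_colouringD(1)[OF H(2)] unfolding colour_class_def by blast
  have f0: "f v = k v" if "v \<in> colour_class H c 0" for v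
    using that by (simp add: f_def colour_class_def)
  have f1: "f v = g v" if "v \<in> ?R" for v
    using that by (auto simp: f_def colour_class_def)
  have inj: "inj_on f (verts H)"
    unfolding V
  proof (rule inj_on_disjoint_UnI[OF _ _ _ _ disj])
    show "inj_on f (colour_class H c 0)" "inj_on f ?R"
      using k(1) g(1) f0 f1 inj_on_cong[of "colour_class H c 0" f k]
        inj_on_cong[of "?R" f g] by blast+
    show "f ` colour_class H c 0 \<subseteq> X"
      "f ` ?R \<subseteq> g ` ?R"
      using f0 f1 k(2) by (auto simp del: One_nat_def)
  qed
  have sub: "f ` verts H \<subseteq> verts G"
  proof
    fix y assume "y \<in> f ` verts H"
    then obtain v where "v \<in> verts H" "y = f v" by auto
    then show "y \<in> verts G" using V f0 f1 k(2) X(1) g(2) by blast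
  qed
  have "f ` e \<in> edges G" if "e \<in> edges H" for e
  proof -
    obtain u v where e: "e = {u, v}"
      using H(1) \<open>e \<in> edges H\<close> by (auto simp: simple_graph_def card_2_iff)
    have mem: "u \<in> verts H" "v \<in> verts H" and ne: "c u \<noteq> c v"
      using simple_graphD[OF H(1)] proper_3_colouringD(2)[OF H(2)] that e by blast+
    have *: "{f u, f v} \<in> edges G"
      if uv: "{u, v} \<in> edges H" "u \<in> verts H" "v \<in> verts H" "c u < c v" for u v
    proof -
      consider "c u = 0" "c v = 1 \<or> c v = 2" | "c u = 1" "c v = 2"
        using proper_3_colouringD(1)[OF H(2)] uv by force
      then show ?thesis
      proof cases
        case 1
        then have "u \<in> colour_class H c 0" "v \<in> ?R"
          using uv by (auto simp: colour_class_def)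
        then show ?thesis using f0 f1 k(2) complete unfolding joined_def by (metis imageI subsetD)
      next
        case 2
        then show ?thesis using edge uv by (simp add: f_def)
      qed
    qed
    consider "c u < c v" | "c v < c u" using ne by linarith
    then show ?thesis
    proof cases
      case 1 then show ?thesis using *[of u v] mem that e by simp
    next
      case 2 then show ?thesis using *[of v u] mem that e by (simp add: insert_commute)
    qed
  qed
  with inj sub show ?thesis by (auto simp: embeds_def)
qed

lemma joined_subset:
  assumes "simple_graph G" "joined G S T"
  shows "S \<noteq> {} \<Longrightarrow> T \<subseteq> verts G" "T \<noteq> {} \<Longrightarrow> S \<subseteq> verts G"
proof -
  have *: "s \<in> verts G \<and> t \<in> verts G" if "s \<in> S" "t \<in> T" for s t
    using assms that simple_graphD[of G s t] by (auto simp: joined_def)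
  then show "S \<noteq> {} \<Longrightarrow> T \<subseteq> verts G" "T \<noteq> {} \<Longrightarrow> S \<subseteq> verts G" by blast+
qed

text \<open>The part of class 1 adjacent to \<open>x\<close> can be placed independently of the part
  adjacent to the rest of class 2. This is the shape excluded by \<open>split_free\<close>.\<close>

definition split_at :: "'a graph \<Rightarrow> ('a \<Rightarrow> nat) \<Rightarrow> 'a \<Rightarrow> bool" where
  "split_at H c x \<longleftrightarrow> proper_3_colouring H c \<and> x \<in> colour_class H c 2 \<and>
     (\<forall>v\<in>colour_class H c 1. \<forall>z\<in>colour_class H c 2.
        {v, x} \<in> edges H \<and> {v, z} \<in> edges H \<longrightarrow> z = x)"

definition matching_like :: "'a graph \<Rightarrow> ('a \<Rightarrow> nat) \<Rightarrow> bool" where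
  "matching_like H c \<longleftrightarrow> proper_3_colouring H c \<and>
      (\<forall>v\<in>colour_class H c 1. \<forall>z\<in>colour_class H c 2. \<forall>z'\<in>colour_class H c 2.
        {v, z} \<in> edges H \<and> {v, z'} \<in> edges H \<longrightarrow> z = z') \<and>
      (\<forall>z\<in>colour_class H c 2. \<forall>v\<in>colour_class H c 1. \<forall>v'\<in>colour_class H c 1.
        {v, z} \<in> edges H \<and> {v', z} \<in> edges H \<longrightarrow> v = v')"

text \<open>The interface between odd-balloonings and the extremal argument:
  \<open>min_class\<close> serves the lower bound on edges, the two colourings serve the
  embeddings.\<close>

locale forbidden =
  fixes H :: "'a graph" and q :: nat
  assumes simple_H: "simple_graph H" and q_pos: "1 \<le> q"
    and min_class: "\<And>c. proper_3_colouring H c \<Longrightarrow> q \<le> card (colour_class H c 2)"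
    and split_colouring: "\<exists>c x. split_at H c x \<and> card (colour_class H c 2) = q"
    and matching_colouring: "\<exists>c. matching_like H c"
begin

abbreviation "cls \<equiv> colour_class H"
abbreviation "h \<equiv> card (verts H)"

lemma finH: "finite (verts H)"
  using simple_H by (simp add: simple_graph_def)

lemma fin_class: "finite (cls c i)"
  using finH by (simp add: colour_class_def)

lemma card_class_le: "card (cls c i) \<le> h"
  using finH by (intro card_mono) (auto simp: colour_class_def)

lemma q_le: "q \<le> h"
  using split_colouring card_class_le by metis

text \<open>\<open>x\<close> goes to \<open>w\<close>, the rest of class 2 to \<open>Q\<close>, the
  class 1 neighbours of \<open>x\<close> to \<open>Z\<close> and the other vertices of class 1 to
  \<open>Y\<close>. Admitting \<open>Y = Z\<close> makes the complete tripartite graph an instance;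
  both halves of class 1 then share one injection.\<close>

lemma split_embeds:
  fixes G :: "'b graph"
  assumes G: "simple_graph G" and Q: "finite Q" "card Q + 1 = q" "w \<notin> Q"
    and large: "h \<le> card X" "h \<le> card Y" "h \<le> card Z"
    and disj: "Y \<inter> Z = {} \<or> Y = Z" "insert w Q \<inter> (Y \<union> Z) = {}"
    and complete: "joined G X (insert w Q \<union> Y \<union> Z)" "joined G Q Y" "joined G {w} Z"
  shows "embeds H G"
proof -
  have h0: "0 < h" using q_pos q_le by simp
  then have fin: "finite X" "finite Y" "finite Z"
    using large by (auto intro: card_ge_0_finite)
  have ne: "X \<noteq> {}" "Y \<noteq> {}" "Z \<noteq> {}" using h0 large by auto
  have sub: "X \<subseteq> verts G" "insert w Q \<union> Y \<union> Z \<subseteq> verts G"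
    using joined_subset[OF G complete(1)] ne by simp_all
  from split_colouring obtain c x where cx: "split_at H c x" "card (cls c 2) = q"
    by (elim exE conjE) (rule that)
  then have c: "proper_3_colouring H c" "card (cls c 2) = q" "x \<in> cls c 2"
    "\<And>v z. v \<in> cls c 1 \<Longrightarrow> z \<in> cls c 2 \<Longrightarrow> {v, x} \<in> edges H \<Longrightarrow> {v, z} \<in> edges H \<Longrightarrow> z = x"
    by (simp_all add: split_at_def)
  have "card (cls c 2 - {x}) \<le> card Q"
    using c(2,3) fin_class Q(2) by (simp add: card_Diff_subset)
  then obtain g1 where g1: "inj_on g1 (cls c 2 - {x})" "g1 ` (cls c 2 - {x}) \<subseteq> Q"
    using inj_into[of "cls c 2 - {x}" Q] fin_class Q(1) by blast
  obtain g2 where g2: "inj_on g2 (cls c 1)" "g2 ` cls c 1 \<subseteq> Y"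
    using inj_into[OF fin_class fin(2) order_trans[OF card_class_le large(2)]] by blast
  obtain g3 where g3: "inj_on g3 (cls c 1)" "g3 ` cls c 1 \<subseteq> Z" "Y = Z \<longrightarrow> g3 = g2"
    using inj_into[OF fin_class fin(3) order_trans[OF card_class_le large(3)]] g2
    by (cases "Y = Z") blast+
  define g where "g v = (if v = x then w else if c v = 2 then g1 v else
    if {v, x} \<in> edges H then g3 v else g2 v)" for v
  have gx: "g x = w" by (simp add: g_def)
  have gQ: "g v = g1 v \<and> g v \<in> Q" if "v \<in> cls c 2 - {x}" for v
    using that g1(2) by (auto simp: g_def colour_class_def)
  have gJ: "g v = g3 v \<and> g v \<in> Z" if "v \<in> cls c 1" "{v, x} \<in> edges H" for v
    using that g3(2) c(3) by (auto simp: g_def colour_class_def)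
  have gJ': "g v = g2 v \<and> g v \<in> Y" if "v \<in> cls c 1" "{v, x} \<notin> edges H" for v
    using that g2(2) c(3) by (auto simp: g_def colour_class_def)
  show ?thesis
  proof (rule embeds_via_class0[OF simple_H c(1) G])
    show im: "g ` (cls c 1 \<union> cls c 2) \<subseteq> verts G"
      using gx gQ gJ gJ' sub by blast
    show "inj_on g (cls c 1 \<union> cls c 2)"
    proof -
      define J where "J = {v\<in>cls c 1. {v, x} \<in> edges H}"
      define J' where "J' = {v\<in>cls c 1. {v, x} \<notin> edges H}"
      have "J \<subseteq> cls c 1" "J' \<subseteq> cls c 1" by (auto simp: J_def J'_def)
      then have "inj_on g3 J" "inj_on g2 J'"
        using inj_on_subset[OF g3(1)] inj_on_subset[OF g2(1)] by blast+
      then have "inj_on g J" "inj_on g J'"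
        using gJ gJ' inj_on_cong[of J g g3] inj_on_cong[of J' g g2] by (auto simp: J_def J'_def)
      moreover have "g ` J \<subseteq> Z" "g ` J' \<subseteq> Y"
        unfolding image_subset_iff J_def J'_def using gJ gJ' by blast+
      ultimately have "inj_on g (J \<union> J')" if "Y \<inter> Z = {}"
        using that by (intro inj_on_disjoint_UnI[of g J J' Z Y]) auto
      moreover have "inj_on g (J \<union> J')" if "Y = Z"
        using that g2(1) g3(3) gJ gJ' inj_on_cong[of "cls c 1" g g2] \<open>J \<subseteq> _\<close> \<open>J' \<subseteq> _\<close>
        by (intro inj_on_subset[of g "cls c 1" "J \<union> J'"]) blast+
      ultimately have "inj_on g (J \<union> J')" using disj(1) by blast
      moreover have "inj_on g (cls c 2 - {x})" "g ` (cls c 2 - {x}) \<subseteq> Q"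
        using gQ g1(1) inj_on_cong[of "cls c 2 - {x}" g g1] by blast+
      then have "inj_on g ({x} \<union> (cls c 2 - {x}))"
        by (intro inj_on_disjoint_UnI[of _ _ _ "{w}"]) (use gx Q(3) in auto)
      moreover have "g ` (J \<union> J') \<subseteq> Y \<union> Z" "g ` ({x} \<union> (cls c 2 - {x})) \<subseteq> insert w Q"
        unfolding image_subset_iff J_def J'_def using gJ gJ' gx gQ by blast+
      moreover have "(Y \<union> Z) \<inter> insert w Q = {}" using disj(2) by blast
      ultimately have "inj_on g ((J \<union> J') \<union> ({x} \<union> (cls c 2 - {x})))"
        by (rule_tac inj_on_disjoint_UnI)
      moreover have "J \<union> J' = cls c 1" "{x} \<union> (cls c 2 - {x}) = cls c 2"
        using c(3) by (auto simp: J_def J'_def)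
      ultimately show ?thesis by simp
    qed
    show "{g u, g v} \<in> edges G" if "{u, v} \<in> edges H" "c u = 1" "c v = 2" for u v
    proof -
      have mem: "u \<in> cls c 1" "v \<in> cls c 2"
        using that simple_graphD[OF simple_H that(1)] by (auto simp: colour_class_def)
      show ?thesis
      proof (cases "v = x")
        case True
        then have "g u \<in> Z" using gJ[OF mem(1)] that by blast
        then show ?thesis using complete(3) gx True by (auto simp: joined_def insert_commute)
      next
        case False
        then have "{u, x} \<notin> edges H" using c(4)[OF mem] that by blast
        then have "g u \<in> Y" "g v \<in> Q" using gJ'[OF mem(1)] gQ[of v] mem False by auto
        then show ?thesis using complete(2) by (auto simp: joined_def insert_commute)
      qed
    qed
    show "joined G X (g ` (cls c 1 \<union> cls c 2))"
      by (rule joined_mono[OF complete(1)]) (use gx gQ gJ gJ' in blast)+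
  qed (use sub large in auto)
qed

lemma tripartite_embeds:
  fixes G :: "'b graph"
  assumes G: "simple_graph G" and Q: "card Q = q" and large: "h \<le> card X" "h \<le> card Y"
    and complete: "joined G Q X" "joined G Q Y" "joined G X Y"
  shows "embeds H G"
proof -
  have "finite Q" "Q \<noteq> {}" using Q q_pos by (auto intro: card_ge_0_finite)
  then obtain w where w: "w \<in> Q" by blast
  then have ins: "insert w (Q - {w}) = Q" by blast
  show ?thesis
  proof (rule split_embeds[OF G _ _ _ large(1,2,2)])
    show "card (Q - {w}) + 1 = q" using Q w \<open>finite Q\<close> q_pos by simp
    show "insert w (Q - {w}) \<inter> (Y \<union> Y) = {}"
      unfolding ins using complete(2) simple_graphD(1)[OF G] by (fastforce simp: joined_def)
    show "joined G X (insert w (Q - {w}) \<union> Y \<union> Y)"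
      unfolding ins using complete(3) iffD1[OF joined_sym complete(1)]
      by (auto simp: joined_def)
    show "joined G (Q - {w}) Y" "joined G {w} Y"
      by (rule joined_mono[OF complete(2)]; use w in blast)+
  qed (use \<open>finite Q\<close> in auto)
qed

text \<open>The matching is indexed by the vertices of \<open>H\<close> through \<open>k\<close>. A
  vertex of class 2 takes the \<open>u\<close>-end of its own index; a vertex of class 1 takes the
  \<open>w\<close>-end of the index of its partner in class 2, or of its own index if it has no
  partner. These indices differ because \<open>m\<close> is injective on class 1.\<close>

lemma matching_embeds:
  fixes G :: "'b graph"
  assumes G: "simple_graph G" and uw: "inj_on u {..<h}" "inj_on w {..<h}" "u ` {..<h} \<inter> w ` {..<h} = {}"
    "\<And>i. i < h \<Longrightarrow> {u i, w i} \<in> edges G"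
    and X: "h \<le> card X" "joined G X (u ` {..<h} \<union> w ` {..<h})"
  shows "embeds H G"
proof -
  have h0: "0 < h" using q_pos q_le by simp
  have U: "u i \<in> verts G" "w i \<in> verts G" if "i < h" for i
    using uw(4)[OF that] simple_graphD[OF G] by blast+
  have sub: "X \<subseteq> verts G"
    using joined_subset(2)[OF G X(2)] h0 by auto
  from matching_colouring obtain c where cc: "matching_like H c"
    by (elim exE) (rule that)
  then have c: "proper_3_colouring H c"
    "\<And>v z z'. v \<in> cls c 1 \<Longrightarrow> z \<in> cls c 2 \<Longrightarrow> z' \<in> cls c 2 \<Longrightarrow>
      {v, z} \<in> edges H \<Longrightarrow> {v, z'} \<in> edges H \<Longrightarrow> z = z'"
    "\<And>z v v'. z \<in> cls c 2 \<Longrightarrow> v \<in> cls c 1 \<Longrightarrow> v' \<in> cls c 1 \<Longrightarrow>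
      {v, z} \<in> edges H \<Longrightarrow> {v', z} \<in> edges H \<Longrightarrow> v = v'"
    unfolding matching_like_def by simp_all
  obtain k where k: "bij_betw k (verts H) {..<h}"
    using finH ex_bij_betw_finite_nat[of "verts H"] by (auto simp: atLeast0LessThan)
  have kinj: "inj_on k (verts H)" and klt: "k v < h" if "v \<in> verts H" for v
    using k that by (auto simp: bij_betw_def)
  define m where "m v = (if \<exists>z\<in>cls c 2. {v, z} \<in> edges H
    then SOME z. z \<in> cls c 2 \<and> {v, z} \<in> edges H else v)" for v
  have m1: "m v = z" if "v \<in> cls c 1" "z \<in> cls c 2" "{v, z} \<in> edges H" for v z
  proof -
    have "(SOME z. z \<in> cls c 2 \<and> {v, z} \<in> edges H) = z"
      by (rule some_equality) (use that c(2) in blast)+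
    then show ?thesis using that by (auto simp: m_def)
  qed
  have m2: "m v = v" if "\<And>z. z \<in> cls c 2 \<Longrightarrow> {v, z} \<notin> edges H" for v
    using that by (auto simp: m_def)
  have mV: "m v \<in> verts H" if "v \<in> cls c 1" for v
  proof (cases "\<exists>z\<in>cls c 2. {v, z} \<in> edges H")
    case True
    then show ?thesis using m1[OF that] by (auto simp: colour_class_def)
  next
    case False
    then show ?thesis using m2[of v] that by (auto simp: colour_class_def)
  qed
  have minj: "v = v'" if v: "v \<in> cls c 1" "v' \<in> cls c 1" "m v = m v'" for v v'
  proof -
    have disj: "cls c 1 \<inter> cls c 2 = {}" by (auto simp: colour_class_def)
    consider z where "z \<in> cls c 2" "{v, z} \<in> edges H"
      | "\<And>z. z \<in> cls c 2 \<Longrightarrow> {v, z} \<notin> edges H" by blast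
    then show ?thesis
    proof cases
      case 1
      then have z: "m v' = z" using m1[OF v(1)] v(3) by simp
      show ?thesis
      proof (cases "\<exists>z\<in>cls c 2. {v', z} \<in> edges H")
        case True
        then obtain z' where z': "z' \<in> cls c 2" "{v', z'} \<in> edges H" by blast
        then have "z' = z" using m1[OF v(2)] z by simp
        then show ?thesis using c(3)[OF 1(1) v(1,2) 1(2)] z' by simp
      next
        case False
        then have "m v' = v'" using m2 by blast
        then show ?thesis using z 1(1) v(2) disj by auto
      qed
    next
      case 2
      then have mv: "m v' = v" using m2[of v] v(3) by simp
      show ?thesis
      proof (cases "\<exists>z\<in>cls c 2. {v', z} \<in> edges H")
        case True
        then obtain z' where z': "z' \<in> cls c 2" "{v', z'} \<in> edges H" by blast
        then have "v = z'" using m1[OF v(2)] mv by simp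
        then show ?thesis using z' v disj by blast
      next
        case False
        then have "m v' = v'" using m2 by blast
        then show ?thesis using mv by simp
      qed
    qed
  qed
  define g where "g v = (if c v = 2 then u (k v) else w (k (m v)))" for v
  have gQ: "g v = u (k v)" "k v < h" if "v \<in> cls c 2" for v
    using that klt by (auto simp: g_def colour_class_def)
  have gJ: "g v = w (k (m v))" "k (m v) < h" if "v \<in> cls c 1" for v
    using that klt mV by (auto simp: g_def colour_class_def)
  have im: "g ` (cls c 1 \<union> cls c 2) \<subseteq> u ` {..<h} \<union> w ` {..<h}"
    using gQ gJ by fastforce
  show ?thesis
  proof (rule embeds_via_class0[OF simple_H c(1) G])
    show "g ` (cls c 1 \<union> cls c 2) \<subseteq> verts G"
      by (rule order_trans[OF im]) (use U in auto)
    show "inj_on g (cls c 1 \<union> cls c 2)"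
    proof (rule inj_onI)
      fix a b assume ab: "a \<in> cls c 1 \<union> cls c 2"
        "b \<in> cls c 1 \<union> cls c 2" "g a = g b"
      have V: "a \<in> verts H" "b \<in> verts H" using ab by (auto simp: colour_class_def)
      from ab(1,2) consider "a \<in> cls c 1" "b \<in> cls c 1"
        | "a \<in> cls c 2" "b \<in> cls c 2"
        | "a \<in> cls c 1" "b \<in> cls c 2"
        | "a \<in> cls c 2" "b \<in> cls c 1" by blast
      then show "a = b"
      proof cases
        case 1
        then have "k (m a) = k (m b)" using gJ ab(3) inj_onD[OF uw(2)] by simp
        then have "m a = m b" using inj_onD[OF kinj] mV 1 V by blast
        then show ?thesis using minj 1 by blast
      next
        case 2
        then have "k a = k b" using gQ ab(3) inj_onD[OF uw(1)] by simp
        then show ?thesis using inj_onD[OF kinj] V by blast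
      next
        case 3
        then have "w (k (m a)) = u (k b)" "k (m a) < h" "k b < h" using gJ gQ ab(3) by auto
        then show ?thesis using uw(3) by (metis IntI emptyE imageI lessThan_iff)
      next
        case 4
        then have "w (k (m b)) = u (k a)" "k (m b) < h" "k a < h" using gJ gQ ab(3) by auto
        then show ?thesis using uw(3) by (metis IntI emptyE imageI lessThan_iff)
      qed
    qed
    show "{g a, g b} \<in> edges G" if "{a, b} \<in> edges H" "c a = 1" "c b = 2" for a b
    proof -
      have mem: "a \<in> cls c 1" "b \<in> cls c 2"
        using that simple_graphD[OF simple_H that(1)] by (auto simp: colour_class_def)
      then have "m a = b" using m1 that by blast
      then show ?thesis using gJ(1)[OF mem(1)] gQ[OF mem(2)] uw(4) by (simp add: insert_commute)
    qed
    show "joined G X (g ` (cls c 1 \<union> cls c 2))"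
      by (rule joined_mono[OF X(2) _ im]) simp
  qed (use sub X in auto)
qed

end

section \<open>Extremal graphs satisfy the working assumptions\<close>

lemma extremalD:
  assumes "G \<in> extremal n H"
  shows "simple_graph G" "card (verts G) = n" "\<not> embeds H G"
    "\<And>G' :: nat graph. simple_graph G' \<Longrightarrow> card (verts G') = n \<Longrightarrow> \<not> embeds H G' \<Longrightarrow> card (edges G') \<le> card (edges G)"
proof -
  have *: "simple_graph G \<and> card (verts G) = n \<and> \<not> embeds H G \<and>
     (\<forall>G' :: nat graph. simple_graph G' \<and> card (verts G') = n \<and> \<not> embeds H G' \<longrightarrow>
        card (edges G') \<le> card (edges G))"
    using assms unfolding extremal_def by (rule CollectD)
  show "simple_graph G" by (rule *[THEN conjunct1])
  show "card (verts G) = n" by (rule *[THEN conjunct2, THEN conjunct1])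
  show "\<not> embeds H G" by (rule *[THEN conjunct2, THEN conjunct2, THEN conjunct1])
  show "card (edges G') \<le> card (edges G)"
    if "simple_graph G'" "card (verts G') = n" "\<not> embeds H G'" for G' :: "nat graph"
    using *[THEN conjunct2, THEN conjunct2, THEN conjunct2, rule_format, of G'] that by simp
qed

text \<open>Reattaching \<open>v\<close> to the common neighbourhood of \<open>X\<close> creates no copy of \<open>H\<close>: in such a copy,
  some vertex of \<open>X\<close> is free to play the role of \<open>v\<close>.\<close>

lemma extremal_degree_common:
  assumes G: "G \<in> extremal n H" and H: "simple_graph H"
    and v: "v \<in> verts G" and X: "X \<subseteq> verts G - {v}" "card (verts H) \<le> card X"
  shows "card {y \<in> verts G - {v}. \<forall>x\<in>X. {x, y} \<in> edges G} \<le> degree G v"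
proof -
  note ex = extremalD[OF G]
  define Y where "Y = {y \<in> verts G - {v}. \<forall>x\<in>X. {x, y} \<in> edges G}"
  define E1 where "E1 = {e\<in>edges G. v \<notin> e}"
  define E3 where "E3 = (\<lambda>y. {v, y}) ` Y"
  define G' where "G' = (verts G, E1 \<union> E3)"
  have fin: "finite (verts G)" "finite (verts H)" "finite (edges G)"
    using ex(1) H finite_edges[OF ex(1)] by (auto simp: simple_graph_def)
  have finX: "finite X" "finite Y" using X fin finite_subset by (auto simp: Y_def)
  have inj: "inj_on (\<lambda>y. {v, y}) S" for S by (auto simp: inj_on_def doubleton_eq_iff)
  have sG': "simple_graph G'"
    using ex(1) v by (auto simp: simple_graph_def G'_def E1_def E3_def Y_def)
  have old: "e \<in> edges G" if "e \<in> edges G'" "v \<notin> e" for e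
    using that by (auto simp: G'_def E1_def E3_def)
  have new: "y \<in> Y" if "{v, y} \<in> edges G'" for y
    using that by (auto simp: G'_def E1_def E3_def doubleton_eq_iff)
  have free: "\<not> embeds H G'"
  proof
    assume "embeds H G'"
    then obtain f where f: "inj_on f (verts H)" "f ` verts H \<subseteq> verts G" "\<And>e. e \<in> edges H \<Longrightarrow> f ` e \<in> edges G'"
      by (auto simp: embeds_def G'_def)
    have eH: "e \<subseteq> verts H" if "e \<in> edges H" for e using H that by (auto simp: simple_graph_def)
    show False
    proof (cases "v \<in> f ` verts H")
      case False
      have "f ` e \<in> edges G" if "e \<in> edges H" for e
        using old[OF f(3)[OF that]] eH[OF that] False by blast
      then have "embeds H G" using f unfolding embeds_def by blast
      then show False using ex(3) by simp
    next
      case True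
      then obtain p where p: "p \<in> verts H" "f p = v" by blast
      have "card (f ` verts H - {v}) < card (verts H)"
        using fin p card_image[OF f(1)] card_Diff1_less[of "f ` verts H" v] by auto
      then have "\<not> X \<subseteq> f ` verts H - {v}"
        using X(2) card_mono[of "f ` verts H - {v}" X] fin by auto
      then obtain x where x: "x \<in> X" "x \<notin> f ` verts H" using X(1) by blast
      define f' where "f' = f(p := x)"
      have "inj_on f' (verts H)" unfolding f'_def by (rule inj_on_fun_updI[OF f(1) x(2)])
      moreover have "f' ` verts H \<subseteq> verts G" using f(2) x(1) X(1) by (auto simp: f'_def)
      moreover have "f' ` e \<in> edges G" if e: "e \<in> edges H" for e
      proof (cases "p \<in> e")
        case False
        then have "f' ` e = f ` e" by (auto simp: f'_def)
        moreover have "v \<notin> f ` e" using False p f(1) eH[OF e] by (auto simp: inj_on_def)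
        ultimately show ?thesis using old[OF f(3)[OF e]] by simp
      next
        case True
        have "card e = 2" using H e by (simp add: simple_graph_def)
        with True obtain r where r: "e = {p, r}" "r \<noteq> p" by (auto simp: card_2_iff)
        then have "f r \<in> Y" using new[of "f r"] f(3)[OF e] p by simp
        then show ?thesis using r x(1) by (auto simp: f'_def Y_def insert_commute)
      qed
      ultimately have "embeds H G" unfolding embeds_def by blast
      then show False using ex(3) by simp
    qed
  qed
  have "card (edges G') \<le> card (edges G)"
    by (rule ex(4)[OF sG' _ free]) (use ex(2) in \<open>simp add: G'_def\<close>)
  moreover have "card (edges G') = card E1 + card Y"
  proof -
    have "card (edges G') = card E1 + card E3"
      unfolding G'_def using fin finX by (simp, subst card_Un_disjoint) (auto simp: E1_def E3_def)
    then show ?thesis using inj by (simp add: E3_def card_image)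
  qed
  moreover have "card (edges G) = card E1 + degree G v"
  proof -
    have E2: "{e\<in>edges G. v \<in> e} = (\<lambda>y. {v, y}) ` nbhd G v"
    proof
      show "{e\<in>edges G. v \<in> e} \<subseteq> (\<lambda>y. {v, y}) ` nbhd G v"
      proof
        fix e assume e: "e \<in> {e\<in>edges G. v \<in> e}"
        then have "card e = 2" using ex(1) by (simp add: simple_graph_def)
        with e obtain r where "e = {v, r}" by (auto simp: card_2_iff)
        with e show "e \<in> (\<lambda>y. {v, y}) ` nbhd G v" by (auto simp: nbhd_def)
      qed
    qed (auto simp: nbhd_def)
    have "edges G = E1 \<union> {e\<in>edges G. v \<in> e}" "E1 \<inter> {e\<in>edges G. v \<in> e} = {}"
      by (auto simp: E1_def)
    then have "card (edges G) = card E1 + card {e\<in>edges G. v \<in> e}"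
      using fin by (metis (no_types, lifting) card_Un_disjoint finite_Un)
    then show ?thesis unfolding E2 using inj by (simp add: card_image degree_def)
  qed
  ultimately show ?thesis by (simp add: Y_def)
qed

definition multipartite :: "nat \<Rightarrow> (nat \<Rightarrow> nat) \<Rightarrow> nat graph" where
  "multipartite n c = ({..<n}, {{i, j} | i j. i < n \<and> j < n \<and> c i \<noteq> c j})"

lemma multipartite_edge: "{i, j} \<in> edges (multipartite n c) \<longleftrightarrow> i < n \<and> j < n \<and> c i \<noteq> c j"
  by (auto simp: multipartite_def doubleton_eq_iff)

lemma simple_multipartite: "simple_graph (multipartite n c)"
  by (auto simp: simple_graph_def multipartite_def card_2_iff)

lemma many_edges_multipartite:
  assumes s: "s \<le> n"
  defines "N \<equiv> n - s"
  defines "c \<equiv> \<lambda>i. if i < s then 2 else if i < s + N div 2 then 0 else (1 :: nat)"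
  shows "2 * card (edges (multipartite n c)) = 2 * s * N + 2 * (N div 2) * (N - N div 2)"
proof -
  let ?T = "multipartite n c"
  define a where "a = N div 2"
  have n: "n = s + N" and aN: "a \<le> N" using s by (auto simp: N_def a_def)
  have nb: "nbhd ?T i = {j. j < n \<and> c i \<noteq> c j}" if "i < n" for i
    using that by (simp add: nbhd_def multipartite_edge)
  have V: "verts ?T = {..<s} \<union> {s..<s+a} \<union> {s+a..<n}"
    using n aN by (auto simp: multipartite_def)
  have d2: "card (nbhd ?T i) = N" if "i \<in> {..<s}" for i
  proof -
    have "nbhd ?T i = {s..<n}" using that n by (subst nb) (auto simp: c_def)
    then show ?thesis using n by simp
  qed
  have d0: "card (nbhd ?T i) = s + (N - a)" if "i \<in> {s..<s+a}" for i
  proof -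
    have "nbhd ?T i = {..<s} \<union> {s+a..<n}" using that n aN by (subst nb) (auto simp: c_def a_def)
    moreover have "card ({..<s} \<union> {s+a..<n}) = s + (n - (s + a))"
      by (subst card_Un_disjoint) auto
    ultimately show ?thesis using n by simp
  qed
  have d1: "card (nbhd ?T i) = s + a" if "i \<in> {s+a..<n}" for i
  proof -
    have "nbhd ?T i = {..<s + a}" using that n aN by (subst nb) (auto simp: c_def a_def)
    then show ?thesis by simp
  qed
  have "2 * card (edges ?T) = (\<Sum>i\<in>verts ?T. card (nbhd ?T i))"
    using handshake[OF simple_multipartite, of n c] nbhd_subset[OF simple_multipartite, of n c]
    by (simp add: card_pairs Int_absorb2 multipartite_def)
  also have "\<dots> = (\<Sum>i\<in>{..<s}. card (nbhd ?T i)) + (\<Sum>i\<in>{s..<s+a}. card (nbhd ?T i)) + (\<Sum>i\<in>{s+a..<n}. card (nbhd ?T i))"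
    unfolding V by (subst sum.union_disjoint; auto simp: sum.union_disjoint)+
  also have "\<dots> = s * N + a * (s + (N - a)) + (N - a) * (s + a)"
    using n aN d0 d1 d2 by simp
  also have "\<dots> = 2 * s * N + 2 * a * (N - a)"
  proof -
    obtain b where "N = a + b" using aN le_Suc_ex by blast
    then show ?thesis by (simp add: algebra_simps)
  qed
  finally show ?thesis by (simp add: a_def)
qed

context forbidden
begin

text \<open>An embedding into the tripartite graph would pull its parts back to a 3-colouring of
  \<open>H\<close> with at most \<open>q - 1\<close> vertices in class 2, against
  \<open>min_class\<close>. The term \<open>2 * q\<^sup>2\<close> absorbs the lower-order terms and
  the rounding of \<open>N div 2\<close>.\<close>

lemma extremal_many_edges:
  assumes G: "G \<in> extremal n H" and n: "q \<le> n"
  shows "real n ^ 2 / 2 + (real q - 1) * n - 2 * real q ^ 2 \<le> 2 * card (edges G)"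
proof -
  define s where "s = q - 1"
  define N where "N = n - s"
  define c where "c = (\<lambda>i. if i < s then 2 else if i < s + N div 2 then 0 else (1 :: nat))"
  have free: "\<not> embeds H (multipartite n c)"
  proof
    assume "embeds H (multipartite n c)"
    then obtain f where f: "inj_on f (verts H)" "f ` verts H \<subseteq> {..<n}"
      "\<And>e. e \<in> edges H \<Longrightarrow> f ` e \<in> edges (multipartite n c)"
      by (auto simp: embeds_def multipartite_def)
    have "proper_3_colouring H (c \<circ> f)"
      unfolding proper_3_colouring_def
    proof (intro conjI allI impI)
      show "(c \<circ> f) ` verts H \<subseteq> {..<3}" by (auto simp: c_def)
      fix u v assume "{u, v} \<in> edges H"
      from f(3)[OF this] show "(c \<circ> f) u \<noteq> (c \<circ> f) v" by (simp add: multipartite_edge)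
    qed
    then have "q \<le> card (cls (c \<circ> f) 2)" by (rule min_class)
    also have "\<dots> = card (f ` cls (c \<circ> f) 2)"
      using inj_on_subset[OF f(1)] by (subst card_image) (auto simp: colour_class_def)
    also have "\<dots> \<le> card {..<s}"
      by (rule card_mono) (auto simp: colour_class_def c_def split: if_splits)
    finally show False using q_pos by (simp add: s_def)
  qed
  have "card (edges (multipartite n c)) \<le> card (edges G)"
    by (rule extremalD(4)[OF G simple_multipartite _ free]) (simp add: multipartite_def)
  moreover have "2 * card (edges (multipartite n c)) = 2 * s * N + 2 * (N div 2) * (N - N div 2)"
    unfolding c_def N_def by (rule many_edges_multipartite) (use n in \<open>simp add: s_def\<close>)
  ultimately have "2 * s * N + 2 * (N div 2) * (N - N div 2) \<le> 2 * card (edges G)" by simp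
  moreover have "N * N \<le> 4 * (N div 2) * (N - N div 2) + 1"
  proof -
    have "N = 2 * (N div 2) \<or> N = 2 * (N div 2) + 1" by linarith
    moreover have "N * N \<le> 4 * k * (N - k) + 1" if "N = 2 * k \<or> N = 2 * k + 1" for k
      using that by (auto simp: algebra_simps)
    ultimately show ?thesis by blast
  qed
  ultimately have "4 * s * N + N * N \<le> 4 * card (edges G) + 1" by linarith
  then have "real (4 * s * N + N * N) \<le> real (4 * card (edges G) + 1)" by (simp only: of_nat_le_iff)
  moreover have "real N = real n - real s" "real s = real q - 1"
    using n q_pos by (auto simp: N_def s_def)
  ultimately have "4 * (real q - 1) * (real n - (real q - 1)) + (real n - (real q - 1)) * (real n - (real q - 1))
    \<le> 4 * card (edges G) + 1" by simp
  moreover have "1 \<le> real q * real q" "1 \<le> real q"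
    using q_pos mult_mono[of 1 "real q" 1 "real q"] by auto
  ultimately show ?thesis by (simp add: power2_eq_square algebra_simps)
qed

lemma extremal_like:
  assumes G: "G \<in> extremal n H" and n: "q \<le> n"
  shows "extremal_like G n q h"
proof
  note ex = extremalD[OF G]
  show "simple_graph G" "card (verts G) = n" by (fact ex)+
  show "1 \<le> q" "q \<le> h" by (fact q_pos q_le)+
  show False if "card Q = q" "h \<le> card X" "h \<le> card Y"
    "joined G Q X" "joined G Q Y" "joined G X Y" for Q X Y
    using tripartite_embeds[OF ex(1) that] ex(3) by simp
  show False if "finite Q" "card Q + 1 = q" "w \<notin> Q" "h \<le> card X" "h \<le> card Y" "h \<le> card Z"
    "Y \<inter> Z = {}" "insert w Q \<inter> (Y \<union> Z) = {}" "joined G X (insert w Q \<union> Y \<union> Z)"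
    "joined G Q Y" "joined G {w} Z" for Q w X Y Z
    using split_embeds[OF ex(1) that(1-6) disjI1[OF that(7)] that(8-)] ex(3) by simp
  show False if "inj_on u {..<h}" "inj_on w {..<h}" "u ` {..<h} \<inter> w ` {..<h} = {}"
    "\<And>i. i < h \<Longrightarrow> {u i, w i} \<in> edges G" "h \<le> card X"
    "joined G X (u ` {..<h} \<union> w ` {..<h})" for u w X
    using matching_embeds[OF ex(1) that] ex(3) by simp
  show "real n ^ 2 / 2 + (real q - 1) * n - 2 * real q ^ 2 \<le> 2 * card (edges G)"
    using extremal_many_edges[OF G n] by simp
  show "card {y \<in> verts G - {v}. \<forall>x\<in>X. {x, y} \<in> edges G} \<le> degree G v"
    if "v \<in> verts G" "X \<subseteq> verts G - {v}" "h \<le> card X" for v X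
    by (rule extremal_degree_common[OF G simple_H that])
qed

end

section \<open>The decomposition family\<close>

text \<open>Fewer than three colours would give a proper 3-colouring with class 2 empty. The value 3
  means \<open>r = 2\<close> in \<open>decomposes\<close>.\<close>

lemma chromatic_number_eq_3:
  assumes c: "proper_3_colouring H c" and ne: "\<And>c. proper_3_colouring H c \<Longrightarrow> colour_class H c 2 \<noteq> {}"
  shows "chromatic_number H = 3"
  unfolding chromatic_number_def
proof (rule Least_equality)
  show "\<exists>c. c ` verts H \<subseteq> {..<3} \<and> (\<forall>u v. {u, v} \<in> edges H \<longrightarrow> c u \<noteq> (c v :: nat))"
    using c by (auto simp: proper_3_colouring_def)
next
  fix k assume "\<exists>c. c ` verts H \<subseteq> {..<k} \<and> (\<forall>u v. {u, v} \<in> edges H \<longrightarrow> c u \<noteq> (c v :: nat))"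
  then obtain c :: "'a \<Rightarrow> nat" where c: "c ` verts H \<subseteq> {..<k}" "\<forall>u v. {u, v} \<in> edges H \<longrightarrow> c u \<noteq> c v"
    by blast
  show "3 \<le> k"
  proof (rule ccontr)
    assume k: "\<not> 3 \<le> k"
    have lt: "c v < 2" if "v \<in> verts H" for v
    proof -
      have "c v < k" using c(1) that by auto
      then show ?thesis using k by linarith
    qed
    then have "proper_3_colouring H c"
      using c(2) by (fastforce simp: proper_3_colouring_def)
    from ne[OF this] show False using lt by (fastforce simp: colour_class_def)
  qed
qed

lemma turan_graph_1: "edges (turan_graph n 1) = {}" "verts (turan_graph n 1) = {..<n}"
  by (auto simp: turan_graph_def)

text \<open>The graph tested in \<open>decomposes\<close> for \<open>r = 2\<close>: a Turan graph
  with one part is edgeless, so the join adds \<open>t\<close> independent vertices adjacent to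
  everything else.\<close>

definition host :: "'a graph \<Rightarrow> nat \<Rightarrow> (('a + nat) + nat) graph" where
  "host M t = join (disjoint_union M (edgeless_graph t)) (turan_graph t 1)"

lemma host_verts:
  "Inl (Inl v) \<in> verts (host M t) \<longleftrightarrow> v \<in> verts M"
  "Inl (Inr i) \<in> verts (host M t) \<longleftrightarrow> i < t"
  "Inr i \<in> verts (host M t) \<longleftrightarrow> i < t"
  by (auto simp: host_def join_def disjoint_union_def edgeless_graph_def turan_graph_def)

lemma host_edges:
  "edges (host M t) = (\<lambda>e. Inl ` Inl ` e) ` edges M \<union>
    {{Inl u, Inr v} | u v. Inl u \<in> verts (host M t) \<and> Inr v \<in> verts (host M t)}"
proof -
  have "Inl u \<in> verts (host M t) \<longleftrightarrow> u \<in> verts (disjoint_union M (edgeless_graph t))"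
    "Inr v \<in> verts (host M t) \<longleftrightarrow> v \<in> verts (turan_graph t 1)" for u v
    by (auto simp: host_def join_def disjoint_union_def)
  then have "edges (host M t) = edges (disjoint_union (disjoint_union M (edgeless_graph t)) (turan_graph t 1)) \<union>
    {{Inl u, Inr v} | u v. Inl u \<in> verts (host M t) \<and> Inr v \<in> verts (host M t)}"
    by (simp add: host_def join_def)
  then show ?thesis
    by (simp add: disjoint_union_def turan_graph_1[unfolded One_nat_def] edgeless_graph_def image_image)
qed

lemma decomposes_iff:
  assumes "chromatic_number H = 3"
  shows "decomposes {H} M \<longleftrightarrow> simple_graph M \<and> no_isolated_vertices M \<and> embeds H (host M (card (verts H)))"
  by (simp add: decomposes_def Let_def assms host_def)

lemma nat_Inf_le: "x \<in> X \<Longrightarrow> Inf X \<le> (x :: nat)"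
  by (rule cInf_lower) auto

text \<open>Here the classes 0, 1 and 2 are embedded into the edgeless part of the host, into \<open>M\<close> minus a
  cover, and into the cover. The isolated vertices of \<open>H\<close> minus class 0 are dropped from \<open>M\<close>.\<close>

lemma q_family_le:
  fixes H :: "nat graph"
  assumes H: "simple_graph H" and chi: "chromatic_number H = 3" and c: "proper_3_colouring H c"
  shows "\<exists>M\<in>decomposition_family {H}. bipartite M \<and> q_graph M \<le> card (colour_class H c 2)"
proof -
  define t where "t = card (verts H)"
  have finH: "finite (verts H)" using H by (simp add: simple_graph_def)
  obtain k where "bij_betw k (verts H) {0..<t}"
    using ex_bij_betw_finite_nat[OF finH] t_def by blast
  then have k: "inj_on k (verts H)" "\<And>v. v \<in> verts H \<Longrightarrow> k v < t"
    by (auto simp: bij_betw_def)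
  define E where "E = {e\<in>edges H. \<forall>v\<in>e. c v \<noteq> 0}"
  define M0 where "M0 = (\<Union>E, E)"
  have eH: "e \<subseteq> verts H" "card e = 2" if "e \<in> edges H" for e
    using H that by (auto simp: simple_graph_def)
  have sub: "\<Union>E \<subseteq> verts H" using eH by (auto simp: E_def)
  have M0: "simple_graph M0" "no_isolated_vertices M0"
  proof -
    show "simple_graph M0"
      using eH finite_subset[OF sub finH] by (auto simp: simple_graph_def M0_def E_def)
    show "no_isolated_vertices M0"
      unfolding no_isolated_vertices_def
    proof
      fix v assume "v \<in> verts M0"
      then obtain e where e: "e \<in> E" "v \<in> e" by (auto simp: M0_def)
      then have "card e = 2" using eH by (simp add: E_def)
      with e(2) obtain u where "e = {v, u}" by (auto simp: card_2_iff)
      then show "nbhd M0 v \<noteq> {}" using e by (auto simp: M0_def nbhd_def)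
    qed
  qed
  define f :: "nat \<Rightarrow> (nat + nat) + nat" where
    "f v = (if c v = 0 then Inr (k v) else if v \<in> \<Union>E then Inl (Inl v) else Inl (Inr (k v)))" for v
  have "embeds H (host M0 t)"
    unfolding embeds_def
  proof (intro exI[of _ f] conjI ballI)
    show "inj_on f (verts H)"
      using k(1) by (auto simp: f_def inj_on_def split: if_splits)
    show img: "f ` verts H \<subseteq> verts (host M0 t)"
      using k(2) by (auto simp: f_def host_verts M0_def)
    fix e assume e: "e \<in> edges H"
    show "f ` e \<in> edges (host M0 t)"
    proof (cases "e \<in> E")
      case True
      have "f v = Inl (Inl v)" if "v \<in> e" for v using that True by (auto simp: f_def E_def)
      then have "f ` e = Inl ` Inl ` e" unfolding image_image by (rule image_cong[OF refl])
      then show ?thesis using True by (auto simp: host_edges M0_def)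
    next
      case False
      then obtain u where u: "u \<in> e" "c u = 0" using e by (auto simp: E_def)
      with eH(2)[OF e] obtain v where v: "e = {v, u}" by (auto simp: card_2_iff insert_commute)
      then have "c v \<noteq> 0" using proper_3_colouringD(2)[OF c, of v u] e u by auto
      then obtain w where "f v = Inl w"
        by (cases "v \<in> \<Union>E") (simp_all add: f_def del: Union_iff)
      moreover have "f u = Inr (k u)" using u by (simp add: f_def)
      moreover have "f v \<in> verts (host M0 t)" "f u \<in> verts (host M0 t)"
        using img eH(1)[OF e] v by blast+
      ultimately show ?thesis using v by (auto simp: host_edges)
    qed
  qed
  then have dec: "decomposes {H} M0"
    using M0 by (simp add: decomposes_iff[OF chi] t_def)
  \<comment> \<open>A subgraph with the least number of vertices and edges together is minimal with
    respect to \<open>subgraph\<close>, hence a member of the family.\<close>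
  define P where "P M \<longleftrightarrow> decomposes {H} M \<and> subgraph M M0" for M
  have "P M0" using dec by (simp add: P_def subgraph_def)
  from ex_has_least_nat[of P, OF this, of "\<lambda>M. card (verts M) + card (edges M)"]
  obtain M where M: "P M" "\<And>M'. P M' \<Longrightarrow> card (verts M) + card (edges M) \<le> card (verts M') + card (edges M')"
    by blast
  have sM: "simple_graph M" using M(1) by (simp add: P_def decomposes_iff[OF chi])
  have finM: "finite (verts M)" "finite (edges M)"
    using sM finite_edges[OF sM] by (auto simp: simple_graph_def)
  have "M' = M" if M': "subgraph M' M" "decomposes {H} M'" for M'
  proof -
    have s: "verts M' \<subseteq> verts M" "edges M' \<subseteq> edges M" using M'(1) by (auto simp: subgraph_def)
    have "P M'" using M' M(1) by (auto simp: P_def subgraph_def)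
    from M(2)[OF this] have "card (verts M') = card (verts M)" "card (edges M') = card (edges M)"
      using card_mono[OF finM(1) s(1)] card_mono[OF finM(2) s(2)] by linarith+
    then have "verts M' = verts M" "edges M' = edges M"
      using card_subset_eq[OF finM(1) s(1)] card_subset_eq[OF finM(2) s(2)] by auto
    then show ?thesis by (simp add: prod_eq_iff)
  qed
  then have fam: "M \<in> decomposition_family {H}"
    using M(1) by (auto simp: decomposition_family_def P_def)
  have EM: "edges M \<subseteq> E" "verts M \<subseteq> verts H"
    using M(1) sub by (auto simp: P_def subgraph_def M0_def)
  define S where "S = {v\<in>verts M. c v = 2}"
  have edge: "\<exists>a b. e = {a, b} \<and> a \<in> verts M \<and> b \<in> verts M \<and> c a = 2 \<and> c b = 1" if e: "e \<in> edges M" for e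
  proof -
    have "card e = 2" "e \<subseteq> verts M" using sM e by (auto simp: simple_graph_def)
    then obtain a b where ab: "e = {a, b}" "a \<in> verts M" "b \<in> verts M" by (auto simp: card_2_iff)
    have "{a, b} \<in> E" using EM e ab by auto
    then have "c a \<noteq> 0" "c b \<noteq> 0" "c a \<noteq> c b"
      using proper_3_colouringD(2)[OF c, of a b] by (auto simp: E_def)
    moreover have "c a = 0 \<or> c a = 1 \<or> c a = 2" "c b = 0 \<or> c b = 1 \<or> c b = 2"
      using proper_3_colouringD(1)[OF c] ab EM by blast+
    ultimately show ?thesis using ab by (metis insert_commute)
  qed
  have "independent_set M S"
    unfolding independent_set_def S_def using edge by (fastforce simp: doubleton_eq_iff)
  moreover have "\<forall>e\<in>edges M. S \<inter> e \<noteq> {}" using edge by (fastforce simp: S_def)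
  ultimately have "q_graph M \<le> card S"
    unfolding q_graph_def by (intro nat_Inf_le) auto
  also have "card S \<le> card (colour_class H c 2)"
    using EM finH by (intro card_mono) (auto simp: S_def colour_class_def)
  finally have "q_graph M \<le> card (colour_class H c 2)" .
  moreover have "bipartition M S (verts M - S)"
    unfolding bipartition_def S_def using edge by fastforce
  then have "bipartite M" by (auto simp: bipartite_def)
  ultimately show ?thesis using fam by blast
qed

text \<open>An embedding into the host of an optimal bipartite member pulls back a colouring: 2 on
  an optimal cover \<open>S\<close>, 1 on the rest of \<open>M\<close> and on the padding, 0 on the
  joined part.\<close>

lemma q_family_attained:
  fixes H :: "nat graph"
  assumes H: "simple_graph H" and chi: "chromatic_number H = 3" and c: "proper_3_colouring H c"
  shows "\<exists>c. proper_3_colouring H c \<and> card (colour_class H c 2) \<le> q_family (decomposition_family {H})"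
proof -
  define t where "t = card (verts H)"
  have finH: "finite (verts H)" using H by (simp add: simple_graph_def)
  \<comment> \<open>\<open>Inf\<close> of the empty set is 0, so both infima need a nonempty set to
    be attained. For \<open>q_graph M\<close> one side of the bipartition is an independent
    cover.\<close>
  have "{q_graph G | G. G \<in> decomposition_family {H} \<and> bipartite G} \<noteq> {}"
    using q_family_le[OF assms] by blast
  from Inf_nat_def1[OF this] obtain M where M: "M \<in> decomposition_family {H}" "bipartite M"
    "q_family (decomposition_family {H}) = q_graph M"
    by (auto simp: q_family_def)
  have dec: "simple_graph M" "embeds H (host M t)"
    using M(1) by (auto simp: decomposition_family_def decomposes_iff[OF chi] t_def)
  obtain A B where AB: "A \<union> B = verts M" "A \<inter> B = {}"
    "\<And>e. e \<in> edges M \<Longrightarrow> \<exists>a\<in>A. \<exists>b\<in>B. e = {a, b}"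
    using M(2) by (auto simp: bipartite_def bipartition_def)
  have "independent_set M A"
    unfolding independent_set_def using AB by (fastforce simp: doubleton_eq_iff)
  moreover have "\<forall>e\<in>edges M. A \<inter> e \<noteq> {}" using AB by fastforce
  ultimately have "{card S | S. independent_set M S \<and> (\<forall>e \<in> edges M. S \<inter> e \<noteq> {})} \<noteq> {}" by blast
  from Inf_nat_def1[OF this] obtain S where S: "independent_set M S" "\<And>e. e \<in> edges M \<Longrightarrow> S \<inter> e \<noteq> {}"
    "q_graph M = card S"
    by (auto simp: q_graph_def)
  have finS: "finite S" using S(1) dec(1) finite_subset by (auto simp: independent_set_def simple_graph_def)
  obtain f where f: "inj_on f (verts H)" "f ` verts H \<subseteq> verts (host M t)"
    "\<And>e. e \<in> edges H \<Longrightarrow> f ` e \<in> edges (host M t)"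
    using dec(2) by (auto simp: embeds_def)
  define col :: "(nat + nat) + nat \<Rightarrow> nat" where
    "col x = (case x of Inl (Inl w) \<Rightarrow> if w \<in> S then 2 else 1 | Inl (Inr _) \<Rightarrow> 1 | Inr _ \<Rightarrow> 0)" for x
  have col_edge: "col x \<noteq> col y" if xy: "{x, y} \<in> edges (host M t)" for x y
  proof -
    consider e where "e \<in> edges M" "{x, y} = Inl ` Inl ` e" | u v where "{x, y} = {Inl u, Inr v}"
      using xy unfolding host_edges by blast
    then show ?thesis
    proof cases
      case 1
      have "card e = 2" using dec(1) 1(1) by (simp add: simple_graph_def)
      then obtain a b where ab: "e = {a, b}" by (auto simp: card_2_iff)
      have "(a \<in> S) \<noteq> (b \<in> S)"
        using S(1) S(2)[OF 1(1)] 1(1) ab by (auto simp: independent_set_def)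
      then show ?thesis using 1(2) ab by (auto simp: col_def doubleton_eq_iff)
    next
      case 2
      then show ?thesis by (auto simp: col_def doubleton_eq_iff split: sum.splits)
    qed
  qed
  have "proper_3_colouring H (col \<circ> f)"
    unfolding proper_3_colouring_def
  proof (intro conjI allI impI)
    show "(col \<circ> f) ` verts H \<subseteq> {..<3}" by (auto simp: col_def split: sum.splits)
    fix u v assume "{u, v} \<in> edges H"
    from f(3)[OF this] show "(col \<circ> f) u \<noteq> (col \<circ> f) v" using col_edge[of "f u" "f v"] by simp
  qed
  moreover have "card (colour_class H (col \<circ> f) 2) \<le> card S"
  proof -
    have "card (colour_class H (col \<circ> f) 2) = card (f ` colour_class H (col \<circ> f) 2)"
      using inj_on_subset[OF f(1)] by (subst card_image) (auto simp: colour_class_def)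
    also have "\<dots> \<le> card ((Inl \<circ> Inl) ` S :: ((nat + nat) + nat) set)"
    proof (intro card_mono)
      show "f ` colour_class H (col \<circ> f) 2 \<subseteq> (Inl \<circ> Inl) ` S"
      proof
        fix x assume "x \<in> f ` colour_class H (col \<circ> f) 2"
        then have "col x = 2" by (auto simp: colour_class_def)
        then show "x \<in> (Inl \<circ> Inl) ` S" by (auto simp: col_def split: sum.splits if_splits)
      qed
    qed (use finS in simp)
    also have "\<dots> \<le> card S" using finS by (rule card_image_le)
    finally show ?thesis .
  qed
  ultimately show ?thesis using M(3) S(3) by metis
qed

lemma q_family_min:
  fixes H :: "nat graph"
  assumes "simple_graph H" "chromatic_number H = 3" "proper_3_colouring H c"
  shows "q_family (decomposition_family {H}) \<le> card (colour_class H c 2)"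
proof -
  obtain M where "M \<in> decomposition_family {H}" "bipartite M" "q_graph M \<le> card (colour_class H c 2)"
    using q_family_le[OF assms] by blast
  moreover from this have "q_family (decomposition_family {H}) \<le> q_graph M"
    unfolding q_family_def by (intro nat_Inf_le) blast
  ultimately show ?thesis by linarith
qed

section \<open>Odd cycles\<close>

definition cycle_edges :: "'a list \<Rightarrow> 'a set set" where
  "cycle_edges xs = (\<lambda>i. {xs ! i, xs ! (Suc i mod length xs)}) ` {..<length xs}"

lemma cycle_graph_iff:
  "cycle_graph C \<longleftrightarrow> (\<exists>xs. distinct xs \<and> 3 \<le> length xs \<and> verts C = set xs \<and> edges C = cycle_edges xs)"
proof -
  have "{{xs ! i, xs ! (Suc i mod length xs)} | i. i < length xs} = cycle_edges xs" for xs :: "'a list"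
    by (auto simp: cycle_edges_def)
  then show ?thesis by (simp add: cycle_graph_def)
qed

lemma cycle_edges_rotate1: "cycle_edges (rotate1 xs) = cycle_edges xs"
proof (cases "xs = []")
  case False
  define n where "n = length xs"
  have n: "0 < n" using False by (simp add: n_def)
  have im: "(\<lambda>i. Suc i mod n) ` {..<n} = {..<n}"
  proof (intro equalityI subsetI)
    fix j assume j: "j \<in> {..<n}"
    show "j \<in> (\<lambda>i. Suc i mod n) ` {..<n}"
    proof (cases j)
      case 0
      then show ?thesis using n by (intro image_eqI[of _ _ "n - 1"]) auto
    next
      case (Suc i)
      then show ?thesis using j by (intro image_eqI[of _ _ i]) auto
    qed
  qed (use n in auto)
  have "cycle_edges (rotate1 xs) =
      (\<lambda>i. {xs ! (Suc i mod n), xs ! (Suc (Suc i mod n) mod n)}) ` {..<n}"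
    unfolding cycle_edges_def using n by (intro image_cong) (auto simp: nth_rotate1 n_def)
  also have "\<dots> = (\<lambda>i. {xs ! i, xs ! (Suc i mod n)}) ` (\<lambda>i. Suc i mod n) ` {..<n}"
    by (simp add: image_image)
  finally show ?thesis unfolding im by (simp add: cycle_edges_def n_def)
qed simp

lemma cycle_edges_rotate: "cycle_edges (rotate k xs) = cycle_edges xs"
  by (induction k) (simp_all add: rotate_def cycle_edges_rotate1)

lemma cycle_edges_rev: "cycle_edges (rev xs) = cycle_edges xs"
proof -
  define n where "n = length xs"
  \<comment> \<open>Edge \<open>i\<close> of the reversed list joins positions
    \<open>n - 1 - i\<close> and \<open>n - 2 - i\<close> of \<open>xs\<close>, so it is edge
    \<open>n - 2 - i\<close> there; the closing edge stays in place.\<close>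
  define \<sigma> where "\<sigma> i = (if Suc i = n then i else n - 2 - i)" for i
  have im: "\<sigma> ` {..<n} = {..<n}"
  proof (intro equalityI subsetI)
    fix j assume j: "j \<in> {..<n}"
    have "\<sigma> (\<sigma> j) = j" "\<sigma> j \<in> {..<n}" using j by (auto simp: \<sigma>_def)
    then show "j \<in> \<sigma> ` {..<n}" by (metis image_eqI)
  qed (auto simp: \<sigma>_def)
  have "cycle_edges (rev xs) = (\<lambda>i. {xs ! \<sigma> i, xs ! (Suc (\<sigma> i) mod n)}) ` {..<n}"
    unfolding cycle_edges_def length_rev n_def[symmetric]
  proof (intro image_cong refl)
    fix i assume i: "i \<in> {..<n}"
    show "{rev xs ! i, rev xs ! (Suc i mod n)} = {xs ! \<sigma> i, xs ! (Suc (\<sigma> i) mod n)}"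
    proof (cases "Suc i = n")
      case True
      then have "i = n - 1" "0 < n" by auto
      then have "rev xs ! i = xs ! 0" "rev xs ! 0 = xs ! i" "\<sigma> i = i" "Suc i mod n = 0"
        by (auto simp: rev_nth n_def \<sigma>_def)
      then show ?thesis by (simp add: insert_commute)
    next
      case False
      then have lt: "Suc i < n" using i by simp
      have "rev xs ! i = xs ! Suc (n - 2 - i)" "rev xs ! Suc i = xs ! (n - 2 - i)"
        using lt by (auto simp: rev_nth n_def intro: arg_cong[of _ _ "(!) xs"])
      then show ?thesis using lt False by (simp add: \<sigma>_def insert_commute)
    qed
  qed
  also have "\<dots> = (\<lambda>i. {xs ! i, xs ! (Suc i mod n)}) ` \<sigma> ` {..<n}"
    by (simp add: image_image)
  finally show ?thesis unfolding im by (simp add: cycle_edges_def n_def)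
qed

text \<open>Rotation turns the given edge into the closing one, and reversal orients it. Colours can
  then be assigned by position along the path from \<open>a\<close> to \<open>b\<close>.\<close>

lemma cycle_as_path:
  assumes "cycle_graph C" "{a, b} \<in> edges C"
  shows "\<exists>ys. distinct ys \<and> 3 \<le> length ys \<and> verts C = set ys \<and> edges C = cycle_edges ys \<and>
    ys ! 0 = a \<and> ys ! (length ys - 1) = b"
proof -
  obtain xs where xs: "distinct xs" "3 \<le> length xs" "verts C = set xs" "edges C = cycle_edges xs"
    using assms(1) by (auto simp: cycle_graph_iff)
  define n where "n = length xs"
  have n: "3 \<le> n" using xs by (simp add: n_def)
  obtain i where i: "i < n" "{a, b} = {xs ! i, xs ! (Suc i mod n)}"
    using assms(2) unfolding xs(4) by (auto simp: cycle_edges_def n_def)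
  define ys where "ys = rotate (Suc i) xs"
  have ys: "distinct ys" "length ys = n" "verts C = set ys" "edges C = cycle_edges ys"
    using xs by (simp_all add: ys_def n_def cycle_edges_rotate del: rotate_Suc)
  have nth: "ys ! j = xs ! ((Suc i + j) mod n)" if "j < n" for j
    using that unfolding ys_def n_def by (rule nth_rotate)
  have "Suc i + (n - 1) = i + n" using n by simp
  then have ends: "ys ! 0 = xs ! (Suc i mod n)" "ys ! (n - 1) = xs ! i"
    using nth[of 0] nth[of "n - 1"] n i(1) by simp_all
  from i(2) have "ys ! 0 = a \<and> ys ! (n - 1) = b \<or> ys ! 0 = b \<and> ys ! (n - 1) = a"
    unfolding ends doubleton_eq_iff by blast
  then consider "ys ! 0 = a" "ys ! (n - 1) = b" | "ys ! 0 = b" "ys ! (n - 1) = a" by blast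
  then show ?thesis
  proof cases
    case 1
    then show ?thesis using ys n by (intro exI[of _ ys]) auto
  next
    case 2
    then have "rev ys ! 0 = a" "rev ys ! (n - 1) = b" using ys(2) n by (simp_all add: rev_nth)
    then show ?thesis using ys n by (intro exI[of _ "rev ys"]) (auto simp: cycle_edges_rev)
  qed
qed

lemma cycle_edge_indices:
  assumes "distinct ys" "{ys ! j, v} \<in> cycle_edges ys" "j < length ys"
  shows "\<exists>k<length ys. v = ys ! k \<and> (k = Suc j mod length ys \<or> j = Suc k mod length ys)"
proof -
  define n where "n = length ys"
  obtain i where i: "i < n" "{ys ! j, v} = {ys ! i, ys ! (Suc i mod n)}"
    using assms(2) by (auto simp: cycle_edges_def n_def)
  have "Suc i mod n < n" using i(1) by simp
  with i(2) consider "ys ! j = ys ! i" "v = ys ! (Suc i mod n)" | "ys ! j = ys ! (Suc i mod n)" "v = ys ! i"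
    by (auto simp: doubleton_eq_iff)
  then show ?thesis
  proof cases
    case 1
    then have "j = i" using assms i(1) by (simp add: n_def nth_eq_iff_index_eq)
    then show ?thesis using 1 \<open>Suc i mod n < n\<close> by (auto simp: n_def)
  next
    case 2
    then have "j = Suc i mod n" using assms \<open>Suc i mod n < n\<close> by (simp add: n_def nth_eq_iff_index_eq)
    then show ?thesis using 2 i(1) by (auto simp: n_def)
  qed
qed

text \<open>With colours 0 and 1 alone, the colour would follow the parity of the position, but the
  closing edge joins positions 0 and \<open>n - 1\<close>, both even.\<close>

lemma odd_cycle_hits_class2:
  assumes "cycle_graph C" "odd (card (verts C))"
    and g: "\<And>u v. {u, v} \<in> edges C \<Longrightarrow> g u \<noteq> g v" "\<And>v. v \<in> verts C \<Longrightarrow> g v = 0 \<or> g v = 1 \<or> g v = (2 :: nat)"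
  shows "\<exists>v\<in>verts C. g v = 2"
proof (rule ccontr)
  assume no: "\<not> ?thesis"
  obtain xs where xs: "distinct xs" "3 \<le> length xs" "verts C = set xs" "edges C = cycle_edges xs"
    using assms(1) by (auto simp: cycle_graph_iff)
  define n where "n = length xs"
  have n: "odd n" "3 \<le> n" using assms(2) xs by (auto simp: n_def distinct_card)
  have val: "g (xs ! i) = 0 \<or> g (xs ! i) = 1" if "i < n" for i
  proof -
    have "xs ! i \<in> verts C" using that xs(3) by (simp add: n_def)
    then show ?thesis using g(2)[of "xs ! i"] no by auto
  qed
  have adj: "g (xs ! i) \<noteq> g (xs ! (Suc i mod n))" if "i < n" for i
    by (rule g(1)) (use that in \<open>auto simp: xs(4) cycle_edges_def n_def\<close>)
  have "i < n \<Longrightarrow> (g (xs ! i) = g (xs ! 0)) \<longleftrightarrow> even i" for i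
  proof (induction i)
    case (Suc i)
    then show ?case using adj[of i] val[of i] val[of "Suc i"] val[of 0] by auto
  qed simp
  from this[of "n - 1"] adj[of "n - 1"] n show False by auto
qed

text \<open>The first clause keeps class 2 small and makes class 2 neighbours on one cycle coincide.
  The second is the other half of the matching property. The third confines contact between a class
  1 end of \<open>e\<close> and an interior vertex of class 2 to triangles, where goodness takes
  over.\<close>

definition sparse_class2 :: "'a graph \<Rightarrow> 'a set \<Rightarrow> ('a \<Rightarrow> nat) \<Rightarrow> bool" where
  "sparse_class2 C e g \<longleftrightarrow>
    (\<forall>v\<in>verts C. \<forall>v'\<in>verts C. g v = 2 \<and> g v' = 2 \<longrightarrow> v = v') \<and>
    (\<forall>x\<in>verts C - e. \<forall>v v'. g x = 2 \<and> {v, x} \<in> edges C \<and> {v', x} \<in> edges C \<and>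
      g v = 1 \<and> g v' = 1 \<longrightarrow> v = v') \<and>
    (\<forall>v\<in>e. \<forall>z\<in>verts C - e. {v, z} \<in> edges C \<and> g v = 1 \<and> g z = 2 \<longrightarrow> card (verts C) = 3)"

lemma sparse_class2D:
  assumes "sparse_class2 C e g"
  shows "v \<in> verts C \<Longrightarrow> v' \<in> verts C \<Longrightarrow> g v = 2 \<Longrightarrow> g v' = 2 \<Longrightarrow> v = v'"
    "x \<in> verts C - e \<Longrightarrow> g x = 2 \<Longrightarrow> {v, x} \<in> edges C \<Longrightarrow> {v', x} \<in> edges C \<Longrightarrow> g v = 1 \<Longrightarrow> g v' = 1 \<Longrightarrow> v = v'"
    "v \<in> e \<Longrightarrow> z \<in> verts C - e \<Longrightarrow> {v, z} \<in> edges C \<Longrightarrow> g v = 1 \<Longrightarrow> g z = 2 \<Longrightarrow> card (verts C) = 3"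
  using assms unfolding sparse_class2_def by blast+

text \<open>Along the path of the cycle that avoids the edge \<open>e\<close>, the colouring alternates between 0 and 1,
  except that colour 2 is used once in the interior if it is used at neither end of \<open>e\<close>.\<close>

lemma cycle_colouring:
  assumes C: "cycle_graph C" "odd (card (verts C))" "{a, b} \<in> edges C"
    and ab: "(\<alpha>, \<beta>) \<in> {(2, 0), (2, 1), (0, 1 :: nat)}"
  shows "\<exists>g. g a = \<alpha> \<and> g b = \<beta> \<and> (\<forall>v. g v < 3) \<and> (\<forall>u v. {u, v} \<in> edges C \<longrightarrow> g u \<noteq> g v) \<and>
    sparse_class2 C {a, b} g"
proof -
  obtain ys where ys: "distinct ys" "3 \<le> length ys" "verts C = set ys" "edges C = cycle_edges ys"
    "ys ! 0 = a" "ys ! (length ys - 1) = b"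
    using cycle_as_path[OF C(1,3)] by blast
  define n where "n = length ys"
  have n: "odd n" "3 \<le> n" using C(2) ys by (auto simp: n_def distinct_card)
  have inj: "inj_on ((!) ys) {..<n}" using ys(1) by (simp add: inj_on_nth n_def)
  define pos where "pos = the_inv_into {..<n} ((!) ys)"
  have pos: "pos (ys ! i) = i" if "i < n" for i
    unfolding pos_def using that by (intro the_inv_into_f_f[OF inj]) simp
  \<comment> \<open>Position \<open>n - 1\<close> is even and so receives \<open>\<beta>\<close>.
    For \<open>\<alpha> = 0\<close>, colour 2 sits next to \<open>a\<close>; its only neighbour of
    colour 1 is at position 2, which is \<open>b\<close> exactly in a triangle.\<close>
  define col where "col i = (if i = 0 then \<alpha> else if i = 1 \<and> \<alpha> = 0 then 2 else if even i then \<beta> else 1 - \<beta>)" for i :: nat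
  define g where "g v = col (pos v)" for v
  have g: "g (ys ! i) = col i" if "i < n" for i using pos[OF that] by (simp add: g_def)
  have obt: "\<exists>i<n. v = ys ! i" if "v \<in> verts C" for v
    using that ys(3) by (metis in_set_conv_nth n_def)
  have n1: "n - 1 < n" "n - 1 \<noteq> 0" "n - 1 \<noteq> 1" "even (n - 1)" using n by auto
  have ends: "g a = \<alpha>" "g b = \<beta>"
    using g[of 0] g[of "n - 1"] ys(5,6) n n1 by (auto simp: col_def n_def[symmetric])
  have colSuc: "col i \<noteq> col (Suc i)" for i
    using ab by (auto simp: col_def)
  have coln: "col (n - 1) \<noteq> col 0"
    using ab n1 by (auto simp: col_def)
  have col2: "i = (if \<alpha> = 2 then 0 else 1)" if "col i = 2" for i
    using that ab by (auto simp: col_def split: if_splits)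
  have proper: "g u \<noteq> g v" if uv: "{u, v} \<in> edges C" for u v
  proof -
    obtain i where i: "i < n" "{u, v} = {ys ! i, ys ! (Suc i mod n)}"
      using uv ys(4) by (auto simp: cycle_edges_def n_def)
    have "col i \<noteq> col (Suc i mod n)"
    proof (cases "Suc i = n")
      case True
      then show ?thesis using coln by auto
    next
      case False
      then show ?thesis using colSuc i(1) by simp
    qed
    then have "g (ys ! i) \<noteq> g (ys ! (Suc i mod n))" using g i(1) by simp
    with i(2) show ?thesis by (auto simp: doubleton_eq_iff)
  qed
  have interior: "i \<noteq> 0 \<and> i \<noteq> n - 1" if "ys ! i \<notin> {a, b}" for i
    using that ys(5,6) by (cases "i = 0") (auto simp: n_def)
  show ?thesis
    unfolding sparse_class2_def
  proof (intro exI[of _ g] conjI ballI allI impI)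
    show "g a = \<alpha>" "g b = \<beta>" by (fact ends)+
    show "g v < 3" for v using ab by (auto simp: g_def col_def)
    show "g u \<noteq> g v" if "{u, v} \<in> edges C" for u v by (rule proper[OF that])
  next
    fix v v' assume v: "v \<in> verts C" "v' \<in> verts C" "g v = 2 \<and> g v' = 2"
    obtain i j where "i < n" "v = ys ! i" "j < n" "v' = ys ! j" using obt v by blast
    then show "v = v'" using v(3) col2[of i] col2[of j] g by metis
  next
    fix x v v'
    assume x: "x \<in> verts C - {a, b}"
      and *: "g x = 2 \<and> {v, x} \<in> edges C \<and> {v', x} \<in> edges C \<and> g v = 1 \<and> g v' = 1"
    obtain i where i: "i < n" "x = ys ! i" using obt x by blast
    have "i \<noteq> 0" "i \<noteq> n - 1" using interior[of i] x i by auto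
    moreover have "col i = 2" using * g i by simp
    ultimately have "i = 1" "\<alpha> \<noteq> 2" using col2[of i] by (auto split: if_splits)
    then have "\<alpha> = 0" using ab by auto
    have "v = ys ! 2" if "{v, x} \<in> edges C" "g v = 1" for v
    proof -
      have "{ys ! i, v} \<in> cycle_edges ys" using that(1) ys(4) i by (simp add: insert_commute)
      then obtain k where k: "k < n" "v = ys ! k" "k = Suc i mod n \<or> i = Suc k mod n"
        using cycle_edge_indices[OF ys(1), of i v] i(1) by (auto simp: n_def)
      have "col k = 1" using g k that(2) by simp
      then have "k \<noteq> 0" using \<open>\<alpha> = 0\<close> by (cases "k = 0") (auto simp: col_def)
      have "Suc i mod n = 2" using \<open>i = 1\<close> n by simp
      have "k = 2"
        using k(3)
      proof
        assume "i = Suc k mod n"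
        then have "Suc k mod n = 1" using \<open>i = 1\<close> by simp
        then have "k = 0" using k(1) by (cases "Suc k = n") auto
        then show ?thesis using \<open>k \<noteq> 0\<close> by simp
      qed (use \<open>Suc i mod n = 2\<close> in simp)
      then show ?thesis using k by simp
    qed
    then show "v = v'" using * by metis
  next
    fix v z assume v: "v \<in> {a, b}" and z: "z \<in> verts C - {a, b}"
      and *: "{v, z} \<in> edges C \<and> g v = 1 \<and> g z = 2"
    obtain i where i: "i < n" "z = ys ! i" using obt z by blast
    have "i \<noteq> 0" using interior[of i] z i by auto
    moreover have "col i = 2" using * g i by simp
    ultimately have "i = 1" "\<alpha> \<noteq> 2" using col2[of i] by (auto split: if_splits)
    then have "\<alpha> = 0" using ab by auto
    then have "v = b" using v * ends by auto
    then have "v = ys ! (n - 1)" using ys(6) by (simp add: n_def)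
    then have "{ys ! i, ys ! (n - 1)} \<in> cycle_edges ys" using * ys(4) i by (simp add: insert_commute)
    then obtain k where k: "k < n" "ys ! (n - 1) = ys ! k" "k = Suc i mod n \<or> i = Suc k mod n"
      using cycle_edge_indices[OF ys(1), of i "ys ! (n - 1)"] i(1) by (auto simp: n_def)
    then have "k = n - 1" using inj n1(1) by (auto simp: inj_on_def)
    then have "n = 3" using k(3) \<open>i = 1\<close> n by auto
    then show "card (verts C) = 3" using ys by (simp add: n_def distinct_card)
  qed
qed

section \<open>Odd-ballooning\<close>

lemma cycle_simple:
  assumes "cycle_graph C"
  shows "simple_graph C"
proof -
  obtain xs where xs: "distinct xs" "3 \<le> length xs" "verts C = set xs" "edges C = cycle_edges xs"
    using assms by (auto simp: cycle_graph_iff)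
  have "xs ! i \<noteq> xs ! (Suc i mod length xs)" "xs ! (Suc i mod length xs) \<in> set xs" if "i < length xs" for i
  proof -
    have "Suc i mod length xs < length xs" "Suc i mod length xs \<noteq> i"
      using that xs(2) by (auto simp: mod_Suc)
    then show "xs ! i \<noteq> xs ! (Suc i mod length xs)" "xs ! (Suc i mod length xs) \<in> set xs"
      using that xs(1) by (auto simp: nth_eq_iff_index_eq)
  qed
  then show ?thesis using xs(3,4) by (auto simp: simple_graph_def cycle_edges_def card_insert_if)
qed

locale ballooning =
  fixes F H :: "'a graph" and A B :: "'a set" and C :: "'a set \<Rightarrow> 'a graph"
  assumes simple_F: "simple_graph F" and bip: "bipartition F A B" and has_edge: "edges F \<noteq> {}"
    and balloon: "odd_ballooning_by F C H"
    and good: "\<And>e. e \<in> edges F \<Longrightarrow> card (verts (C e)) = 3 \<Longrightarrow> \<exists>b\<in>B. b \<in> e \<and> degree F b = 1"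
begin

abbreviation "cls \<equiv> colour_class H"

lemma cyc:
  assumes "e \<in> edges F"
  shows "cycle_graph (C e)" "odd (card (verts (C e)))" "e \<in> edges (C e)" "verts (C e) \<inter> verts F = e"
  using balloon assms by (auto simp: odd_ballooning_by_def)

text \<open>New vertices of distinct cycles differ, and a new vertex is outside \<open>F\<close>, so
  it cannot be an end of another edge of \<open>F\<close> either.\<close>

lemma interior_unique:
  assumes "e \<in> edges F" "e' \<in> edges F" "x \<in> verts (C e) - e" "x \<in> verts (C e')"
  shows "e' = e"
proof (rule ccontr)
  assume "e' \<noteq> e"
  then have "(verts (C e) - e) \<inter> (verts (C e') - e') = {}"
    using balloon assms by (auto simp: odd_ballooning_by_def)
  then have "x \<in> e'" using assms by blast
  then have "x \<in> verts F" using cyc(4)[OF assms(2)] by blast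
  then show False using assms cyc(4)[OF assms(1)] by blast
qed

lemma H_verts: "verts H = verts F \<union> (\<Union>e\<in>edges F. verts (C e))"
  using balloon by (simp add: odd_ballooning_by_def)

lemma H_edges: "edges H = (\<Union>e\<in>edges F. edges (C e))"
proof -
  have "edges H = edges F \<union> (\<Union>e\<in>edges F. edges (C e))"
    using balloon by (simp add: odd_ballooning_by_def)
  then show ?thesis using cyc(3) by blast
qed

lemma cyc_edge:
  assumes "e \<in> edges F" "{u, v} \<in> edges (C e)"
  shows "u \<in> verts (C e)" "v \<in> verts (C e)"
  using simple_graphD[OF cycle_simple[OF cyc(1)[OF assms(1)]] assms(2)] by auto

lemma simple_H: "simple_graph H"
  unfolding simple_graph_def
proof
  show "finite (verts H)"
    unfolding H_verts using simple_F finite_edges[OF simple_F] cycle_simple[OF cyc(1)]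
    by (auto simp: simple_graph_def)
  show "\<forall>e\<in>edges H. e \<subseteq> verts H \<and> card e = 2"
  proof
    fix d assume "d \<in> edges H"
    then obtain e where e: "e \<in> edges F" "d \<in> edges (C e)" unfolding H_edges by blast
    then have "d \<subseteq> verts (C e)" "card d = 2"
      using cycle_simple[OF cyc(1)[OF e(1)]] by (auto simp: simple_graph_def)
    then show "d \<subseteq> verts H \<and> card d = 2" using e(1) unfolding H_verts by blast
  qed
qed

lemma F_edge:
  assumes "e \<in> edges F"
  shows "\<exists>a b. a \<in> A \<and> b \<in> B \<and> e = {a, b}"
proof -
  have "\<exists>a\<in>A. \<exists>b\<in>B. e = {a, b}" using bip assms by (simp add: bipartition_def)
  then show ?thesis by blast
qed

lemma AB: "A \<union> B = verts F" "A \<inter> B = {}"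
  using bip by (auto simp: bipartition_def)

lemma edge_at_interior:
  assumes "{u, v} \<in> edges H" "e \<in> edges F" "u \<in> verts (C e) - e"
  shows "{u, v} \<in> edges (C e)"
proof -
  obtain e' where e': "e' \<in> edges F" "{u, v} \<in> edges (C e')" using assms(1) unfolding H_edges by blast
  then have "u \<in> verts (C e')" using cyc_edge by blast
  then have "e' = e" using interior_unique[OF assms(2) e'(1) assms(3)] by simp
  then show ?thesis using e' by simp
qed

text \<open>The only step that needs the odd-ballooning to be good.\<close>

lemma triangle_leaf:
  assumes "e \<in> edges F" "card (verts (C e)) = 3" "b \<in> e" "b \<in> B" "e' \<in> edges F" "b \<in> verts (C e')"
  shows "e' = e"
proof -
  obtain b' where b': "b' \<in> B" "b' \<in> e" "degree F b' = 1" using good[OF assms(1,2)] by blast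
  obtain a d where ad: "a \<in> A" "d \<in> B" "e = {a, d}" using F_edge[OF assms(1)] by blast
  then have "b' = b" using b' assms AB by auto
  then have "card (nbhd F b) = 1" using b' by (simp add: degree_def)
  then obtain w where w: "nbhd F b = {w}" by (auto simp: card_1_singleton_iff)
  have "b \<in> verts F" using assms(4) AB by auto
  then have "b \<in> e'" using cyc(4)[OF assms(5)] assms(6) by blast
  have *: "f = {b, w}" if f: "f \<in> edges F" "b \<in> f" for f
  proof -
    have "card f = 2" using simple_F f by (simp add: simple_graph_def)
    then obtain u where "f = {b, u}" using f by (auto simp: card_2_iff)
    then show ?thesis using w f by (auto simp: nbhd_def)
  qed
  show ?thesis using *[OF assms(5) \<open>b \<in> e'\<close>] *[OF assms(1,3)] by simp
qed

definition extension :: "('a \<Rightarrow> nat) \<Rightarrow> ('a \<Rightarrow> nat) \<Rightarrow> bool" where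
  "extension c c' \<longleftrightarrow> proper_3_colouring H c' \<and> (\<forall>v\<in>verts F. c' v = c v) \<and>
     (\<forall>e\<in>edges F. sparse_class2 (C e) e c')"

lemma extensionD:
  assumes "extension c c'"
  shows "proper_3_colouring H c'" "\<And>v. v \<in> verts F \<Longrightarrow> c' v = c v"
    "\<And>e. e \<in> edges F \<Longrightarrow> sparse_class2 (C e) e c'"
  using assms by (auto simp: extension_def)

text \<open>The colourings of the single cycles agree with \<open>c\<close> on \<open>F\<close>, and
  outside \<open>F\<close> the cycles are disjoint, so they fit together.\<close>

lemma colouring_extends:
  assumes c: "proper_3_colouring F c"
  shows "\<exists>c'. extension c c'"
proof -
  define P where "P e g \<longleftrightarrow> (\<forall>v\<in>e. g v = c v) \<and> (\<forall>v. g v < 3) \<and>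
    (\<forall>u v. {u, v} \<in> edges (C e) \<longrightarrow> g u \<noteq> g v) \<and> sparse_class2 (C e) e g"
    for e and g :: "'a \<Rightarrow> nat"
  have "\<exists>g. P e g" if e: "e \<in> edges F" for e
  proof -
    obtain a b where ab: "a \<in> A" "b \<in> B" "e = {a, b}" using F_edge[OF e] by blast
    \<comment> \<open>\<open>cycle_colouring\<close> handles three of the six ordered pairs of
      distinct colours; exchanging the ends of \<open>e\<close> gives the others.\<close>
    have *: "\<exists>g. P e g" if eab: "e = {a, b}" and cab: "(c a, c b) \<in> {(2, 0), (2, 1), (0, 1 :: nat)}" for a b
    proof -
      have "{a, b} \<in> edges (C e)" using cyc(3)[OF e] eab by simp
      from cycle_colouring[OF cyc(1,2)[OF e] this cab] obtain g where g:
        "g a = c a \<and> g b = c b \<and> (\<forall>v. g v < 3) \<and> (\<forall>u v. {u, v} \<in> edges (C e) \<longrightarrow> g u \<noteq> g v) \<and>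
        sparse_class2 (C e) {a, b} g"
        by (elim exE) (rule that)
      have "\<forall>v\<in>e. g v = c v"
        using g[THEN conjunct1] g[THEN conjunct2, THEN conjunct1] by (simp add: eab)
      with g[folded eab] have "P e g" unfolding P_def by (elim conjE) (intro conjI; assumption)
      then show ?thesis by blast
    qed
    have "c a = 0 \<or> c a = 1 \<or> c a = 2" "c b = 0 \<or> c b = 1 \<or> c b = 2" "c a \<noteq> c b"
      using proper_3_colouringD[OF c] AB ab e by blast+
    then have "(c a, c b) \<in> {(2, 0), (2, 1), (0, 1)} \<or> (c b, c a) \<in> {(2, 0), (2, 1), (0, 1)}" by auto
    then show ?thesis using *[of a b] *[of b a] ab(3) by (auto simp: insert_commute)
  qed
  then obtain G where G: "\<And>e. e \<in> edges F \<Longrightarrow> P e (G e)" by metis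
  define c' where "c' v = (if v \<in> verts F then c v else G (SOME e. e \<in> edges F \<and> v \<in> verts (C e)) v)" for v
  have loc: "c' v = G e v" if e: "e \<in> edges F" and v: "v \<in> verts (C e)" for e v
  proof (cases "v \<in> verts F")
    case True
    then have "v \<in> e" using cyc(4)[OF e] v by blast
    then show ?thesis using G[OF e] True by (simp add: c'_def P_def)
  next
    case False
    have "e \<subseteq> verts F" using e simple_F by (auto simp: simple_graph_def)
    then have int: "v \<in> verts (C e) - e" using v False by blast
    have "(SOME e. e \<in> edges F \<and> v \<in> verts (C e)) = e"
    proof (rule some_equality)
      show "e \<in> edges F \<and> v \<in> verts (C e)" using e v by blast
      show "e' = e" if "e' \<in> edges F \<and> v \<in> verts (C e')" for e'
        by (rule interior_unique[OF e _ int]) (use that in blast)+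
    qed
    then show ?thesis using False by (simp add: c'_def)
  qed
  have sub: "e \<subseteq> verts (C e)" if "e \<in> edges F" for e using cyc(4)[OF that] by blast
  show ?thesis
    unfolding extension_def sparse_class2_def
  proof (intro exI[of _ c'] conjI ballI allI impI)
    show "proper_3_colouring H c'"
      unfolding proper_3_colouring_def
    proof (intro conjI allI impI)
      show "c' ` verts H \<subseteq> {..<3}"
      proof
        fix y assume "y \<in> c' ` verts H"
        then obtain v where v: "v \<in> verts H" "y = c' v" by blast
        then consider "v \<in> verts F" | e where "e \<in> edges F" "v \<in> verts (C e)" unfolding H_verts by blast
        then show "y \<in> {..<3}"
        proof cases
          case 1
          then show ?thesis using v c by (auto simp: c'_def proper_3_colouring_def)
        next
          case 2
          then show ?thesis using v loc[OF 2] G[OF 2(1)] by (simp add: P_def)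
        qed
      qed
    next
      fix u v assume "{u, v} \<in> edges H"
      then obtain e where e: "e \<in> edges F" "{u, v} \<in> edges (C e)" unfolding H_edges by blast
      then show "c' u \<noteq> c' v" using loc[OF e(1)] cyc_edge[OF e] G[OF e(1)] by (simp add: P_def)
    qed
    show "c' v = c v" if "v \<in> verts F" for v using that by (simp add: c'_def)
  next
    fix e v v' assume "e \<in> edges F" "v \<in> verts (C e)" "v' \<in> verts (C e)" "c' v = 2 \<and> c' v' = 2"
    then show "v = v'" using G[of e] loc[of e] sparse_class2D(1) unfolding P_def by metis
  next
    fix e x v v' assume e: "e \<in> edges F" and x: "x \<in> verts (C e) - e"
      and *: "c' x = 2 \<and> {v, x} \<in> edges (C e) \<and> {v', x} \<in> edges (C e) \<and> c' v = 1 \<and> c' v' = 1"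
    have "v \<in> verts (C e)" "v' \<in> verts (C e)" using * cyc_edge[OF e] by blast+
    then show "v = v'" using * x G[OF e] loc[OF e] sparse_class2D(2) unfolding P_def by (metis DiffE)
  next
    fix e v z assume e: "e \<in> edges F" and vz: "v \<in> e" "z \<in> verts (C e) - e"
      and *: "{v, z} \<in> edges (C e) \<and> c' v = 1 \<and> c' z = 2"
    have "c' v = G e v" "c' z = G e z" using loc[OF e] vz sub[OF e] by auto
    then show "card (verts (C e)) = 3" using * vz G[OF e] sparse_class2D(3) unfolding P_def by metis
  qed
qed

lemma cycle_class2:
  assumes "proper_3_colouring H c" "e \<in> edges F"
  shows "\<exists>v\<in>verts (C e). c v = 2"
proof (rule odd_cycle_hits_class2[OF cyc(1,2)[OF assms(2)]])
  show "c u \<noteq> c v" if "{u, v} \<in> edges (C e)" for u v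
    using that assms H_edges proper_3_colouringD(2)[OF assms(1), of u v] by blast
  show "c v = 0 \<or> c v = 1 \<or> c v = 2" if "v \<in> verts (C e)" for v
    using that assms H_verts proper_3_colouringD(1)[OF assms(1), of v] by blast
qed

text \<open>Replace class 2 outside \<open>F\<close> by one interior vertex for each cycle whose edge it does not meet.\<close>

lemma class2_not_larger:
  assumes c: "proper_3_colouring H c" and c1: "\<And>v. v \<in> verts F \<Longrightarrow> c1 v = 2 \<longleftrightarrow> c v = 2"
    and c': "proper_3_colouring H c'" "\<And>v. v \<in> verts F \<Longrightarrow> c' v = c1 v"
    and uniq: "\<And>e. e \<in> edges F \<Longrightarrow> sparse_class2 (C e) e c'"
  shows "card (cls c' 2) \<le> card (cls c 2)"
proof -
  have ex: "\<exists>z e. e \<in> edges F \<and> x \<in> verts (C e) - e \<and> z \<in> verts (C e) - e \<and> c z = 2"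
    if x: "x \<in> cls c' 2" "x \<notin> verts F" for x
  proof -
    obtain e where e: "e \<in> edges F" "x \<in> verts (C e)"
      using x unfolding colour_class_def H_verts by blast
    have eF: "e \<subseteq> verts F" "e \<subseteq> verts (C e)" using cyc(4)[OF e(1)] by blast+
    obtain z where z: "z \<in> verts (C e)" "c z = 2" using cycle_class2[OF c e(1)] by blast
    have "z \<notin> e"
    proof
      assume "z \<in> e"
      then have "z \<in> verts F" using eF by blast
      then have "c' z = 2" using c1[of z] c'(2)[of z] z by simp
      then have "z = x" using sparse_class2D(1)[OF uniq[OF e(1)] z(1) e(2)] x(1) by (simp add: colour_class_def)
      then show False using \<open>z \<in> e\<close> eF x(2) by blast
    qed
    then show ?thesis using e z eF x(2) by blast
  qed
  define m where "m x = (if x \<in> verts F then x else SOME z. \<exists>e. e \<in> edges F \<and> x \<in> verts (C e) - e \<and> z \<in> verts (C e) - e \<and> c z = 2)" for x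
  have m: "\<exists>e. e \<in> edges F \<and> x \<in> verts (C e) - e \<and> m x \<in> verts (C e) - e \<and> c (m x) = 2"
    if "x \<in> cls c' 2" "x \<notin> verts F" for x
    using someI_ex[OF ex[OF that]] that(2) by (simp add: m_def)
  have mF: "m x = x" if "x \<in> verts F" for x using that by (simp add: m_def)
  have mnF: "m x \<notin> verts F" if "x \<in> cls c' 2" "x \<notin> verts F" for x
    using m[OF that] cyc(4) by blast
  have "inj_on m (cls c' 2)"
  proof (rule inj_onI)
    fix x y assume xy: "x \<in> cls c' 2" "y \<in> cls c' 2" "m x = m y"
    show "x = y"
    proof (cases "x \<in> verts F \<or> y \<in> verts F")
      case True
      then show ?thesis using mF mnF xy by metis
    next
      case False
      obtain e where e: "e \<in> edges F" "x \<in> verts (C e) - e" "m x \<in> verts (C e) - e" using m[OF xy(1)] False by blast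
      obtain e' where e': "e' \<in> edges F" "y \<in> verts (C e') - e'" "m y \<in> verts (C e') - e'" using m[OF xy(2)] False by blast
      have "e' = e" using interior_unique[OF e(1) e'(1) e(3)] e'(3) xy(3) by simp
      then show ?thesis using sparse_class2D(1)[OF uniq[OF e(1)]] e e' xy by (simp add: colour_class_def)
    qed
  qed
  moreover have "m ` cls c' 2 \<subseteq> cls c 2"
  proof
    fix z assume "z \<in> m ` cls c' 2"
    then obtain x where x: "x \<in> cls c' 2" "z = m x" by blast
    show "z \<in> cls c 2"
    proof (cases "x \<in> verts F")
      case True
      then show ?thesis using x mF c1 c'(2) by (simp add: colour_class_def)
    next
      case False
      then obtain e where "e \<in> edges F" "z \<in> verts (C e)" "c z = 2" using m[OF x(1)] x(2) by blast
      then show ?thesis unfolding colour_class_def H_verts by blast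
    qed
  qed
  moreover have "finite (cls c 2)"
    using simple_H by (simp add: colour_class_def simple_graph_def)
  ultimately show ?thesis by (metis card_image card_mono)
qed

end

context ballooning
begin

lemma class2_nonempty: "proper_3_colouring H c \<Longrightarrow> cls c 2 \<noteq> {}"
  using has_edge cycle_class2 unfolding colour_class_def H_verts by fastforce

lemma F_in_H:
  assumes "{u, v} \<in> edges F"
  shows "{u, v} \<in> edges H"
  using cyc(3)[OF assms] assms unfolding H_edges by blast

lemma proper_on_F:
  assumes "\<And>v. v \<in> verts F \<Longrightarrow> c v < 3" "\<And>a b. a \<in> A \<Longrightarrow> b \<in> B \<Longrightarrow> {a, b} \<in> edges F \<Longrightarrow> c a \<noteq> c b"
  shows "proper_3_colouring F c"
  unfolding proper_3_colouring_def
proof (intro conjI allI impI)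
  show "c ` verts F \<subseteq> {..<3}" using assms(1) by auto
  fix u v assume uv: "{u, v} \<in> edges F"
  obtain a b where ab: "a \<in> A" "b \<in> B" "{u, v} = {a, b}" using F_edge[OF uv] by blast
  then have "c a \<noteq> c b" using assms(2) uv by simp
  with ab(3) show "c u \<noteq> c v" by (auto simp: doubleton_eq_iff)
qed

text \<open>All of class 2 is interior. A vertex of class 1 that sees class 2 on two cycles lies in
  \<open>F\<close>, hence in \<open>B\<close>. The third clause of \<open>sparse_class2\<close> then
  makes one of these cycles a triangle, and \<open>triangle_leaf\<close> excludes the other.\<close>

lemma matching_colouring:
  "\<exists>c. matching_like H c"
proof -
  define c0 where "c0 v = (if v \<in> A then 0 else 1 :: nat)" for v
  have "proper_3_colouring F c0"
    by (rule proper_on_F) (use AB in \<open>auto simp: c0_def\<close>)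
  from colouring_extends[OF this] obtain c where ext: "extension c0 c" by blast
  note c = extensionD[OF ext]
  note sp = sparse_class2D[OF c(3)]
  have int: "\<exists>e. e \<in> edges F \<and> z \<in> verts (C e) - e" if z: "z \<in> cls c 2" for z
  proof -
    have "z \<notin> verts F" using z c(2)[of z] by (auto simp: colour_class_def c0_def split: if_splits)
    then obtain e where e: "e \<in> edges F" "z \<in> verts (C e)"
      using z unfolding colour_class_def H_verts by blast
    then show ?thesis using cyc(4)[OF e(1)] \<open>z \<notin> verts F\<close> by blast
  qed
  show ?thesis
    unfolding matching_like_def
  proof (intro exI[of _ c] conjI ballI impI)
    show "proper_3_colouring H c" by (fact c(1))
  next
    fix v z z' assume v: "v \<in> cls c 1" and z: "z \<in> cls c 2" "z' \<in> cls c 2"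
      and vz: "{v, z} \<in> edges H \<and> {v, z'} \<in> edges H"
    have col: "c v = 1" "c z = 2" "c z' = 2" using v z by (auto simp: colour_class_def)
    obtain e where e: "e \<in> edges F" "z \<in> verts (C e) - e" using int[OF z(1)] by blast
    obtain e' where e': "e' \<in> edges F" "z' \<in> verts (C e') - e'" using int[OF z(2)] by blast
    have edge: "{z, v} \<in> edges (C e)" "{z', v} \<in> edges (C e')"
      using edge_at_interior[OF _ e] edge_at_interior[OF _ e'] vz by (simp_all add: insert_commute)
    then have mem: "v \<in> verts (C e)" "v \<in> verts (C e')" using cyc_edge e e' by blast+
    have "e' = e"
    proof (cases "v \<in> e")
      case False
      show ?thesis by (rule interior_unique[OF e(1) e'(1) _ mem(2)]) (use False mem in blast)
    next
      case True
      have "v \<in> verts F" using True cyc(4)[OF e(1)] by blast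
      then have "c0 v = 1" using c(2)[of v] col(1) by simp
      then have "v \<notin> A" by (auto simp: c0_def)
      then have "v \<in> B" using \<open>v \<in> verts F\<close> AB by blast
      have "card (verts (C e)) = 3"
        by (rule sp(3)[OF e(1) True e(2) _ col(1,2)]) (use edge(1) in \<open>simp add: insert_commute\<close>)
      then show ?thesis by (rule triangle_leaf[OF e(1) _ True \<open>v \<in> B\<close> e'(1) mem(2)])
    qed
    then show "z = z'" using sp(1)[OF e(1), of z z'] e e' col by blast
  next
    fix z v v' assume z: "z \<in> cls c 2" and v: "v \<in> cls c 1" "v' \<in> cls c 1"
      and vz: "{v, z} \<in> edges H \<and> {v', z} \<in> edges H"
    obtain e where e: "e \<in> edges F" "z \<in> verts (C e) - e" using int[OF z] by blast
    have "{z, v} \<in> edges (C e)" "{z, v'} \<in> edges (C e)"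
      using edge_at_interior[OF _ e] vz by (simp_all add: insert_commute)
    then have edge: "{v, z} \<in> edges (C e)" "{v', z} \<in> edges (C e)" by (simp_all add: insert_commute)
    have col: "c v = 1" "c v' = 1" "c z = 2" using v z by (auto simp: colour_class_def)
    show "v = v'" by (rule sp(2)[OF e col(3) edge col(1,2)])
  qed
qed

text \<open>Let \<open>U\<close> be class 2 on \<open>F\<close>. If \<open>U\<close> covers \<open>F\<close>, give colour 0 to the rest of \<open>F\<close>. Otherwise use the
  bipartition of \<open>F\<close> outside \<open>U\<close> and let \<open>x\<close> be the vertex of colour 2 on the cycle of an uncovered edge.\<close>

lemma split_colouring:
  assumes c: "proper_3_colouring H c"
  shows "\<exists>c' x. split_at H c' x \<and> card (cls c' 2) \<le> card (cls c 2)"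
proof (cases "\<forall>e\<in>edges F. \<exists>v\<in>e. c v = 2")
  case True
  define c1 where "c1 v = (if c v = 2 then 2 else 0 :: nat)" for v
  have "proper_3_colouring F c1"
  proof (rule proper_on_F)
    fix a b assume ab: "{a, b} \<in> edges F"
    have "\<exists>v\<in>{a, b}. c v = 2" using True ab by blast
    moreover have "c a \<noteq> c b" by (rule proper_3_colouringD(2)[OF c F_in_H[OF ab]])
    ultimately show "c1 a \<noteq> c1 b" by (auto simp: c1_def)
  qed (simp add: c1_def)
  from colouring_extends[OF this] obtain c' where ext: "extension c1 c'" by blast
  note c' = extensionD[OF ext]
  note sp = sparse_class2D[OF c'(3)]
  have "card (cls c' 2) \<le> card (cls c 2)"
    by (rule class2_not_larger[OF c _ c']) (auto simp: c1_def)
  moreover obtain x where x: "x \<in> cls c' 2" using class2_nonempty[OF c'(1)] by blast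
  moreover have "z = x" if v: "v \<in> cls c' 1" and z: "z \<in> cls c' 2"
    and edge: "{v, x} \<in> edges H" "{v, z} \<in> edges H" for v z
  proof -
    \<comment> \<open>On \<open>F\<close> only colours 0 and 2 occur, so class 1 is interior and
      each of its vertices meets a single cycle. Hence any vertex of class 2 can serve as
      \<open>x\<close>.\<close>
    have "v \<notin> verts F" using v c'(2)[of v] by (auto simp: colour_class_def c1_def split: if_splits)
    then obtain e where e: "e \<in> edges F" "v \<in> verts (C e) - e"
      using v cyc(4) unfolding colour_class_def H_verts by blast
    have "{v, x} \<in> edges (C e)" "{v, z} \<in> edges (C e)" using edge_at_interior[OF _ e] edge by blast+
    then have "x \<in> verts (C e)" "z \<in> verts (C e)" using cyc_edge[OF e(1)] by blast+
    then show ?thesis using sp(1)[OF e(1), of z x] x z by (simp add: colour_class_def)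
  qed
  ultimately show ?thesis using c'(1) unfolding split_at_def by blast
next
  case False
  then obtain e0 where e0: "e0 \<in> edges F" "\<And>v. v \<in> e0 \<Longrightarrow> c v \<noteq> 2" by blast
  define c1 where "c1 v = (if c v = 2 then 2 else if v \<in> A then 0 else 1 :: nat)" for v
  have "proper_3_colouring F c1"
  proof (rule proper_on_F)
    fix a b assume ab: "a \<in> A" "b \<in> B" "{a, b} \<in> edges F"
    have "c a \<noteq> c b" by (rule proper_3_colouringD(2)[OF c F_in_H[OF ab(3)]])
    moreover have "b \<notin> A" using ab(2) AB by blast
    ultimately show "c1 a \<noteq> c1 b" using ab(1) by (simp add: c1_def)
  qed (simp add: c1_def)
  from colouring_extends[OF this] obtain c' where ext: "extension c1 c'" by blast
  note c' = extensionD[OF ext]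
  note sp = sparse_class2D[OF c'(3)]
  have "card (cls c' 2) \<le> card (cls c 2)"
    by (rule class2_not_larger[OF c _ c']) (auto simp: c1_def)
  moreover obtain x where x: "x \<in> verts (C e0)" "c' x = 2" using cycle_class2[OF c'(1) e0(1)] by blast
  have "e0 \<subseteq> verts F" using cyc(4)[OF e0(1)] by blast
  then have "x \<notin> e0" using x(2) c'(2)[of x] e0(2)[of x] by (auto simp: c1_def split: if_splits)
  then have xi: "x \<in> verts (C e0) - e0" using x by blast
  have "x \<in> cls c' 2" using x e0(1) unfolding colour_class_def H_verts by blast
  moreover have "z = x" if v: "v \<in> cls c' 1" and z: "z \<in> cls c' 2"
    and edge: "{v, x} \<in> edges H" "{v, z} \<in> edges H" for v z
  proof -
    have "{x, v} \<in> edges (C e0)"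
      by (rule edge_at_interior[OF _ e0(1) xi]) (use edge(1) in \<open>simp add: insert_commute\<close>)
    then have vx: "{v, x} \<in> edges (C e0)" by (simp add: insert_commute)
    have vC: "v \<in> verts (C e0)" by (rule cyc_edge(1)[OF e0(1) vx])
    have col: "c' v = 1" "c' z = 2" using v z by (auto simp: colour_class_def)
    obtain e where e: "e \<in> edges F" "{v, z} \<in> edges (C e)" using edge(2) unfolding H_edges by blast
    have mem: "v \<in> verts (C e)" "z \<in> verts (C e)" using cyc_edge[OF e] by blast+
    have "e = e0"
    proof (cases "v \<in> e0")
      case False
      show ?thesis by (rule interior_unique[OF e0(1) e(1) _ mem(1)]) (use False vC in blast)
    next
      case True
      then have "v \<in> verts F" using \<open>e0 \<subseteq> verts F\<close> by blast
      then have "c1 v = 1" using c'(2)[of v] col(1) by simp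
      then have "v \<notin> A" by (auto simp: c1_def split: if_splits)
      then have "v \<in> B" using \<open>v \<in> verts F\<close> AB by blast
      have "card (verts (C e0)) = 3" by (rule sp(3)[OF e0(1) True xi vx col(1) x(2)])
      then show ?thesis by (rule triangle_leaf[OF e0(1) _ True \<open>v \<in> B\<close> e(1) mem(1)])
    qed
    then show ?thesis using sp(1)[OF e0(1), of z x] mem(2) x col(2) by simp
  qed
  ultimately show ?thesis using c'(1) unfolding split_at_def by blast
qed

end

section \<open>From odd-balloonings to the theorem\<close>

lemma ballooning_forbidden:
  fixes F H :: "nat graph"
  assumes "ballooning F H A B C"
  shows "forbidden H (q_family (decomposition_family {H}))"
proof -
  interpret ballooning F H A B C by fact
  define q where "q = q_family (decomposition_family {H})"
  obtain c0 where c0: "proper_3_colouring H c0" using matching_colouring unfolding matching_like_def by (elim exE conjE) (rule that)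
  have chi: "chromatic_number H = 3"
    by (rule chromatic_number_eq_3[OF c0 class2_nonempty])
  have min: "q \<le> card (colour_class H c 2)" if "proper_3_colouring H c" for c
    unfolding q_def by (rule q_family_min[OF simple_H chi that])
  obtain c where c: "proper_3_colouring H c" "card (colour_class H c 2) \<le> q"
    using q_family_attained[OF simple_H chi c0, folded q_def] by (elim exE conjE) (rule that)
  have "finite (colour_class H c 2)"
    using simple_H by (simp add: colour_class_def simple_graph_def)
  then have "0 < card (colour_class H c 2)" using class2_nonempty[OF c(1)] by (simp add: card_gt_0_iff)
  then have "1 \<le> q" using c(2) by simp
  \<comment> \<open>\<open>split_colouring\<close> does not enlarge class 2, and \<open>q\<close> is
    the minimum, so its size is exactly \<open>q\<close>.\<close>
  have "\<exists>c x. split_at H c x \<and> card (colour_class H c 2) = q"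
  proof -
    obtain c' x where *: "split_at H c' x" "card (colour_class H c' 2) \<le> card (colour_class H c 2)"
      using split_colouring[OF c(1)] by (elim exE conjE) (rule that)
    then have "card (colour_class H c' 2) = q"
      using min[of c'] c(2) by (simp add: split_at_def)
    with *(1) show ?thesis by blast
  qed
  with simple_H \<open>1 \<le> q\<close> min matching_colouring show ?thesis
    unfolding q_def[symmetric] by unfold_locales
qed

text \<open>An edgeless graph embeds into every graph with enough vertices. This settles the case of
  edgeless \<open>F\<close> vacuously.\<close>

lemma extremal_edgeless_empty:
  fixes H :: "'a graph"
  assumes H: "finite (verts H)" "edges H = {}" and n: "card (verts H) \<le> n"
  shows "extremal n H = {}"
proof (rule ccontr)
  assume "extremal n H \<noteq> {}"
  then obtain G where G: "G \<in> extremal n H" by blast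
  note ex = extremalD[OF G]
  have "finite (verts G)" using ex(1) by (simp add: simple_graph_def)
  then obtain f where "inj_on f (verts H)" "f ` verts H \<subseteq> verts G"
    using inj_into[OF H(1), of "verts G"] ex(2) n by auto
  then have "embeds H G" using H(2) by (auto simp: embeds_def)
  then show False using ex(3) by simp
qed

lemma half_floor_ceiling:
  fixes a b m :: nat
  assumes "a + b = m" "a \<le> b + 1" "b \<le> a + 1"
  shows "int a \<in> {\<lfloor>real m / 2\<rfloor>, \<lceil>real m / 2\<rceil>}"
proof -
  consider "m = 2 * a" | "m + 1 = 2 * a" | "m = 2 * a + 1" using assms by linarith
  then show ?thesis
  proof cases
    case 1
    then have "real m / 2 = a" by simp
    then show ?thesis by simp
  next
    case 2
    then have "real m + 1 = 2 * real a" by linarith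
    then have "\<lceil>real m / 2\<rceil> = int a" by (intro ceiling_unique) auto
    then show ?thesis by simp
  next
    case 3
    then have "\<lfloor>real m / 2\<rfloor> = int a" by (intro floor_unique) auto
    then show ?thesis by simp
  qed
qed

definition balanced_structure :: "'a graph \<Rightarrow> nat \<Rightarrow> nat \<Rightarrow> nat \<Rightarrow> bool" where
  "balanced_structure G n q M \<longleftrightarrow> (\<exists>W S1 S2.
     verts G = W \<union> S1 \<union> S2 \<and> W \<inter> S1 = {} \<and> W \<inter> S2 = {} \<and> S1 \<inter> S2 = {} \<and>
     int (card W) = int q - 1 \<and>
     (\<forall>S \<in> {S1, S2}.
        int (card S) \<in> {\<lfloor>(real n - real q + 1) / 2\<rfloor>, \<lceil>(real n - real q + 1) / 2\<rceil>}) \<and>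
     (\<forall>S \<in> {S1, S2}. \<exists>S' \<subseteq> S. card (S - S') \<le> M \<and> (\<forall>v \<in> S'. nbhd G v = verts G - S)))"

lemma structured_balanced:
  assumes "finite (verts G)" "card (verts G) = n" and S: "structured G q M W S1 S2" and "M \<le> M'"
  shows "balanced_structure G n q M'"
proof -
  have parts: "W \<union> S1 \<union> S2 = verts G" "W \<inter> S1 = {}" "W \<inter> S2 = {}" "S1 \<inter> S2 = {}"
    and cards: "card W + 1 = q" "card S1 \<le> card S2 + 1" "card S2 \<le> card S1 + 1"
    and most: "\<And>S. S \<in> {S1, S2} \<Longrightarrow> \<exists>S'\<subseteq>S. card (S - S') \<le> M \<and> (\<forall>v\<in>S'. nbhd G v = verts G - S)"
    using S unfolding structured_def by blast+
  have fin: "finite W" "finite S1" "finite S2" using parts(1) assms(1) by (metis finite_Un)+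
  have "card (W \<union> S1 \<union> S2) = card W + card S1 + card S2"
    using parts fin by (subst card_Un_disjoint; simp add: Int_Un_distrib2 card_Un_disjoint)
  then have n_eq: "n = card W + (card S1 + card S2)"
    using parts(1) assms(2) by simp
  define m where "m = card S1 + card S2"
  have m: "real n - real q + 1 = real m" using n_eq cards(1) by (simp add: m_def)
  have size: "int (card S) \<in> {\<lfloor>real m / 2\<rfloor>, \<lceil>real m / 2\<rceil>}" if "S \<in> {S1, S2}" for S
    using that half_floor_ceiling[of "card S1" "card S2" m] half_floor_ceiling[of "card S2" "card S1" m] cards
    by (auto simp: m_def)
  have most': "\<exists>S'\<subseteq>S. card (S - S') \<le> M' \<and> (\<forall>v\<in>S'. nbhd G v = verts G - S)" if "S \<in> {S1, S2}" for S
    using most[OF that] \<open>M \<le> M'\<close> by (meson order_trans)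
  have cW: "int (card W) = int q - 1" using cards(1) by linarith
  show ?thesis
    unfolding m balanced_structure_def
  proof (rule exI[of _ W], rule exI[of _ S1], rule exI[of _ S2], intro conjI ballI)
    show "verts G = W \<union> S1 \<union> S2" using parts(1) by simp
  qed (fact parts cW | rule size most', assumption)+
qed

theorem theorem2p5:
  "\<exists>M :: nat \<Rightarrow> nat. \<forall>(F :: nat graph) A B (H :: nat graph).
     simple_graph F \<and> bipartition F A B \<and> card A \<le> card B \<and> good_odd_ballooning F B H \<longrightarrow>
     (let q = q_family (decomposition_family {H}) in
      \<exists>n\<^sub>0. \<forall>n \<ge> n\<^sub>0. \<forall>G \<in> extremal n H.
        \<exists>W S\<^sub>1 S\<^sub>2.
          verts G = W \<union> S\<^sub>1 \<union> S\<^sub>2 \<and> W \<inter> S\<^sub>1 = {} \<and> W \<inter> S\<^sub>2 = {} \<and> S\<^sub>1 \<inter> S\<^sub>2 = {} \<and>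
          int (card W) = int q - 1 \<and>
          (\<forall>S \<in> {S\<^sub>1, S\<^sub>2}.
             int (card S) \<in> {\<lfloor>(real n - real q + 1) / 2\<rfloor>, \<lceil>(real n - real q + 1) / 2\<rceil>}) \<and>
          (\<forall>S \<in> {S\<^sub>1, S\<^sub>2}. \<exists>S' \<subseteq> S.
             card (S - S') \<le> M (card (verts H)) \<and>
             (\<forall>v \<in> S'. nbhd G v = verts G - S)))"
proof -
  define Q where "Q q h M \<longleftrightarrow> (\<exists>N. \<forall>(G :: nat graph) n. extremal_like G n q h \<and> N \<le> n \<longrightarrow>
    (\<exists>W S1 S2. structured G q M W S1 S2))" for q h M
  define Mf where "Mf q h = (SOME M. Q q h M)" for q h
  have Mf: "Q q h (Mf q h)" for q h
    unfolding Mf_def by (rule someI_ex) (unfold Q_def, rule extremal_like_structure)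
  \<comment> \<open>The constant may depend on \<open>card (verts H)\<close> only, and
    \<open>q\<close> is at most that number, so the bounds for all \<open>q \<le> h\<close> are
    added up.\<close>
  define M where "M h = (\<Sum>q\<le>h. Mf q h)" for h
  show ?thesis
    unfolding Let_def balanced_structure_def[symmetric]
  proof (intro exI[of _ M] allI impI)
    fix F H :: "nat graph" and A B
    assume *: "simple_graph F \<and> bipartition F A B \<and> card A \<le> card B \<and> good_odd_ballooning F B H"
    then obtain C where C: "odd_ballooning_by F C H"
      "\<And>e. e \<in> edges F \<Longrightarrow> card (verts (C e)) = 3 \<Longrightarrow> \<exists>b\<in>B. b \<in> e \<and> degree F b = 1"
      by (auto simp: good_odd_ballooning_def)
    define q where "q = q_family (decomposition_family {H})"
    define h where "h = card (verts H)"
    show "\<exists>n\<^sub>0. \<forall>n\<ge>n\<^sub>0. \<forall>G\<in>extremal n H.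
        balanced_structure G n (q_family (decomposition_family {H})) (M (card (verts H)))"
      unfolding q_def[symmetric] h_def[symmetric]
    proof (cases "edges F = {}")
      case True
      then have "finite (verts H)" "edges H = {}"
        using C(1) * by (auto simp: odd_ballooning_by_def simple_graph_def)
      then show "\<exists>n\<^sub>0. \<forall>n\<ge>n\<^sub>0. \<forall>G\<in>extremal n H. balanced_structure G n q (M h)"
        using extremal_edgeless_empty[of H] by (intro exI[of _ h]) (simp add: h_def)
    next
      case False
      have "ballooning F H A B C"
        by unfold_locales (use * C False in auto)
      then interpret forbidden H q unfolding q_def by (rule ballooning_forbidden)
      have "q \<le> h" using q_le by (simp add: h_def)
      then have Mle: "Mf q h \<le> M h" unfolding M_def by (intro member_le_sum) auto
      from Mf[of q h] obtain N where N: "\<forall>(G :: nat graph) n. extremal_like G n q h \<and> N \<le> n \<longrightarrow>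
        (\<exists>W S1 S2. structured G q (Mf q h) W S1 S2)"
        unfolding Q_def by (elim exE) (rule that)
      show "\<exists>n\<^sub>0. \<forall>n\<ge>n\<^sub>0. \<forall>G\<in>extremal n H. balanced_structure G n q (M h)"
      proof (rule exI[of _ "N + q"], intro allI impI ballI)
        fix n G assume n: "N + q \<le> n" and G: "G \<in> extremal n H"
        have "extremal_like G n q h" unfolding h_def by (rule extremal_like[OF G]) (use n in simp)
        then have "extremal_like G n q h \<and> N \<le> n" using n by simp
        from N[rule_format, OF this] obtain W S1 S2 where "structured G q (Mf q h) W S1 S2"
          by (elim exE) (rule that)
        then show "balanced_structure G n q (M h)"
          using extremalD(1,2)[OF G] Mle by (intro structured_balanced) (simp_all add: simple_graph_def)
      qed
    qed
  qed
qed

end
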